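(* Fix $k\ge0$, and consider the pencil $\sigma=(f,g)$ of degree $k+3$ on $\mathbb{P}^3$ with $$f=x_0x_1^{k+2}+x_2^{k+3}+x_2^{k+2}x_3\quad\text{and}\quad g=x_2x_3(x_2^{k+1}-x_1^{k+1}).$$ Then $\mathcal{T}_\sigma\simeq N(-k-2)$, where $N$ is a null correlation bundle.
   Context: $\kappa$ is an algebraically closed field of characteristic zero and $f,g\in\kappa[x_0,x_1,x_2,x_3]$. $\mathcal{T}_\sigma:=\ker\big(\nabla\sigma:\mathcal{O}_{\mathbb{P}^3}^{\oplus4}\to\mathcal{O}_{\mathbb{P}^3}(k+2)^{\oplus2}\big)$, where $\nabla\sigma$ is the $2\times4$ Jacobian matrix of partial derivatives of $(f,g)$. A null correlation bundle on $\mathbb{P}^3$ is the cokernel of a nowhere vanishing morphism $\mathcal{O}_{\mathbb{P}^3}(-1)\to\Omega^1_{\mathbb{P}^3}(1)$; every slope-stable rank 2 locally free sheaf $N$ on $\mathbb{P}^3$ with $c_1(N)=0$, $c_2(N)=1$ arises in this way. *)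

theory Defs
  imports
    "HOL-Analysis.Finite_Cartesian_Product"
    "HOL-Library.Poly_Mapping"
    "HOL-Computational_Algebra.Polynomial"
    "HOL-Algebra.Module"
begin

section \<open>Polynomials in four variables\<close>

text \<open>
  A monomial is its exponent vector; the variables are indexed by the four-element
  numeral type, whose elements are \<open>0, 1, 2, 3\<close>.
\<close>

type_synonym 'a poly4 = "(4 \<Rightarrow>\<^sub>0 nat) \<Rightarrow>\<^sub>0 'a"

definition X :: "4 \<Rightarrow> 'a::field poly4" where
  "X i = Poly_Mapping.single (Poly_Mapping.single i 1) 1"

definition peval :: "'a::field poly4 \<Rightarrow> 'a ^ 4 \<Rightarrow> 'a" where
  "peval F v = (\<Sum>m\<in>Poly_Mapping.keys F.
     Poly_Mapping.lookup F m * (\<Prod>i\<in>UNIV. (v $ i) ^ Poly_Mapping.lookup m i))"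

definition partial_deriv :: "4 \<Rightarrow> 'a::field poly4 \<Rightarrow> 'a poly4" where
  "partial_deriv i F = (\<Sum>m\<in>Poly_Mapping.keys F.
     Poly_Mapping.single (m - Poly_Mapping.single i 1)
       (of_nat (Poly_Mapping.lookup m i) * Poly_Mapping.lookup F m))"

definition homogeneous :: "nat \<Rightarrow> 'a::field poly4 \<Rightarrow> bool" where
  "homogeneous d F \<longleftrightarrow>
     (\<forall>m\<in>Poly_Mapping.keys F. (\<Sum>i\<in>UNIV. Poly_Mapping.lookup m i) = d)"

lemma peval_superset:
  assumes "finite K" "Poly_Mapping.keys F \<subseteq> K"
  shows "peval F v = (\<Sum>m\<in>K.
     Poly_Mapping.lookup F m * (\<Prod>i\<in>UNIV. (v $ i) ^ Poly_Mapping.lookup m i))"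
  unfolding peval_def using assms
  by (intro sum.mono_neutral_left) (auto simp: in_keys_iff)

lemma peval_zero [simp]: "peval 0 v = 0"
  by (simp add: peval_def)

lemma peval_one [simp]: "peval 1 v = 1"
  by (simp add: peval_def lookup_one)

lemma peval_add: "peval (F + G) v = peval F v + peval G v"
proof -
  let ?K = "Poly_Mapping.keys F \<union> Poly_Mapping.keys G"
  have "Poly_Mapping.keys (F + G) \<subseteq> ?K"
    by (rule keys_add)
  then show ?thesis
    by (simp add: peval_superset[of ?K] lookup_add distrib_right sum.distrib)
qed

lemma peval_sum: "peval (sum F A) v = (\<Sum>a\<in>A. peval (F a) v)"
  by (induction A rule: infinite_finite_induct) (auto simp: peval_add)

lemma peval_single:
  "peval (Poly_Mapping.single m c) v = c * (\<Prod>i\<in>UNIV. (v $ i) ^ Poly_Mapping.lookup m i)"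
  by (cases "c = 0") (auto simp: peval_def)

lemma poly4_sum_monomials:
  "(F :: 'a::field poly4) =
     (\<Sum>m\<in>Poly_Mapping.keys F. Poly_Mapping.single m (Poly_Mapping.lookup F m))"
proof (rule poly_mapping_eqI)
  fix k
  have "(\<Sum>m\<in>Poly_Mapping.keys F.
           Poly_Mapping.lookup (Poly_Mapping.single m (Poly_Mapping.lookup F m)) k)
      = (\<Sum>m\<in>Poly_Mapping.keys F. if m = k then Poly_Mapping.lookup F k else 0)"
    by (intro sum.cong) (auto simp: lookup_single when_def)
  also have "\<dots> = Poly_Mapping.lookup F k"
    by (simp add: sum.delta in_keys_iff)
  finally show "Poly_Mapping.lookup F k = Poly_Mapping.lookup
      (\<Sum>m\<in>Poly_Mapping.keys F. Poly_Mapping.single m (Poly_Mapping.lookup F m)) k"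
    by (simp add: lookup_sum)
qed

lemma peval_mult: "peval (F * G) v = peval F v * peval G v"
proof -
  let ?l = Poly_Mapping.lookup and ?k = Poly_Mapping.keys
  have "F * G = (\<Sum>m\<in>?k F. Poly_Mapping.single m (?l F m)) *
                (\<Sum>n\<in>?k G. Poly_Mapping.single n (?l G n))"
    using poly4_sum_monomials by metis
  also have "\<dots> = (\<Sum>m\<in>?k F. \<Sum>n\<in>?k G. Poly_Mapping.single (m + n) (?l F m * ?l G n))"
    by (simp add: sum_product mult_single)
  finally show ?thesis
    by (simp add: peval_sum peval_single peval_def[of F] peval_def[of G] sum_product
        lookup_add power_add prod.distrib mult_ac)
qed

lemma homogeneous_mult:
  assumes "homogeneous d F" "homogeneous e G"
  shows "homogeneous (d + e) (F * G)"
  unfolding homogeneous_def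
proof
  fix m assume "m \<in> Poly_Mapping.keys (F * G)"
  then obtain a b where "m = a + b" "a \<in> Poly_Mapping.keys F" "b \<in> Poly_Mapping.keys G"
    using keys_mult[of F G] by blast
  then show "(\<Sum>i\<in>UNIV. Poly_Mapping.lookup m i) = d + e"
    using assms by (simp add: homogeneous_def lookup_add sum.distrib)
qed

lemma peval_scale:
  assumes "homogeneous d F"
  shows "peval F (c *s v) = c ^ d * peval F v"
proof -
  have "(\<Prod>i\<in>UNIV. ((c *s v) $ i) ^ Poly_Mapping.lookup m i) =
        c ^ d * (\<Prod>i\<in>UNIV. (v $ i) ^ Poly_Mapping.lookup m i)"
    if "m \<in> Poly_Mapping.keys F" for m
    using that assms
    by (auto simp: homogeneous_def power_mult_distrib prod.distrib power_sum[symmetric])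
  then show ?thesis
    unfolding peval_def sum_distrib_left by (intro sum.cong) (auto simp: mult_ac)
qed


section \<open>Projective 3-space with its Zariski topology\<close>

quotient_type (overloaded) 'a proj3 = "'a::field ^ 4" / partial:
  "\<lambda>v w. v \<noteq> 0 \<and> w \<noteq> 0 \<and> (\<exists>c. c \<noteq> 0 \<and> w = c *s v)"
  morphisms rep_proj3 pt
proof (rule part_equivpI)
  have "(1::'a ^ 4) \<noteq> 0 \<and> (\<exists>c::'a. c \<noteq> 0 \<and> (1::'a ^ 4) = c *s 1)"
    by (auto intro!: exI[of _ 1] simp: vec_eq_iff)
  then show "\<exists>v::'a ^ 4. v \<noteq> 0 \<and> v \<noteq> 0 \<and> (\<exists>c. c \<noteq> 0 \<and> v = c *s v)"
    by blast
  show "symp (\<lambda>v w::'a ^ 4. v \<noteq> 0 \<and> w \<noteq> 0 \<and> (\<exists>c. c \<noteq> 0 \<and> w = c *s v))"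
  proof (rule sympI)
    fix v w :: "'a ^ 4"
    assume vw: "v \<noteq> 0 \<and> w \<noteq> 0 \<and> (\<exists>c. c \<noteq> 0 \<and> w = c *s v)"
    then obtain c where "c \<noteq> 0" "w = c *s v" by blast
    then have "inverse c \<noteq> 0 \<and> v = inverse c *s w"
      by (simp add: vec_eq_iff)
    with vw show "w \<noteq> 0 \<and> v \<noteq> 0 \<and> (\<exists>c. c \<noteq> 0 \<and> v = c *s w)" by blast
  qed
  show "transp (\<lambda>v w::'a ^ 4. v \<noteq> 0 \<and> w \<noteq> 0 \<and> (\<exists>c. c \<noteq> 0 \<and> w = c *s v))"
  proof (rule transpI)
    fix u v w :: "'a ^ 4"
    assume a: "u \<noteq> 0 \<and> v \<noteq> 0 \<and> (\<exists>c. c \<noteq> 0 \<and> v = c *s u)"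
      and b: "v \<noteq> 0 \<and> w \<noteq> 0 \<and> (\<exists>c. c \<noteq> 0 \<and> w = c *s v)"
    then obtain c d where "c \<noteq> 0" "v = c *s u" "d \<noteq> 0" "w = d *s v" by blast
    then have "d * c \<noteq> 0 \<and> w = (d * c) *s u"
      by (simp add: vec_eq_iff mult.assoc)
    with a b show "u \<noteq> 0 \<and> w \<noteq> 0 \<and> (\<exists>c. c \<noteq> 0 \<and> w = c *s u)" by blast
  qed
qed

lemma pt_eq_iff:
  assumes "v \<noteq> 0" "w \<noteq> 0"
  shows "pt v = pt w \<longleftrightarrow> (\<exists>c. c \<noteq> 0 \<and> w = c *s v)"
proof -
  have refl: "\<exists>c. c \<noteq> 0 \<and> u = c *s u" for u :: "'a ^ 4"
    by (rule exI[of _ 1]) (simp add: vec_eq_iff)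
  show ?thesis
    using Quotient3_rel[OF Quotient3_proj3, of v w] assms refl by metis
qed

definition basic_open :: "'a::field poly4 \<Rightarrow> 'a proj3 set" where
  "basic_open F = {pt v | v. v \<noteq> 0 \<and> peval F v \<noteq> 0}"

lemma pt_in_basic_open_iff:
  assumes "homogeneous d F" "v \<noteq> 0"
  shows "pt v \<in> basic_open F \<longleftrightarrow> peval F v \<noteq> 0"
proof
  assume "pt v \<in> basic_open F"
  then obtain w where w: "w \<noteq> 0" "pt v = pt w" "peval F w \<noteq> 0"
    by (auto simp: basic_open_def)
  then obtain c where "c \<noteq> 0" "w = c *s v"
    using pt_eq_iff assms by metis
  with w show "peval F v \<noteq> 0"
    using peval_scale[OF assms(1)] by auto
qed (use assms in \<open>auto simp: basic_open_def\<close>)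

lemma basic_open_mult:
  assumes "homogeneous d F" "homogeneous e G"
  shows "basic_open (F * G) = basic_open F \<inter> basic_open G"
proof (rule subset_antisym; rule subsetI)
  fix p assume "p \<in> basic_open (F * G)"
  then show "p \<in> basic_open F \<inter> basic_open G"
    by (auto simp: basic_open_def peval_mult)
next
  fix p assume p: "p \<in> basic_open F \<inter> basic_open G"
  then obtain v where v: "v \<noteq> 0" "p = pt v" "peval F v \<noteq> 0"
    by (auto simp: basic_open_def)
  with p have "peval G v \<noteq> 0"
    using pt_in_basic_open_iff[OF assms(2)] by blast
  with v show "p \<in> basic_open (F * G)"
    by (auto simp: basic_open_def peval_mult)
qed

text \<open>Closed sets are the common zero loci of sets of homogeneous polynomials.\<close>

instantiation proj3 :: (field) topological_space
begin

definition open_proj3_def: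
  "open (U :: 'a proj3 set) \<longleftrightarrow>
     (\<exists>S. (\<forall>F\<in>S. \<exists>d. homogeneous d F) \<and> U = (\<Union>F\<in>S. basic_open F))"

instance
proof
  have "homogeneous 0 (1 :: 'a poly4)"
    by (simp add: homogeneous_def)
  moreover have "p \<in> basic_open 1" for p :: "'a proj3"
  proof -
    have "rep_proj3 p \<noteq> 0" "pt (rep_proj3 p) = p"
      using Quotient3_rep_reflp[OF Quotient3_proj3, of p]
        Quotient3_abs_rep[OF Quotient3_proj3, of p] by auto
    then show ?thesis
      unfolding basic_open_def by (auto intro!: exI[of _ "rep_proj3 p"])
  qed
  ultimately show "open (UNIV :: 'a proj3 set)"
    unfolding open_proj3_def by (intro exI[of _ "{1}"]) auto
next
  fix U V :: "'a proj3 set"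
  assume "open U" "open V"
  then obtain S T where S: "\<forall>F\<in>S. \<exists>d. homogeneous d F" "U = (\<Union>F\<in>S. basic_open F)"
    and T: "\<forall>F\<in>T. \<exists>d. homogeneous d F" "V = (\<Union>F\<in>T. basic_open F)"
    unfolding open_proj3_def by blast
  let ?R = "{F * G | F G. F \<in> S \<and> G \<in> T}"
  have "\<forall>H\<in>?R. \<exists>d. homogeneous d H"
    using S(1) T(1) homogeneous_mult by blast
  moreover have "basic_open (F * G) = basic_open F \<inter> basic_open G" if "F \<in> S" "G \<in> T" for F G
    using that S(1) T(1) basic_open_mult by blast
  then have "(\<Union>H\<in>?R. basic_open H) = (\<Union>F\<in>S. \<Union>G\<in>T. basic_open F \<inter> basic_open G)"
    by fastforce
  then have "U \<inter> V = (\<Union>H\<in>?R. basic_open H)"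
    unfolding S(2) T(2) by auto
  ultimately show "open (U \<inter> V)"
    unfolding open_proj3_def by blast
next
  fix K :: "'a proj3 set set"
  assume K: "\<forall>U\<in>K. open U"
  let ?R = "{F. (\<exists>d. homogeneous d F) \<and> basic_open F \<subseteq> \<Union>K}"
  have "\<Union>K \<subseteq> (\<Union>F\<in>?R. basic_open F)"
  proof
    fix p assume "p \<in> \<Union>K"
    then obtain U where U: "U \<in> K" "p \<in> U" by blast
    with K obtain S where "\<forall>F\<in>S. \<exists>d. homogeneous d F" "U = (\<Union>F\<in>S. basic_open F)"
      unfolding open_proj3_def by blast
    with U show "p \<in> (\<Union>F\<in>?R. basic_open F)" by blast
  qed
  then have eq: "\<Union>K = (\<Union>F\<in>?R. basic_open F)" by blast
  show "open (\<Union>K)"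
    unfolding open_proj3_def
  proof (rule exI, rule conjI)
    show "\<forall>F\<in>?R. \<exists>d. homogeneous d F" by simp
    show "\<Union>K = (\<Union>F\<in>?R. basic_open F)" by (rule eq)
  qed
qed

end

text \<open>The punctured affine cone over a set of points, and the affine charts.\<close>

definition cone :: "'a::field proj3 set \<Rightarrow> ('a ^ 4) set" where
  "cone U = {v. v \<noteq> 0 \<and> pt v \<in> U}"

definition chart :: "4 \<Rightarrow> 'a::field proj3 set" where
  "chart i = {pt v | v. v $ i \<noteq> 0}"


section \<open>The structure sheaf and sheaves of modules\<close>

definition regular_on :: "'a::field proj3 set \<Rightarrow> ('a proj3 \<Rightarrow> 'a) \<Rightarrow> bool" where
  "regular_on U s \<longleftrightarrow> (\<forall>p\<in>U. \<exists>V F G d. open V \<and> p \<in> V \<and> V \<subseteq> U \<and>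
     homogeneous d F \<and> homogeneous d G \<and>
     (\<forall>v\<in>cone V. peval G v \<noteq> 0 \<and> s (pt v) = peval F v / peval G v))"

definition structure_ring :: "'a::field proj3 set \<Rightarrow> ('a proj3 \<Rightarrow> 'a) ring" where
  "structure_ring U =
     \<lparr>carrier = {s \<in> extensional U. regular_on U s},
      mult = (\<lambda>s t. \<lambda>p\<in>U. s p * t p), one = (\<lambda>p\<in>U. 1),
      zero = (\<lambda>p\<in>U. 0), add = (\<lambda>s t. \<lambda>p\<in>U. s p + t p)\<rparr>"

text \<open>
  The record \<^typ>\<open>('a, 'b) module\<close> extends that of rings; for a module the fields
  \<open>mult\<close> and \<open>one\<close> carry no meaning.
\<close>

definition mk_module ::
  "'s set \<Rightarrow> 's \<Rightarrow> ('s \<Rightarrow> 's \<Rightarrow> 's) \<Rightarrow> ('r \<Rightarrow> 's \<Rightarrow> 's) \<Rightarrow> ('r, 's) module" where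
  "mk_module C z pl sm =
     \<lparr>carrier = C, mult = undefined, one = undefined, zero = z, add = pl, smult = sm\<rparr>"

text \<open>
  Raw data of a presheaf of modules over the structure sheaf; \<open>res F U V\<close> is the restriction
  map from sections over \<open>U\<close> to sections over \<open>V\<close>. Only the values at open sets matter.
\<close>

record (overloaded) ('a, 's) presheaf =
  sections :: "'a proj3 set \<Rightarrow> ('a proj3 \<Rightarrow> 'a, 's) module"
  res :: "'a proj3 set \<Rightarrow> 'a proj3 set \<Rightarrow> 's \<Rightarrow> 's"

abbreviation sec :: "('a, 's) presheaf \<Rightarrow> 'a proj3 set \<Rightarrow> 's set" where
  "sec F U \<equiv> carrier (sections F U)"

definition presheaf_of_modules :: "('a::field, 's) presheaf \<Rightarrow> bool" where
  "presheaf_of_modules F \<longleftrightarrow>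
     (\<forall>U. open U \<longrightarrow> Module.module (structure_ring U) (sections F U)) \<and>
     (\<forall>U V. open U \<and> open V \<and> V \<subseteq> U \<longrightarrow>
        res F U V \<in> sec F U \<rightarrow> sec F V \<and>
        (\<forall>s\<in>sec F U. \<forall>t\<in>sec F U.
           res F U V (s \<oplus>\<^bsub>sections F U\<^esub> t) = res F U V s \<oplus>\<^bsub>sections F V\<^esub> res F U V t) \<and>
        (\<forall>a\<in>carrier (structure_ring U). \<forall>s\<in>sec F U.
           res F U V (a \<odot>\<^bsub>sections F U\<^esub> s) = restrict a V \<odot>\<^bsub>sections F V\<^esub> res F U V s)) \<and>
     (\<forall>U. open U \<longrightarrow> (\<forall>s\<in>sec F U. res F U U s = s)) \<and>
     (\<forall>U V W. open U \<and> open V \<and> open W \<and> W \<subseteq> V \<and> V \<subseteq> U \<longrightarrow>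
        (\<forall>s\<in>sec F U. res F V W (res F U V s) = res F U W s))"

definition sheaf_of_modules :: "('a::field, 's) presheaf \<Rightarrow> bool" where
  "sheaf_of_modules F \<longleftrightarrow> presheaf_of_modules F \<and>
     (\<forall>C s. (\<forall>U\<in>C. open U \<and> s U \<in> sec F U) \<and>
        (\<forall>U\<in>C. \<forall>V\<in>C. res F U (U \<inter> V) (s U) = res F V (U \<inter> V) (s V)) \<longrightarrow>
        (\<exists>!t. t \<in> sec F (\<Union>C) \<and> (\<forall>U\<in>C. res F (\<Union>C) U t = s U)))"

definition sheaf_morphism ::
  "('a::field, 's) presheaf \<Rightarrow> ('a, 't) presheaf \<Rightarrow> ('a proj3 set \<Rightarrow> 's \<Rightarrow> 't) \<Rightarrow> bool" where
  "sheaf_morphism F G \<phi> \<longleftrightarrow>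
     (\<forall>U. open U \<longrightarrow>
        \<phi> U \<in> sec F U \<rightarrow> sec G U \<and>
        (\<forall>s\<in>sec F U. \<forall>t\<in>sec F U.
           \<phi> U (s \<oplus>\<^bsub>sections F U\<^esub> t) = \<phi> U s \<oplus>\<^bsub>sections G U\<^esub> \<phi> U t) \<and>
        (\<forall>a\<in>carrier (structure_ring U). \<forall>s\<in>sec F U.
           \<phi> U (a \<odot>\<^bsub>sections F U\<^esub> s) = a \<odot>\<^bsub>sections G U\<^esub> \<phi> U s)) \<and>
     (\<forall>U V. open U \<and> open V \<and> V \<subseteq> U \<longrightarrow>
        (\<forall>s\<in>sec F U. res G U V (\<phi> U s) = \<phi> V (res F U V s)))"

definition sheaf_isomorphic :: "('a::field, 's) presheaf \<Rightarrow> ('a, 't) presheaf \<Rightarrow> bool"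
    (infix \<open>\<simeq>\<^sub>s\<close> 50) where
  "F \<simeq>\<^sub>s G \<longleftrightarrow> (\<exists>\<phi>. sheaf_morphism F G \<phi> \<and>
     (\<forall>U. open U \<longrightarrow> bij_betw (\<phi> U) (sec F U) (sec G U)))"

text \<open>
  \<open>N\<close> is a cokernel of \<open>\<phi> : A \<rightarrow> B\<close> if there is an exact sequence
  \<open>A \<rightarrow> B \<rightarrow> N \<rightarrow> 0\<close> of sheaves; images of sheaf morphisms are formed locally.
\<close>

definition is_cokernel ::
  "('a::field, 's) presheaf \<Rightarrow> ('a, 't) presheaf \<Rightarrow> ('a proj3 set \<Rightarrow> 's \<Rightarrow> 't) \<Rightarrow>
   ('a, 'n) presheaf \<Rightarrow> bool" where
  "is_cokernel A B \<phi> N \<longleftrightarrow> sheaf_of_modules N \<and>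
     (\<exists>q. sheaf_morphism B N q \<and>
        (\<forall>U. open U \<longrightarrow> (\<forall>t\<in>sec N U. \<forall>p\<in>U. \<exists>V. open V \<and> p \<in> V \<and> V \<subseteq> U \<and>
           (\<exists>b\<in>sec B V. q V b = res N U V t))) \<and>
        (\<forall>U. open U \<longrightarrow> (\<forall>b\<in>sec B U. q U b = \<zero>\<^bsub>sections N U\<^esub> \<longleftrightarrow>
           (\<forall>p\<in>U. \<exists>V. open V \<and> p \<in> V \<and> V \<subseteq> U \<and> (\<exists>a\<in>sec A V. \<phi> V a = res B U V b)))))"

text \<open>
  A section \<open>s\<close> over \<open>U\<close> vanishes at \<open>p\<close> if it is zero in the fibre at \<open>p\<close>, i.e. if its germ
  lies in the maximal ideal of the local ring at \<open>p\<close> times the stalk.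
\<close>

definition vanishes_at ::
  "('a::field, 's) presheaf \<Rightarrow> 'a proj3 set \<Rightarrow> 's \<Rightarrow> 'a proj3 \<Rightarrow> bool" where
  "vanishes_at F U s p \<longleftrightarrow> (\<exists>V. open V \<and> p \<in> V \<and> V \<subseteq> U \<and>
     (\<exists>n a t. (\<forall>j<n::nat. a j \<in> carrier (structure_ring V) \<and> a j p = 0 \<and> t j \<in> sec F V) \<and>
        res F U V s = finsum (sections F V) (\<lambda>j. a j \<odot>\<^bsub>sections F V\<^esub> t j) {..<n}))"

text \<open>The map on fibres is nonzero at every point.\<close>

definition nowhere_vanishing ::
  "('a::field, 's) presheaf \<Rightarrow> ('a, 't) presheaf \<Rightarrow> ('a proj3 set \<Rightarrow> 's \<Rightarrow> 't) \<Rightarrow> bool" where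
  "nowhere_vanishing F G \<phi> \<longleftrightarrow>
     (\<forall>p. \<exists>U. open U \<and> p \<in> U \<and> (\<exists>s\<in>sec F U. \<not> vanishes_at G U (\<phi> U s) p))"

definition power_sheaf :: "('a, 's) presheaf \<Rightarrow> ('a, 'i \<Rightarrow> 's) presheaf" where
  "power_sheaf F =
     \<lparr>sections = (\<lambda>U. mk_module {s. \<forall>i. s i \<in> sec F U} (\<lambda>i. \<zero>\<^bsub>sections F U\<^esub>)
        (\<lambda>s t i. s i \<oplus>\<^bsub>sections F U\<^esub> t i) (\<lambda>a s i. a \<odot>\<^bsub>sections F U\<^esub> s i)),
      res = (\<lambda>U V s i. res F U V (s i))\<rparr>"

definition kernel_sheaf ::
  "('a, 's) presheaf \<Rightarrow> ('a, 't) presheaf \<Rightarrow> ('a proj3 set \<Rightarrow> 's \<Rightarrow> 't) \<Rightarrow> ('a, 's) presheaf" where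
  "kernel_sheaf F G \<phi> =
     F\<lparr>sections := (\<lambda>U. (sections F U)\<lparr>carrier := {s \<in> sec F U. \<phi> U s = \<zero>\<^bsub>sections G U\<^esub>}\<rparr>)\<rparr>"


section \<open>The sheaves $O$, $O(d)$ and twists\<close>

definition structure_sheaf :: "('a::field, 'a proj3 \<Rightarrow> 'a) presheaf" where
  "structure_sheaf =
     \<lparr>sections = (\<lambda>U. mk_module (carrier (structure_ring U)) \<zero>\<^bsub>structure_ring U\<^esub>
        (add (structure_ring U)) (mult (structure_ring U))),
      res = (\<lambda>U V s. restrict s V)\<rparr>"

text \<open>
  Sections of \<open>O(d)\<close> are the functions on the punctured cone that are locally quotients of
  homogeneous polynomials whose degrees differ by \<open>d\<close>.
\<close>

definition O_sheaf :: "int \<Rightarrow> ('a::field, 'a ^ 4 \<Rightarrow> 'a) presheaf" where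
  "O_sheaf d =
     \<lparr>sections = (\<lambda>U. mk_module
        {s \<in> extensional (cone U). \<forall>p\<in>U. \<exists>V F G m n. open V \<and> p \<in> V \<and> V \<subseteq> U \<and>
           homogeneous m F \<and> homogeneous n G \<and> int m - int n = d \<and>
           (\<forall>v\<in>cone V. peval G v \<noteq> 0 \<and> s v = peval F v / peval G v)}
        (\<lambda>v\<in>cone U. 0) (\<lambda>s t. \<lambda>v\<in>cone U. s v + t v) (\<lambda>a s. \<lambda>v\<in>cone U. a (pt v) * s v)),
      res = (\<lambda>U V s. restrict s (cone V))\<rparr>"

text \<open>
  The twist \<open>F(d) = F \<otimes> O(d)\<close>. On the chart where the \<open>i\<close>-th coordinate is invertible,
  \<open>O(d)\<close> is freely generated by the \<open>d\<close>-th power of that coordinate, so a section of \<open>F(d)\<close> is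
  a family of sections \<open>s i\<close> of \<open>F\<close> over the charts, standing for \<open>s i \<otimes> x\<^sub>i\<^sup>d\<close>, which are glued
  by \<open>s j = (x\<^sub>i / x\<^sub>j)\<^sup>d s i\<close>.
\<close>

definition transition :: "int \<Rightarrow> 4 \<Rightarrow> 4 \<Rightarrow> 'a::field proj3 \<Rightarrow> 'a" where
  "transition d i j p = (rep_proj3 p $ i / rep_proj3 p $ j) powi d"

definition twist :: "int \<Rightarrow> ('a::field, 's) presheaf \<Rightarrow> ('a, 4 \<Rightarrow> 's) presheaf" where
  "twist d F =
     \<lparr>sections = (\<lambda>U. mk_module
        {s. (\<forall>i. s i \<in> sec F (U \<inter> chart i)) \<and>
           (\<forall>i j. let W = U \<inter> chart i \<inter> chart j in
              res F (U \<inter> chart j) W (s j) =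
                restrict (transition d i j) W \<odot>\<^bsub>sections F W\<^esub> res F (U \<inter> chart i) W (s i))}
        (\<lambda>i. \<zero>\<^bsub>sections F (U \<inter> chart i)\<^esub>)
        (\<lambda>s t i. s i \<oplus>\<^bsub>sections F (U \<inter> chart i)\<^esub> t i)
        (\<lambda>a s i. restrict a (U \<inter> chart i) \<odot>\<^bsub>sections F (U \<inter> chart i)\<^esub> s i)),
      res = (\<lambda>U V s i. res F (U \<inter> chart i) (V \<inter> chart i) (s i))\<rparr>"


section \<open>The cotangent sheaf\<close>

definition regular_at :: "'a::field proj3 \<Rightarrow> ('a proj3 \<Rightarrow> 'a) \<Rightarrow> bool" where
  "regular_at p b \<longleftrightarrow> (\<exists>U. open U \<and> p \<in> U \<and> regular_on U b)"

text \<open>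
  The Zariski tangent space at \<open>p\<close>: derivations of the local ring at \<open>p\<close> into the residue field.
  Germs are represented by functions regular near \<open>p\<close>, so a derivation has to respect
  equality near \<open>p\<close>.
\<close>

definition tangent_space :: "'a::field proj3 \<Rightarrow> (('a proj3 \<Rightarrow> 'a) \<Rightarrow> 'a) set" where
  "tangent_space p = {D \<in> extensional {b. regular_at p b}.
     (\<forall>b c. regular_at p b \<and> regular_at p c \<longrightarrow>
        ((\<exists>U. open U \<and> p \<in> U \<and> (\<forall>q\<in>U. b q = c q)) \<longrightarrow> D b = D c) \<and>
        D (\<lambda>q. b q + c q) = D b + D c \<and>
        D (\<lambda>q. b q * c q) = b p * D c + c p * D b) \<and>
     (\<forall>r b. regular_at p b \<longrightarrow> D (\<lambda>q. r * b q) = r * D b)}"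

text \<open>
  Regular differential forms: a section assigns to every point a cotangent vector (a functional
  on the tangent space) and is locally of the form \<open>\<Sum>\<^sub>j a\<^sub>j db\<^sub>j\<close> with \<open>a\<^sub>j\<close> and \<open>b\<^sub>j\<close> regular.
  As projective space is smooth, this is the sheaf of Kaehler differentials.
\<close>

definition Omega1 ::
  "('a::field, 'a proj3 \<Rightarrow> (('a proj3 \<Rightarrow> 'a) \<Rightarrow> 'a) \<Rightarrow> 'a) presheaf" where
  "Omega1 =
     \<lparr>sections = (\<lambda>U. mk_module
        {\<omega> \<in> extensional U. \<forall>p\<in>U. \<omega> p \<in> extensional (tangent_space p) \<and>
           (\<exists>V n a b. open V \<and> p \<in> V \<and> V \<subseteq> U \<and>
              (\<forall>j<n::nat. regular_on V (a j) \<and> regular_on V (b j)) \<and>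
              (\<forall>q\<in>V. \<forall>D\<in>tangent_space q. \<omega> q D = (\<Sum>j<n. a j q * D (b j))))}
        (\<lambda>p\<in>U. \<lambda>D\<in>tangent_space p. 0)
        (\<lambda>\<omega> \<eta>. \<lambda>p\<in>U. \<lambda>D\<in>tangent_space p. \<omega> p D + \<eta> p D)
        (\<lambda>a \<omega>. \<lambda>p\<in>U. \<lambda>D\<in>tangent_space p. a p * \<omega> p D)),
      res = (\<lambda>U V \<omega>. restrict \<omega> V)\<rparr>"


section \<open>Null correlation bundles and the sheaf of a pencil\<close>

text \<open>
  The notion is invariant under isomorphism, and the type of sections of \<open>N\<close> is arbitrary; an
  assertion that some null correlation bundle exists has to name that type, which
  matters only up to being large enough.
\<close>

definition null_correlation_bundle :: "('a::field, 's) presheaf \<Rightarrow> bool" where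
  "null_correlation_bundle N \<longleftrightarrow>
     (\<exists>\<phi>. sheaf_morphism (O_sheaf (-1)) (twist 1 Omega1) \<phi> \<and>
        nowhere_vanishing (O_sheaf (-1)) (twist 1 Omega1 :: ('a, _) presheaf) \<phi> \<and>
        is_cokernel (O_sheaf (-1)) (twist 1 Omega1) \<phi> N)"

text \<open>The Jacobian matrix of \<open>\<sigma> = (f, g)\<close> as a map from \<open>O\<^sup>4\<close> to two copies of \<open>O(d)\<close>.\<close>

definition jacobian_map ::
  "'a::field poly4 \<times> 'a poly4 \<Rightarrow> 'a proj3 set \<Rightarrow> (4 \<Rightarrow> 'a proj3 \<Rightarrow> 'a) \<Rightarrow> (2 \<Rightarrow> 'a ^ 4 \<Rightarrow> 'a)" where
  "jacobian_map \<sigma> U s = (\<lambda>r. \<lambda>v\<in>cone U.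
     \<Sum>i\<in>UNIV. peval (partial_deriv i (if r = 0 then fst \<sigma> else snd \<sigma>)) v * s i (pt v))"

text \<open>Here \<open>f\<close> and \<open>g\<close> are homogeneous of degree \<open>k + 3\<close>.\<close>

definition T_sheaf ::
  "nat \<Rightarrow> 'a::field poly4 \<times> 'a poly4 \<Rightarrow> ('a, 4 \<Rightarrow> 'a proj3 \<Rightarrow> 'a) presheaf" where
  "T_sheaf k \<sigma> =
     kernel_sheaf (power_sheaf structure_sheaf) (power_sheaf (O_sheaf (int k + 2))) (jacobian_map \<sigma>)"

end

theory Submission
  imports Defs
begin

text \<open>
  Write \<open>x, y, z, w\<close> for the coordinates and \<open>r = (k + 2) / (k + 1)\<close>. All sheaves involved are
  described by functions on the punctured cone that are locally quotients of homogeneous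
  polynomials; the proof compares two such descriptions.

  A section of \<open>T\<^sub>\<sigma>(k + 2)\<close> is a vector \<open>(b\<^sub>0, b\<^sub>1, b\<^sub>2, b\<^sub>3)\<close> of functions of degree \<open>k + 2\<close> that the
  Jacobian matrix of \<open>(f, g)\<close> annihilates. Modulo a suitable coordinate an equation leaves a single
  term, so the entries can be divided by powers of coordinates one after the other
  (\<open>jacobian_syzygy_reduce\<close>). What is left is one equation
  \<open>y\<^sup>2 A + (r x y + z w) T + (k + 3) z\<^sup>2 C = 0\<close> in three functions of degree 1. Thus \<open>T\<^sub>\<sigma>(k + 2)\<close> is the
  kernel of the map from \<open>O(1)\<^sup>3\<close> to \<open>O(3)\<close> given by three quadrics, which cut out a double structure on
  the line \<open>y = z = 0\<close>.

  By the Euler sequence a section of \<open>\<Omega>(1)\<close> is a vector \<open>(e\<^sub>0, e\<^sub>1, e\<^sub>2, e\<^sub>3)\<close> of functions of degree 0 with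
  \<open>x e\<^sub>0 + y e\<^sub>1 + z e\<^sub>2 + w e\<^sub>3 = 0\<close>. Here the sheaf of differentials is defined by derivations of local
  rings, and the comparison rests on the fact that the derivations at a point are the combinations of
  the partial derivatives on the cone (\<open>tangent_expansion\<close>). There are three linear vector fields whose
  combination with the three quadrics as coefficients is \<open>- y z\<close> times the Euler field
  (\<open>quad_relation\<close>). Contraction with them maps \<open>\<Omega>(1)\<close> to the kernel above. This map is surjective
  (\<open>quadric_syzygy_lift\<close>), and its kernel is generated by the contact form
  \<open>r (y dx - x dy) + w dz - z dw\<close> (\<open>contact_kernel\<close>), whose coefficients have no common zero. Hence
  \<open>T\<^sub>\<sigma>(k + 2)\<close> is the cokernel of a nowhere vanishing map from \<open>O(-1)\<close> to \<open>\<Omega>(1)\<close>.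

  Finally \<open>T\<^sub>\<sigma>\<close> is recovered by twisting back, since the transition functions of opposite twists
  cancel (\<open>twist_untwist\<close>).
\<close>

section \<open>Polynomial functions\<close>

lemma peval_X [simp]: "peval (X i) v = v $ i"
proof -
  have "(\<Prod>j\<in>UNIV. (v $ j) ^ (1 when i = j)) = (\<Prod>j\<in>UNIV. if j = i then v $ j else 1)"
    by (rule prod.cong) (auto simp: when_def)
  then show ?thesis by (simp add: X_def peval_single lookup_single)
qed

lemma homogeneous_X: "homogeneous (Suc 0) (X i)"
  by (auto simp: homogeneous_def X_def lookup_single when_def)

lemma homogeneous_zero: "homogeneous d 0"
  by (simp add: homogeneous_def)

lemma homogeneous_const: "homogeneous 0 (Poly_Mapping.single 0 c)"
  by (simp add: homogeneous_def)

lemma homogeneous_one: "homogeneous 0 1"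
  by (simp add: homogeneous_def)

lemma homogeneous_add: "homogeneous d F \<Longrightarrow> homogeneous d G \<Longrightarrow> homogeneous d (F + G)"
  using keys_add[of F G] by (auto simp: homogeneous_def)

lemma homogeneous_X_power: "homogeneous m (X i ^ m)"
  by (induction m) (auto simp: homogeneous_one dest: homogeneous_mult[OF homogeneous_X])

lemma peval_power [simp]: "peval (F ^ m) v = peval F v ^ m"
  by (induction m) (auto simp: peval_mult)

lemma peval_const [simp]: "peval (Poly_Mapping.single 0 c) v = c"
  by (simp add: peval_single)

text \<open>
  Over an infinite field a polynomial is determined by its values. The divisibility arguments below
  work with values only, so that no computation with coefficients is needed.
\<close>

definition polyfun :: "('a::field ^ 4 \<Rightarrow> 'a) \<Rightarrow> bool" where
  "polyfun P \<longleftrightarrow> (\<exists>F. P = peval F)"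

lemma polyfun_peval [intro, simp]: "polyfun (peval F)"
  by (auto simp: polyfun_def)

lemma polyfun_const [intro, simp]: "polyfun (\<lambda>v. c)"
  unfolding polyfun_def by (rule exI[of _ "Poly_Mapping.single 0 c"]) auto

lemma polyfun_coord [intro, simp]: "polyfun (\<lambda>v. v $ i)"
  unfolding polyfun_def by (rule exI[of _ "X i"]) auto

lemma polyfun_add [intro]: "polyfun P \<Longrightarrow> polyfun Q \<Longrightarrow> polyfun (\<lambda>v. P v + Q v)"
  by (auto simp: polyfun_def peval_add[symmetric])

lemma polyfun_mult [intro]: "polyfun P \<Longrightarrow> polyfun Q \<Longrightarrow> polyfun (\<lambda>v. P v * Q v)"
  by (auto simp: polyfun_def peval_mult[symmetric])

lemma polyfun_minus [intro]: "polyfun P \<Longrightarrow> polyfun (\<lambda>v. - P v)"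
  using polyfun_mult[of "\<lambda>v. -1" P] by simp

lemma polyfun_diff [intro]: "polyfun P \<Longrightarrow> polyfun Q \<Longrightarrow> polyfun (\<lambda>v. P v - Q v)"
  using polyfun_add[of P "\<lambda>v. - Q v"] by auto

lemma polyfun_power [intro]: "polyfun P \<Longrightarrow> polyfun (\<lambda>v. P v ^ m)"
  by (induction m) (auto intro: polyfun_mult)

text \<open>
  The restriction of \<open>F\<close> to the line through \<open>v\<close> in direction \<open>u\<close>, as a polynomial in the parameter.
\<close>

definition line_poly :: "'a::field poly4 \<Rightarrow> 'a ^ 4 \<Rightarrow> 'a ^ 4 \<Rightarrow> 'a poly" where
  "line_poly F v u = (\<Sum>m\<in>Poly_Mapping.keys F. Polynomial.smult (Poly_Mapping.lookup F m)
     (\<Prod>i\<in>UNIV. [:v $ i, u $ i:] ^ Poly_Mapping.lookup m i))"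

lemma poly_line_poly: "poly (line_poly F v u) t = peval F (v + t *s u)"
  by (simp add: line_poly_def peval_def poly_sum poly_prod)

lemma poly_eqI_fun:
  fixes p q :: "'a::field_char_0 poly"
  assumes "\<And>t. poly p t = poly q t"
  shows "p = q"
  using assms poly_eq_poly_eq_iff by blast

text \<open>
  On the line joining a point where \<open>P\<close> does not vanish to such a point for \<open>Q\<close>, both functions are
  nonzero polynomials in one variable, and so is their product. The set \<open>E\<close> will be the whole space or a coordinate
  hyperplane.
\<close>

lemma polyfun_mult_zero:
  fixes P Q :: "'a::field_char_0 ^ 4 \<Rightarrow> 'a"
  assumes E: "\<And>v u t. v \<in> E \<Longrightarrow> u \<in> E \<Longrightarrow> v + t *s (u - v) \<in> E"
    and P: "polyfun P" and Q: "polyfun Q" and PQ: "\<And>v. v \<in> E \<Longrightarrow> P v * Q v = 0"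
  shows "(\<forall>v\<in>E. P v = 0) \<or> (\<forall>v\<in>E. Q v = 0)"
proof (rule ccontr)
  assume "\<not> ?thesis"
  then obtain v u where v: "v \<in> E" "P v \<noteq> 0" and u: "u \<in> E" "Q u \<noteq> 0" by blast
  obtain F G where F: "P = peval F" and G: "Q = peval G"
    using P Q by (auto simp: polyfun_def)
  let ?p = "line_poly F v (u - v)" and ?q = "line_poly G v (u - v)"
  have "poly (?p * ?q) t = 0" for t
    using PQ[OF E[OF v(1) u(1), of t]] by (simp add: poly_line_poly F G)
  then have "?p * ?q = 0"
    using poly_all_0_iff_0 by blast
  then have "?p = 0 \<or> ?q = 0" by simp
  moreover have "poly ?p 0 = P v" "poly ?q 1 = Q u"
    by (simp_all add: poly_line_poly F G)
  ultimately show False using v u by auto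
qed

lemma polyfun_cancel:
  fixes P Q :: "'a::field_char_0 ^ 4 \<Rightarrow> 'a"
  assumes "polyfun P" "polyfun Q" "\<And>v. P v * Q v = 0" "P w \<noteq> 0"
  shows "Q v = 0"
  using polyfun_mult_zero[of UNIV P Q] assms by auto

text \<open>
  The monomials of \<open>F\<close> without the \<open>i\<close>-th variable add up to the value of \<open>F\<close> at the projection to the
  hyperplane, which is zero; the others contain the variable as a factor.
\<close>

lemma homogeneous_divide_coord:
  assumes F: "homogeneous (Suc m) F" and van: "\<And>v. v $ i = 0 \<Longrightarrow> peval F v = 0"
  obtains F' where "homogeneous m F'" "\<And>v. peval F v = v $ i * peval F' v"
proof
  let ?l = Poly_Mapping.lookup and ?k = "Poly_Mapping.keys F"
  let ?A = "{a \<in> ?k. ?l a i > 0}" and ?B = "{a \<in> ?k. ?l a i = 0}"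
  let ?e = "Poly_Mapping.single i (1::nat)"
  let ?F' = "\<Sum>a\<in>?A. Poly_Mapping.single (a - ?e) (?l F a)"
  have sub: "a - ?e + ?e = a" if "?l a i > 0" for a
    by (rule poly_mapping_eqI) (use that in \<open>auto simp: lookup_add lookup_minus lookup_single when_def\<close>)
  show "homogeneous m ?F'"
    unfolding homogeneous_def
  proof
    fix b assume "b \<in> Poly_Mapping.keys ?F'"
    then have "b \<in> (\<Union>a\<in>?A. Poly_Mapping.keys (Poly_Mapping.single (a - ?e) (?l F a)))"
      using keys_sum[of "\<lambda>a. Poly_Mapping.single (a - ?e) (?l F a)" ?A] by blast
    then obtain a where a: "a \<in> ?A" "b = a - ?e" by (auto split: if_splits)
    then have "(\<Sum>j\<in>UNIV. ?l (b + ?e) j) = Suc m"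
      using F sub[of a] by (auto simp: homogeneous_def)
    then show "(\<Sum>j\<in>UNIV. ?l b j) = m"
      by (simp add: lookup_add sum.distrib lookup_single when_def)
  qed
  have split: "F = (\<Sum>a\<in>?B. Poly_Mapping.single a (?l F a)) + X i * ?F'" (is "F = ?F0 + _")
  proof -
    have "X i * Poly_Mapping.single (a - ?e) (?l F a) = Poly_Mapping.single a (?l F a)" if "a \<in> ?A" for a
      unfolding X_def mult_single using sub[of a] that by (simp add: add.commute del: One_nat_def)
    then have *: "X i * ?F' = (\<Sum>a\<in>?A. Poly_Mapping.single a (?l F a))"
      unfolding sum_distrib_left by (intro sum.cong) auto
    have "F = (\<Sum>a\<in>?k. Poly_Mapping.single a (?l F a))"
      by (rule poly4_sum_monomials)
    also have "\<dots> = (\<Sum>a\<in>?B \<union> ?A. Poly_Mapping.single a (?l F a))"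
      by (rule sum.cong) auto
    also have "\<dots> = ?F0 + (\<Sum>a\<in>?A. Poly_Mapping.single a (?l F a))"
      by (rule sum.union_disjoint) auto
    finally show ?thesis unfolding * .
  qed
  show "peval F v = v $ i * peval ?F' v" for v
  proof -
    define u where "u = (\<chi> j. if j = i then 0 else v $ j)"
    have "(v $ j) ^ ?l a j = (u $ j) ^ ?l a j" if "a \<in> ?B" for a j
      using that by (auto simp: u_def)
    then have "peval ?F0 v = peval ?F0 u"
      unfolding peval_sum peval_single by (intro sum.cong) auto
    moreover have "peval F u = peval ?F0 u + u $ i * peval ?F' u"
      by (subst split) (simp add: peval_add peval_mult)
    then have "peval ?F0 u = 0"
      using van[of u] by (simp add: u_def)
    ultimately show ?thesis
      by (subst split) (simp add: peval_add peval_mult)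
  qed
qed

lemma pderiv_of_sum: "pderiv (sum f A) = (\<Sum>i\<in>A. pderiv (f i))"
  by (induction A rule: infinite_finite_induct) (auto simp: pderiv_add)

lemma prod_const_polys: "(\<Prod>i\<in>A. [:f i:]) = [:\<Prod>i\<in>A. f i:]"
  by (induction A rule: infinite_finite_induct) (auto simp: one_pCons mult.commute)

text \<open>
  A partial derivative is the derivative along a coordinate line. This reduces the product rule to
  polynomials in one variable.
\<close>

lemma peval_partial_deriv:
  "peval (partial_deriv l F) v = poly (pderiv (line_poly F v (axis l 1))) 0"
proof -
  let ?l = Poly_Mapping.lookup
  have "peval (Poly_Mapping.single (m - Poly_Mapping.single l 1) (of_nat (?l m l) * c)) v =
      c * poly (pderiv (\<Prod>i\<in>UNIV. [:v $ i, axis l 1 $ i:] ^ ?l m i)) 0" for m c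
  proof -
    let ?r = "\<Prod>i\<in>UNIV-{l}. (v $ i) ^ ?l m i"
    have "(\<Prod>i\<in>UNIV. [:v $ i, axis l 1 $ i:] ^ ?l m i) =
        [:v $ l, 1:] ^ ?l m l * (\<Prod>i\<in>UNIV-{l}. [:v $ i, axis l 1 $ i:] ^ ?l m i)"
      by (subst prod.remove[of _ l]) (auto simp: axis_def)
    also have "(\<Prod>i\<in>UNIV-{l}. [:v $ i, axis l 1 $ i:] ^ ?l m i) = (\<Prod>i\<in>UNIV-{l}. [:(v $ i) ^ ?l m i:])"
      by (intro prod.cong) (auto simp: axis_def poly_const_pow)
    also have "\<dots> = [:?r:]"
      by (rule prod_const_polys)
    finally have "pderiv (\<Prod>i\<in>UNIV. [:v $ i, axis l 1 $ i:] ^ ?l m i) =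
        Polynomial.smult (of_nat (?l m l)) ([:v $ l, 1:] ^ (?l m l - 1)) * [:?r:]"
      by (simp add: pderiv_smult pderiv_power pderiv_pCons)
    then have "c * poly (pderiv (\<Prod>i\<in>UNIV. [:v $ i, axis l 1 $ i:] ^ ?l m i)) 0 =
       of_nat (?l m l) * c * ((v $ l) ^ (?l m l - 1) * ?r)"
      by (simp add: ac_simps)
    also have "(v $ l) ^ (?l m l - 1) * ?r =
        (\<Prod>i\<in>UNIV. (v $ i) ^ ?l (m - Poly_Mapping.single l 1) i)"
      by (subst prod.remove[of UNIV l]) (auto simp: lookup_minus lookup_single intro!: prod.cong)
    finally show ?thesis by (simp only: peval_single)
  qed
  then show ?thesis
    by (simp add: partial_deriv_def line_poly_def peval_sum pderiv_of_sum poly_sum pderiv_smult)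
qed

lemma line_poly_mult:
  fixes F :: "'a::field_char_0 poly4"
  shows "line_poly (F * G) v u = line_poly F v u * line_poly G v u"
  by (rule poly_eqI_fun) (simp add: poly_line_poly peval_mult)

lemma line_poly_add:
  fixes F :: "'a::field_char_0 poly4"
  shows "line_poly (F + G) v u = line_poly F v u + line_poly G v u"
  by (rule poly_eqI_fun) (simp add: poly_line_poly peval_add)

definition pd :: "4 \<Rightarrow> 'a::field poly4 \<Rightarrow> 'a ^ 4 \<Rightarrow> 'a" where
  "pd l F v = peval (partial_deriv l F) v"

lemma pd_cong:
  fixes F :: "'a::field_char_0 poly4"
  assumes "\<And>v. peval F v = peval G v"
  shows "pd l F v = pd l G v"
proof -
  have "line_poly F v (axis l 1) = line_poly G v (axis l 1)"
    by (rule poly_eqI_fun) (simp add: poly_line_poly assms)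
  then show ?thesis by (simp add: pd_def peval_partial_deriv)
qed

lemma pd_add:
  fixes F :: "'a::field_char_0 poly4"
  shows "pd l (F + G) v = pd l F v + pd l G v"
  by (simp add: pd_def peval_partial_deriv line_poly_add pderiv_add)

lemma pd_mult:
  fixes F :: "'a::field_char_0 poly4"
  shows "pd l (F * G) v = pd l F v * peval G v + peval F v * pd l G v"
  by (simp add: pd_def peval_partial_deriv line_poly_mult pderiv_mult poly_line_poly)

lemma pd_X: "pd l (X i) (v :: 'a::field_char_0 ^ 4) = (if i = l then 1 else 0)"
proof -
  have "line_poly (X i) v (axis l 1) = [:v $ i, axis l 1 $ i:]"
    by (rule poly_eqI_fun) (simp add: poly_line_poly)
  then show ?thesis by (simp add: pd_def peval_partial_deriv axis_def pderiv_pCons)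
qed

lemma pd_const: "pd l (Poly_Mapping.single 0 c) (v :: 'a::field_char_0 ^ 4) = 0"
proof -
  have "line_poly (Poly_Mapping.single 0 c) v (axis l 1) = [:c:]"
    by (rule poly_eqI_fun) (simp add: poly_line_poly)
  then show ?thesis by (simp add: pd_def peval_partial_deriv axis_def pderiv_pCons)
qed

lemma pd_power:
  fixes F :: "'a::field_char_0 poly4"
  shows "pd l (F ^ m) v = of_nat m * peval F v ^ (m - 1) * pd l F v"
proof (induction m)
  case 0
  then show ?case using pd_const[of l 1 v] by (simp add: single_one)
next
  case (Suc m)
  then show ?case by (cases m) (simp_all add: pd_mult peval_mult algebra_simps)
qed

lemma pd_uminus:
  fixes F :: "'a::field_char_0 poly4"
  shows "pd l (- F) v = - pd l F v"
  using pd_add[of l F "-F" v] pd_const[of l 0 v] by (simp add: eq_neg_iff_add_eq_0 add.commute)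

lemma pd_diff:
  fixes F :: "'a::field_char_0 poly4"
  shows "pd l (F - G) v = pd l F v - pd l G v"
  using pd_add[of l F "-G" v] by (simp add: pd_uminus)

lemma homogeneous_partial_deriv:
  assumes "homogeneous (Suc d) F"
  shows "homogeneous d (partial_deriv l F)"
  unfolding homogeneous_def
proof
  let ?l = Poly_Mapping.lookup and ?e = "Poly_Mapping.single l (1::nat)"
  fix b assume "b \<in> Poly_Mapping.keys (partial_deriv l F)"
  then have "b \<in> (\<Union>m\<in>Poly_Mapping.keys F. Poly_Mapping.keys (Poly_Mapping.single (m - ?e) (of_nat (?l m l) * ?l F m)))"
    unfolding partial_deriv_def
    using keys_sum[of "\<lambda>m. Poly_Mapping.single (m - ?e) (of_nat (?l m l) * ?l F m)" "Poly_Mapping.keys F"] by blast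
  then obtain m where m: "m \<in> Poly_Mapping.keys F" "b = m - ?e" "?l m l > 0"
    by (auto split: if_splits) (metis of_nat_0 gr0I)
  have "b + ?e = m"
    by (rule poly_mapping_eqI) (use m in \<open>auto simp: lookup_add lookup_minus lookup_single when_def\<close>)
  then have "(\<Sum>j\<in>UNIV. ?l (b + ?e) j) = Suc d"
    using assms m by (auto simp: homogeneous_def)
  then show "(\<Sum>j\<in>UNIV. ?l b j) = d"
    by (simp add: lookup_add sum.distrib lookup_single when_def)
qed

lemma euler_identity:
  fixes F :: "'a::field_char_0 poly4"
  assumes "homogeneous d F"
  shows "(\<Sum>l\<in>UNIV. v $ l * pd l F v) = of_nat d * peval F v"
proof -
  let ?l = Poly_Mapping.lookup
  have mono: "v $ l * peval (Poly_Mapping.single (m - Poly_Mapping.single l 1) (of_nat (?l m l) * c)) v =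
      of_nat (?l m l) * peval (Poly_Mapping.single m c) v" for l m c
  proof (cases "?l m l")
    case (Suc r)
    have "(\<Prod>i\<in>UNIV. (v $ i) ^ ?l m i) = v $ l * (\<Prod>i\<in>UNIV. (v $ i) ^ ?l (m - Poly_Mapping.single l 1) i)"
      by (subst (1 2) prod.remove[of UNIV l])
         (auto simp: lookup_minus lookup_single Suc intro!: prod.cong)
    then show ?thesis by (simp add: peval_single)
  qed simp
  have "(\<Sum>l\<in>UNIV. v $ l * pd l F v) =
      (\<Sum>m\<in>Poly_Mapping.keys F. \<Sum>l\<in>UNIV. of_nat (?l m l) * peval (Poly_Mapping.single m (?l F m)) v)"
    unfolding pd_def partial_deriv_def peval_sum sum_distrib_left
    by (subst sum.swap) (intro sum.cong refl mono)
  also have "\<dots> = (\<Sum>m\<in>Poly_Mapping.keys F. of_nat d * peval (Poly_Mapping.single m (?l F m)) v)"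
    using assms by (intro sum.cong) (auto simp: homogeneous_def simp flip: sum_distrib_right of_nat_sum)
  also have "\<dots> = of_nat d * peval F v"
    unfolding sum_distrib_left[symmetric] peval_sum[symmetric] poly4_sum_monomials[symmetric] ..
  finally show ?thesis .
qed

section \<open>Local quotients of polynomials\<close>

lemma rep_proj3_nonzero: "rep_proj3 p \<noteq> 0"
  using Quotient3_rep_reflp[OF Quotient3_proj3, of p] by auto

lemma pt_rep_proj3 [simp]: "pt (rep_proj3 p) = p"
  using Quotient3_abs_rep[OF Quotient3_proj3, of p] .

lemma rep_in_cone [simp]: "rep_proj3 p \<in> cone U \<longleftrightarrow> p \<in> U"
  by (simp add: cone_def rep_proj3_nonzero)

lemma rep_pt:
  assumes "v \<noteq> 0"
  obtains c where "c \<noteq> 0" "rep_proj3 (pt v) = c *s v"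
  using pt_eq_iff[OF assms rep_proj3_nonzero, of "pt v"] by auto

lemma cone_mono: "V \<subseteq> U \<Longrightarrow> cone V \<subseteq> cone U"
  by (auto simp: cone_def)

lemma cone_Int: "cone (U \<inter> V) = cone U \<inter> cone V"
  by (auto simp: cone_def)

lemma coneD: "v \<in> cone U \<Longrightarrow> v \<noteq> 0 \<and> pt v \<in> U"
  by (auto simp: cone_def)

lemma open_basic_open: "homogeneous d F \<Longrightarrow> open (basic_open F)"
  unfolding open_proj3_def by (rule exI[of _ "{F}"]) auto

lemma cone_basic_open: "homogeneous d F \<Longrightarrow> cone (basic_open F) = {v. v \<noteq> 0 \<and> peval F v \<noteq> 0}"
  by (auto simp: cone_def pt_in_basic_open_iff)

lemma chart_eq_basic_open: "chart i = basic_open (X i)"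
  by (auto simp: chart_def basic_open_def)

lemma open_chart [simp]: "open (chart i)"
  unfolding chart_eq_basic_open by (rule open_basic_open[OF homogeneous_X])

lemma cone_chart: "cone (chart i) = {v. v $ i \<noteq> 0}"
  unfolding chart_eq_basic_open cone_basic_open[OF homogeneous_X] by auto

lemma pt_in_chart: "v \<noteq> 0 \<Longrightarrow> pt v \<in> chart i \<longleftrightarrow> v $ i \<noteq> 0"
  unfolding chart_eq_basic_open by (simp add: pt_in_basic_open_iff[OF homogeneous_X])

lemma in_chart_iff: "p \<in> chart i \<longleftrightarrow> rep_proj3 p $ i \<noteq> 0"
  using pt_in_chart[OF rep_proj3_nonzero, of p i] by simp

lemma ex_chart: "\<exists>i. p \<in> chart i"
  using rep_proj3_nonzero[of p] by (auto simp: in_chart_iff vec_eq_iff)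

lemma open_contains_basic:
  assumes "open V" "p \<in> V"
  obtains H e where "homogeneous e H" "p \<in> basic_open H" "basic_open H \<subseteq> V"
  using assms unfolding open_proj3_def by blast

text \<open>
  The sections of \<open>O(d)\<close> over \<open>U\<close>, without a convention about the values outside the cone, so that
  the predicate applies to formulas.
\<close>

definition sect :: "int \<Rightarrow> 'a::field proj3 set \<Rightarrow> ('a ^ 4 \<Rightarrow> 'a) \<Rightarrow> bool" where
  "sect d U s \<longleftrightarrow> (\<forall>p\<in>U. \<exists>V F G m n. open V \<and> p \<in> V \<and> V \<subseteq> U \<and>
     homogeneous m F \<and> homogeneous n G \<and> int m - int n = d \<and>
     (\<forall>v\<in>cone V. peval G v \<noteq> 0 \<and> s v = peval F v / peval G v))"

text \<open>
  The same without homogeneity. Relations between sections mix several degrees; as long as only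
  their vanishing matters, this predicate avoids keeping track of them.
\<close>

definition rat :: "'a::field proj3 set \<Rightarrow> ('a ^ 4 \<Rightarrow> 'a) \<Rightarrow> bool" where
  "rat U s \<longleftrightarrow> (\<forall>p\<in>U. \<exists>V P Q. open V \<and> p \<in> V \<and> V \<subseteq> U \<and>
     polyfun P \<and> polyfun Q \<and> (\<forall>v\<in>cone V. Q v \<noteq> 0 \<and> s v = P v / Q v))"

lemma sect_defD:
  assumes "sect d U s" "p \<in> U"
  shows "\<exists>V F G m n. open V \<and> p \<in> V \<and> V \<subseteq> U \<and>
     homogeneous m F \<and> homogeneous n G \<and> int m - int n = d \<and>
     (\<forall>v\<in>cone V. peval G v \<noteq> 0 \<and> s v = peval F v / peval G v)"
  using assms unfolding sect_def by (rule bspec)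

lemma sect_cong:
  assumes "\<And>v. v \<in> cone U \<Longrightarrow> s v = t v"
  shows "sect d U s \<longleftrightarrow> sect d U t"
proof -
  have "sect d U t" if "sect d U s" and eq: "\<And>v. v \<in> cone U \<Longrightarrow> s v = t v" for s t
    unfolding sect_def
  proof
    fix p assume p: "p \<in> U"
    obtain V F G m n where V: "open V" "p \<in> V" "V \<subseteq> U"
      "homogeneous m F" "homogeneous n G" "int m - int n = d"
      "\<forall>v\<in>cone V. peval G v \<noteq> 0 \<and> s v = peval F v / peval G v"
      using sect_defD[OF \<open>sect d U s\<close> p] by (elim exE conjE) (rule that)
    moreover have "\<forall>v\<in>cone V. peval G v \<noteq> 0 \<and> t v = peval F v / peval G v"
      using V(7) eq cone_mono[OF V(3)] by (metis subsetD)
    ultimately show "\<exists>V F G m n. open V \<and> p \<in> V \<and> V \<subseteq> U \<and>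
     homogeneous m F \<and> homogeneous n G \<and> int m - int n = d \<and>
     (\<forall>v\<in>cone V. peval G v \<noteq> 0 \<and> t v = peval F v / peval G v)" by blast
  qed
  from this[of s t] this[of t s] assms show ?thesis by metis
qed

lemma sect_local:
  assumes "\<And>p. p \<in> U \<Longrightarrow> \<exists>V. open V \<and> p \<in> V \<and> V \<subseteq> U \<and> sect d V s"
  shows "sect d U s"
  unfolding sect_def
proof
  fix p assume "p \<in> U"
  then obtain V where V: "open V" "p \<in> V" "V \<subseteq> U" "sect d V s"
    using assms by blast
  obtain W F G m n where "open W" "p \<in> W" "W \<subseteq> V"
      "homogeneous m F" "homogeneous n G" "int m - int n = d"
      "\<forall>v\<in>cone W. peval G v \<noteq> 0 \<and> s v = peval F v / peval G v"
    using sect_defD[OF V(4,2)] by (elim exE conjE) (rule that)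
  moreover have "W \<subseteq> U" using calculation V(3) by blast
  ultimately show "\<exists>V F G m n. open V \<and> p \<in> V \<and> V \<subseteq> U \<and>
     homogeneous m F \<and> homogeneous n G \<and> int m - int n = d \<and>
     (\<forall>v\<in>cone V. peval G v \<noteq> 0 \<and> s v = peval F v / peval G v)"
    by blast
qed

text \<open>
  One polynomial \<open>G\<close> can serve as denominator and as equation of the neighbourhood, if numerator and
  denominator are multiplied by an equation of a smaller neighbourhood. A further factor \<open>X i\<close> makes
  the degree of the numerator positive, as division by a coordinate and differentiation require.
\<close>

lemma sectD:
  assumes "sect d U s" "p \<in> U"
  shows "\<exists>F G m n. homogeneous (Suc m) F \<and> homogeneous n G \<and> int (Suc m) - int n = d \<and>
    p \<in> basic_open G \<and> basic_open G \<subseteq> U \<and>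
    (\<forall>v. v \<noteq> 0 \<longrightarrow> peval G v \<noteq> 0 \<longrightarrow> s v = peval F v / peval G v)"
proof -
  obtain V F G m n where V: "open V" "p \<in> V" "V \<subseteq> U"
      "homogeneous m F" "homogeneous n G" "int m - int n = d"
      "\<forall>v\<in>cone V. peval G v \<noteq> 0 \<and> s v = peval F v / peval G v"
    using sect_defD[OF assms] by (elim exE conjE) (rule that)
  obtain H e where H: "homogeneous e H" "p \<in> basic_open H" "basic_open H \<subseteq> V"
    by (rule open_contains_basic[OF V(1,2)])
  obtain i where i: "p \<in> chart i" using ex_chart by blast
  let ?K = "H * X i"
  have K: "homogeneous (Suc e) ?K" using homogeneous_mult[OF H(1) homogeneous_X[of i]] by simp
  have hG: "homogeneous (n + Suc e) (G * ?K)" and hF: "homogeneous (Suc (m + e)) (F * ?K)"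
    using homogeneous_mult[OF V(5) K] homogeneous_mult[OF V(4) K] by simp_all
  have eq: "basic_open (G * ?K) = basic_open G \<inter> basic_open H \<inter> chart i"
    using basic_open_mult[OF V(5) K] basic_open_mult[OF H(1) homogeneous_X]
    by (auto simp: chart_eq_basic_open)
  have "rep_proj3 p \<in> cone V" using V(2) by simp
  then have "peval G (rep_proj3 p) \<noteq> 0" using V(7) by blast
  then have pG: "p \<in> basic_open G"
    using pt_in_basic_open_iff[OF V(5) rep_proj3_nonzero] by force
  show ?thesis
  proof (intro exI conjI allI impI)
    show "homogeneous (Suc (m + e)) (F * ?K)" "homogeneous (n + Suc e) (G * ?K)" by (rule hF hG)+
    show "int (Suc (m + e)) - int (n + Suc e) = d" using V(6) by simp
    show "p \<in> basic_open (G * ?K)" using eq pG H i by blast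
    show "basic_open (G * ?K) \<subseteq> U" using eq H V(3) by blast
    fix v :: "'a ^ 4" assume v: "v \<noteq> 0" "peval (G * ?K) v \<noteq> 0"
    then have "pt v \<in> basic_open H"
      by (simp add: peval_mult pt_in_basic_open_iff[OF H(1)])
    then have "v \<in> cone V" using H(3) v by (auto simp: cone_def)
    then show "s v = peval (F * ?K) v / peval (G * ?K) v"
      using V(7) v by (simp add: peval_mult)
  qed
qed

lemma sectI:
  assumes "open U" and "\<And>p. p \<in> U \<Longrightarrow> \<exists>F G m n. homogeneous m F \<and> homogeneous n G \<and>
    int m - int n = d \<and> p \<in> basic_open G \<and>
    (\<forall>v\<in>cone U. peval G v \<noteq> 0 \<longrightarrow> s v = peval F v / peval G v)"
  shows "sect d U s"
  unfolding sect_def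
proof
  fix p assume p: "p \<in> U"
  then obtain F G m n where *: "homogeneous m F" "homogeneous n G" "int m - int n = d"
    "p \<in> basic_open G" "\<forall>v\<in>cone U. peval G v \<noteq> 0 \<longrightarrow> s v = peval F v / peval G v"
    using assms(2) by blast
  show "\<exists>V F G m n. open V \<and> p \<in> V \<and> V \<subseteq> U \<and>
     homogeneous m F \<and> homogeneous n G \<and> int m - int n = d \<and>
     (\<forall>v\<in>cone V. peval G v \<noteq> 0 \<and> s v = peval F v / peval G v)"
    by (rule exI[of _ "U \<inter> basic_open G"], rule exI[of _ F], rule exI[of _ G])
       (use * p assms(1) open_basic_open[OF *(2)] in
         \<open>auto simp: cone_Int cone_basic_open[OF *(2)]\<close>)
qed

lemma sect_mono:
  assumes "sect d U s" "open V" "V \<subseteq> U"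
  shows "sect d V s"
proof (rule sectI[OF assms(2)])
  fix p assume "p \<in> V"
  with assms(3) have p: "p \<in> U" by blast
  obtain F G m n where "homogeneous (Suc m) F" "homogeneous n G" "int (Suc m) - int n = d"
    "p \<in> basic_open G" "basic_open G \<subseteq> U" "\<forall>v. v \<noteq> 0 \<longrightarrow> peval G v \<noteq> 0 \<longrightarrow> s v = peval F v / peval G v"
    using sectD[OF assms(1) p] by (elim exE conjE) (rule that)
  then show "\<exists>F G m n. homogeneous m F \<and> homogeneous n G \<and> int m - int n = d \<and>
      p \<in> basic_open G \<and> (\<forall>v\<in>cone V. peval G v \<noteq> 0 \<longrightarrow> s v = peval F v / peval G v)"
    by (intro exI[of _ F] exI[of _ G] exI[of _ "Suc m"] exI[of _ n]) (auto dest: coneD)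
qed

lemma sect_scale:
  assumes "sect d U s" "v \<in> cone U" "c \<noteq> 0"
  shows "s (c *s v) = c powi d * s v"
proof -
  have v: "v \<noteq> 0" "pt v \<in> U" using assms(2) by (auto simp: cone_def)
  obtain F G m n where *: "homogeneous (Suc m) F" "homogeneous n G" "int (Suc m) - int n = d"
    "pt v \<in> basic_open G" "basic_open G \<subseteq> U" "\<forall>v. v \<noteq> 0 \<longrightarrow> peval G v \<noteq> 0 \<longrightarrow> s v = peval F v / peval G v"
    using sectD[OF assms(1) v(2)] by (elim exE conjE) (rule that)
  have "peval G v \<noteq> 0" using *(4) pt_in_basic_open_iff[OF *(2) v(1)] by simp
  moreover have "c *s v \<noteq> 0" using v assms(3) by (auto simp: vec_eq_iff)
  moreover have "c powi d = c ^ Suc m / c ^ n"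
    using assms(3) unfolding *(3)[symmetric] by (simp add: power_int_diff del: of_nat_Suc)
  ultimately show ?thesis
    using *(6)[rule_format, of v] *(6)[rule_format, of "c *s v"] assms(3) v
    by (simp add: peval_scale[OF *(1)] peval_scale[OF *(2)])
qed

lemma sect_add:
  assumes "sect d U s" "sect d U t" "open U"
  shows "sect d U (\<lambda>v. s v + t v)"
proof (rule sectI[OF assms(3)])
  fix p assume p: "p \<in> U"
  obtain F G m n where 1: "homogeneous (Suc m) F" "homogeneous n G" "int (Suc m) - int n = d"
    "p \<in> basic_open G" "basic_open G \<subseteq> U" "\<forall>v. v \<noteq> 0 \<longrightarrow> peval G v \<noteq> 0 \<longrightarrow> s v = peval F v / peval G v"
    using sectD[OF assms(1) p] by (elim exE conjE) (rule that)
  obtain F' G' m' n' where 2: "homogeneous (Suc m') F'" "homogeneous n' G'" "int (Suc m') - int n' = d"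
    "p \<in> basic_open G'" "basic_open G' \<subseteq> U" "\<forall>v. v \<noteq> 0 \<longrightarrow> peval G' v \<noteq> 0 \<longrightarrow> t v = peval F' v / peval G' v"
    using sectD[OF assms(2) p] by (elim exE conjE) (rule that)
  have "Suc m + n' = n + Suc m'" using 1(3) 2(3) by linarith
  then have h: "homogeneous (Suc m + n') (F * G' + G * F')"
    using homogeneous_mult[OF 1(1) 2(2)] homogeneous_mult[OF 1(2) 2(1)] homogeneous_add by metis
  show "\<exists>F G m n. homogeneous m F \<and> homogeneous n G \<and> int m - int n = d \<and>
      p \<in> basic_open G \<and> (\<forall>v\<in>cone U. peval G v \<noteq> 0 \<longrightarrow> s v + t v = peval F v / peval G v)"
  proof (intro exI conjI ballI impI)
    show "homogeneous (Suc m + n') (F * G' + G * F')" by (rule h)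
    show "homogeneous (n + n') (G * G')" by (rule homogeneous_mult[OF 1(2) 2(2)])
    show "int (Suc m + n') - int (n + n') = d" using 1(3) by simp
    show "p \<in> basic_open (G * G')" using 1 2 basic_open_mult[OF 1(2) 2(2)] by blast
    fix v assume "v \<in> cone U" "peval (G * G') v \<noteq> 0"
    then have "v \<noteq> 0" "peval G v \<noteq> 0" "peval G' v \<noteq> 0" by (auto simp: cone_def peval_mult)
    then show "s v + t v = peval (F * G' + G * F') v / peval (G * G') v"
      by (simp add: 1(6) 2(6) peval_add peval_mult add_frac_eq mult.commute)
  qed
qed

lemma sect_mult:
  assumes "sect d U s" "sect e U t" "open U"
  shows "sect (d + e) U (\<lambda>v. s v * t v)"
proof (rule sectI[OF assms(3)])
  fix p assume p: "p \<in> U"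
  obtain F G m n where 1: "homogeneous (Suc m) F" "homogeneous n G" "int (Suc m) - int n = d"
    "p \<in> basic_open G" "basic_open G \<subseteq> U" "\<forall>v. v \<noteq> 0 \<longrightarrow> peval G v \<noteq> 0 \<longrightarrow> s v = peval F v / peval G v"
    using sectD[OF assms(1) p] by (elim exE conjE) (rule that)
  obtain F' G' m' n' where 2: "homogeneous (Suc m') F'" "homogeneous n' G'" "int (Suc m') - int n' = e"
    "p \<in> basic_open G'" "basic_open G' \<subseteq> U" "\<forall>v. v \<noteq> 0 \<longrightarrow> peval G' v \<noteq> 0 \<longrightarrow> t v = peval F' v / peval G' v"
    using sectD[OF assms(2) p] by (elim exE conjE) (rule that)
  show "\<exists>F G m n. homogeneous m F \<and> homogeneous n G \<and> int m - int n = d + e \<and>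
      p \<in> basic_open G \<and> (\<forall>v\<in>cone U. peval G v \<noteq> 0 \<longrightarrow> s v * t v = peval F v / peval G v)"
  proof (intro exI conjI ballI impI)
    show "homogeneous (Suc m + Suc m') (F * F')" by (rule homogeneous_mult[OF 1(1) 2(1)])
    show "homogeneous (n + n') (G * G')" by (rule homogeneous_mult[OF 1(2) 2(2)])
    show "int (Suc m + Suc m') - int (n + n') = d + e" using 1(3) 2(3) by simp
    show "p \<in> basic_open (G * G')" using 1 2 basic_open_mult[OF 1(2) 2(2)] by blast
    fix v assume "v \<in> cone U" "peval (G * G') v \<noteq> 0"
    then have "v \<noteq> 0" "peval G v \<noteq> 0" "peval G' v \<noteq> 0" by (auto simp: cone_def peval_mult)
    then show "s v * t v = peval (F * F') v / peval (G * G') v"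
      by (simp add: 1(6) 2(6) peval_mult)
  qed
qed

lemma sect_of_poly:
  assumes "open U" "homogeneous m F" "\<And>v. s v = peval F v"
  shows "sect (int m) U s"
proof (rule sectI[OF assms(1)], intro exI conjI ballI impI)
  show "homogeneous m F" by fact
  show "homogeneous 0 1" by (rule homogeneous_one)
  show "p \<in> basic_open 1" for p
    using pt_in_basic_open_iff[OF homogeneous_one rep_proj3_nonzero, of p] by simp
qed (auto simp: assms(3))

lemma sect_const: "open U \<Longrightarrow> sect 0 U (\<lambda>v. c)"
  using sect_of_poly[of U 0 "Poly_Mapping.single 0 c" "\<lambda>v. c"] homogeneous_const[of c] by simp

lemma sect_coord: "open U \<Longrightarrow> sect 1 U (\<lambda>v. v $ i)"
  using sect_of_poly[of U "Suc 0" "X i" "\<lambda>v. v $ i"] homogeneous_X[of i] by simp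

lemma sect_zero:
  assumes "open U"
  shows "sect d U (\<lambda>v. 0)"
proof (rule sectI[OF assms])
  fix p assume "p \<in> U"
  obtain i where i: "p \<in> chart i" using ex_chart by blast
  have "p \<in> basic_open (X i ^ nat (- d))"
    using i pt_in_basic_open_iff[OF homogeneous_X_power rep_proj3_nonzero, of p]
    by (auto simp: in_chart_iff)
  then show "\<exists>F G m n. homogeneous m F \<and> homogeneous n G \<and> int m - int n = d \<and>
      p \<in> basic_open G \<and> (\<forall>v\<in>cone U. peval G v \<noteq> 0 \<longrightarrow> 0 = peval F v / peval G v)"
    using homogeneous_X_power[of "nat (- d)" i] homogeneous_zero
    by (intro exI[of _ 0] exI[of _ "X i ^ nat (- d)"] exI[of _ "nat d"] exI[of _ "nat (- d)"]) auto
qed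

lemma sect_inverse_coord:
  assumes "open U" "U \<subseteq> chart i"
  shows "sect (-1) U (\<lambda>v. 1 / v $ i)"
proof (rule sectI[OF assms(1)], intro exI conjI ballI impI)
  show "homogeneous 0 1" by (rule homogeneous_one)
  show "homogeneous (Suc 0) (X i)" by (rule homogeneous_X)
  show "p \<in> basic_open (X i)" if "p \<in> U" for p
    using that assms by (auto simp: chart_eq_basic_open)
qed auto

lemma sect_coord_power: "open U \<Longrightarrow> sect (int m) U (\<lambda>v. v $ i ^ m)"
  using sect_of_poly[of U m "X i ^ m" "\<lambda>v. v $ i ^ m"] homogeneous_X_power[of m i] by simp

lemma sect_divide_coord_power:
  assumes "sect d U s" "open U" "U \<subseteq> chart i"
  shows "sect (d - int m) U (\<lambda>v. s v / v $ i ^ m)"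
proof (induction m)
  case (Suc m)
  show ?case
    using sect_mult[OF Suc sect_inverse_coord[OF assms(2,3)] assms(2)]
    by (simp add: algebra_simps)
qed (use assms in simp)

lemma sect_cmult: "sect d U s \<Longrightarrow> open U \<Longrightarrow> sect d U (\<lambda>v. c * s v)"
  using sect_mult[OF sect_const[of U c], of d s] by simp

lemma sect_uminus: "sect d U s \<Longrightarrow> open U \<Longrightarrow> sect d U (\<lambda>v. - s v)"
  using sect_cmult[of d U s "-1"] by simp

lemma sect_diff: "sect d U s \<Longrightarrow> sect d U t \<Longrightarrow> open U \<Longrightarrow> sect d U (\<lambda>v. s v - t v)"
  using sect_add[of d U s "\<lambda>v. - t v"] sect_uminus[of d U t] by simp

lemma sect_sum: "open U \<Longrightarrow> (\<And>j. j \<in> A \<Longrightarrow> sect d U (s j)) \<Longrightarrow> sect d U (\<lambda>v. \<Sum>j\<in>A. s j v)"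
  by (induction A rule: infinite_finite_induct) (auto simp: sect_zero sect_add)

lemma regular_on_iff_sect: "regular_on U s \<longleftrightarrow> sect 0 U (\<lambda>v. s (pt v))"
proof -
  have "(\<exists>m n. homogeneous m F \<and> homogeneous n G \<and> int m - int n = 0 \<and> Q) \<longleftrightarrow>
      (\<exists>d. homogeneous d F \<and> homogeneous d G \<and> Q)" for F G :: "'a poly4" and Q
    by auto
  then show ?thesis unfolding regular_on_def sect_def by simp
qed

lemma sect_0_rep:
  assumes "sect 0 U s" "v \<in> cone U"
  shows "s (rep_proj3 (pt v)) = s v"
proof -
  have "v \<noteq> 0" using assms by (simp add: cone_def)
  then obtain c where "c \<noteq> 0" "rep_proj3 (pt v) = c *s v" using rep_pt by blast
  then show ?thesis using sect_scale[OF assms, of c] by simp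
qed

lemma regular_on_rep:
  assumes "sect 0 U s"
  shows "regular_on U (\<lambda>p. s (rep_proj3 p))"
  unfolding regular_on_iff_sect
  by (rule iffD1[OF sect_cong assms]) (simp add: sect_0_rep[OF assms])

lemma regular_on_cong: "(\<And>p. p \<in> U \<Longrightarrow> s p = t p) \<Longrightarrow> regular_on U s \<longleftrightarrow> regular_on U t"
  unfolding regular_on_iff_sect by (rule sect_cong) (simp add: cone_def)

lemma rat_of_sect: "sect d U s \<Longrightarrow> rat U s"
proof -
  assume s: "sect d U s"
  show ?thesis
    unfolding rat_def
  proof
    fix p assume p: "p \<in> U"
    obtain V F G where "open V" "p \<in> V" "V \<subseteq> U"
      "\<forall>v\<in>cone V. peval G v \<noteq> 0 \<and> s v = peval F v / peval G v"
      using sect_defD[OF s p] by (elim exE conjE) (rule that)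
    then show "\<exists>V P Q. open V \<and> p \<in> V \<and> V \<subseteq> U \<and>
        polyfun P \<and> polyfun Q \<and> (\<forall>v\<in>cone V. Q v \<noteq> 0 \<and> s v = P v / Q v)"
      using polyfun_peval by blast
  qed
qed

lemma ratD:
  assumes "rat U s" "p \<in> U"
  shows "\<exists>V P Q. open V \<and> p \<in> V \<and> V \<subseteq> U \<and> polyfun P \<and> polyfun Q \<and>
    (\<forall>v\<in>cone V. Q v \<noteq> 0 \<and> s v = P v / Q v)"
  using assms unfolding rat_def by blast

lemma rat_mono:
  assumes "rat U s" "open V" "V \<subseteq> U"
  shows "rat V s"
  unfolding rat_def
proof
  fix p assume p: "p \<in> V"
  with assms(3) have "p \<in> U" by blast
  obtain W P Q where "open W" "p \<in> W" "W \<subseteq> U" "polyfun P" "polyfun Q"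
    "\<forall>v\<in>cone W. Q v \<noteq> 0 \<and> s v = P v / Q v"
    using ratD[OF assms(1) \<open>p \<in> U\<close>] by (elim exE conjE) (rule that)
  then show "\<exists>W P Q. open W \<and> p \<in> W \<and> W \<subseteq> V \<and> polyfun P \<and> polyfun Q \<and>
      (\<forall>v\<in>cone W. Q v \<noteq> 0 \<and> s v = P v / Q v)"
    using assms(2) p by (intro exI[of _ "W \<inter> V"] exI[of _ P] exI[of _ Q]) (simp add: cone_Int open_Int)
qed

lemma rat_of_polyfun:
  assumes "polyfun P" "open U" shows "rat U P"
  unfolding rat_def
  by (intro ballI exI[of _ U] exI[of _ P] exI[of _ "\<lambda>v. 1"]) (use assms in auto)

lemma rat_binop:
  assumes "rat U s" "rat U t"
    and "\<And>P Q P' Q'. polyfun P \<Longrightarrow> polyfun Q \<Longrightarrow> polyfun P' \<Longrightarrow> polyfun Q' \<Longrightarrow>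
      polyfun (N P Q P' Q')"
    and "\<And>P Q P' Q' v. Q v \<noteq> 0 \<Longrightarrow> Q' v \<noteq> 0 \<Longrightarrow>
      h (P v / Q v) (P' v / Q' v) = N P Q P' Q' v / (Q v * Q' v)"
  shows "rat U (\<lambda>v. h (s v) (t v))"
  unfolding rat_def
proof
  fix p assume p: "p \<in> U"
  obtain V P Q where
    1: "open V" "p \<in> V" "V \<subseteq> U" "polyfun P" "polyfun Q" "\<forall>v\<in>cone V. Q v \<noteq> 0 \<and> s v = P v / Q v"
    using ratD[OF assms(1) p] by (elim exE conjE) (rule that)
  obtain V' P' Q' where
    2: "open V'" "p \<in> V'" "V' \<subseteq> U" "polyfun P'" "polyfun Q'" "\<forall>v\<in>cone V'. Q' v \<noteq> 0 \<and> t v = P' v / Q' v"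
    using ratD[OF assms(2) p] by (elim exE conjE) (rule that)
  show "\<exists>V P Q. open V \<and> p \<in> V \<and> V \<subseteq> U \<and>
     polyfun P \<and> polyfun Q \<and> (\<forall>v\<in>cone V. Q v \<noteq> 0 \<and> h (s v) (t v) = P v / Q v)"
  proof (intro exI conjI ballI)
    show "open (V \<inter> V')" using 1 2 by blast
    show "p \<in> V \<inter> V'" "V \<inter> V' \<subseteq> U" using 1 2 by blast+
    show "polyfun (N P Q P' Q')" by (rule assms(3)[OF 1(4,5) 2(4,5)])
    show "polyfun (\<lambda>v. Q v * Q' v)" by (rule polyfun_mult[OF 1(5) 2(5)])
    fix v assume "v \<in> cone (V \<inter> V')"
    then have *: "Q v \<noteq> 0" "Q' v \<noteq> 0" "s v = P v / Q v" "t v = P' v / Q' v"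
      using 1(6) 2(6) by (auto simp: cone_Int)
    then show "Q v * Q' v \<noteq> 0" by simp
    show "h (s v) (t v) = N P Q P' Q' v / (Q v * Q' v)"
      unfolding *(3,4) by (rule assms(4)) (use * in auto)
  qed
qed

lemma rat_add: "rat U s \<Longrightarrow> rat U t \<Longrightarrow> rat U (\<lambda>v. s v + t v)"
  by (rule rat_binop[where N = "\<lambda>P Q P' Q' v. P v * Q' v + P' v * Q v"])
     (auto intro!: polyfun_add polyfun_mult simp: field_simps)

lemma rat_diff: "rat U s \<Longrightarrow> rat U t \<Longrightarrow> rat U (\<lambda>v. s v - t v)"
  by (rule rat_binop[where N = "\<lambda>P Q P' Q' v. P v * Q' v - P' v * Q v"])
     (auto intro!: polyfun_diff polyfun_mult simp: field_simps)

lemma rat_mult: "rat U s \<Longrightarrow> rat U t \<Longrightarrow> rat U (\<lambda>v. s v * t v)"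
  by (rule rat_binop[where N = "\<lambda>P Q P' Q' v. P v * P' v"]) (auto intro!: polyfun_mult)

lemma rat_const: "open U \<Longrightarrow> rat U (\<lambda>v. c)"
  by (rule rat_of_polyfun) auto

lemma rat_coord: "open U \<Longrightarrow> rat U (\<lambda>v. v $ i)"
  by (rule rat_of_polyfun) auto

lemma rat_uminus: "rat U s \<Longrightarrow> open U \<Longrightarrow> rat U (\<lambda>v. - s v)"
  using rat_diff[OF rat_const[of U 0]] by simp

lemma rat_power: "rat U s \<Longrightarrow> open U \<Longrightarrow> rat U (\<lambda>v. s v ^ m)"
  by (induction m) (auto intro: rat_mult rat_const)

text \<open>
  Nonempty open sets are dense: \<open>P\<close> times an equation of the complement of a basic open subset of
  \<open>V\<close> vanishes on the cone. The origin does not belong to the cone; an additional coordinate as factor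
  takes care of it.
\<close>

lemma polyfun_eq_zero_dense:
  fixes P :: "'a::field_char_0 ^ 4 \<Rightarrow> 'a"
  assumes "polyfun P" "open V" "p \<in> V" "\<And>v. v \<in> cone V \<Longrightarrow> P v = 0"
  shows "P v = 0"
proof -
  obtain H e where H: "homogeneous e H" "p \<in> basic_open H" "basic_open H \<subseteq> V"
    by (rule open_contains_basic[OF assms(2,3)])
  have H0: "peval H (rep_proj3 p) \<noteq> 0"
    using H(2) pt_in_basic_open_iff[OF H(1) rep_proj3_nonzero, of p] by simp
  have eq: "peval H v * (v $ 0 * P v) = 0" for v
  proof (cases "v = 0 \<or> peval H v = 0")
    case False
    then have "v \<in> cone V" using H(3) by (auto simp: cone_def pt_in_basic_open_iff[OF H(1)])
    then show ?thesis using assms(4) by simp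
  qed auto
  have "v $ 0 * P v = 0" for v
  proof (rule polyfun_cancel[of "peval H" "\<lambda>v. v $ 0 * P v"])
    show "polyfun (\<lambda>v. v $ 0 * P v)" using assms(1) by (rule polyfun_mult[OF polyfun_coord])
  qed (rule polyfun_peval eq H0)+
  then show ?thesis
    using polyfun_cancel[OF _ assms(1), of "\<lambda>v. v $ 0" 1] by simp
qed

lemma rat_cancel:
  fixes s :: "'a::field_char_0 ^ 4 \<Rightarrow> 'a"
  assumes "rat U s" "polyfun P" "P w \<noteq> 0" "\<And>v. v \<in> cone U \<Longrightarrow> P v * s v = 0" "v \<in> cone U"
  shows "s v = 0"
proof -
  have v: "v \<noteq> 0" "pt v \<in> U" using assms(5) by (auto simp: cone_def)
  obtain V F G where V: "open V" "pt v \<in> V" "V \<subseteq> U" "polyfun F" "polyfun G"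
    "\<forall>v\<in>cone V. G v \<noteq> 0 \<and> s v = F v / G v"
    using ratD[OF assms(1) v(2)] by (elim exE conjE) (rule that)
  have "P u * F u = 0" for u
  proof (rule polyfun_eq_zero_dense[OF _ V(1,2)])
    show "polyfun (\<lambda>u. P u * F u)" using assms V by blast
    fix u assume u: "u \<in> cone V"
    then have "P u * (F u / G u) = 0" using V(6) assms(4) cone_mono[OF V(3)] by (metis subsetD)
    then show "P u * F u = 0" using V(6) u by simp
  qed
  then have "F v = 0" using polyfun_cancel[OF assms(2) V(4) _ assms(3)] by blast
  then show ?thesis using V v by (auto simp: cone_def)
qed

text \<open>
  Off the hyperplane \<open>v $ i = 0\<close> there is nothing to prove. At a point on the hyperplane let
  \<open>s = F / G\<close>. On the hyperplane the product of \<open>P\<close>, \<open>F\<close> and the denominator of \<open>A\<close> vanishes, but neither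
  \<open>P\<close> nor that denominator vanishes identically. So \<open>F\<close> does, and it is divisible by the coordinate.
\<close>

lemma sect_divisible_by_coord:
  fixes s :: "'a::field_char_0 ^ 4 \<Rightarrow> 'a"
  assumes V: "open V" "p \<in> V" and s: "sect d V s" and A: "rat V A"
    and P: "polyfun P" "P w \<noteq> 0" "w $ i = 0"
    and eq: "\<And>v. v \<in> cone V \<Longrightarrow> v $ i * A v = P v * s v"
  obtains W s' where "open W" "p \<in> W" "W \<subseteq> V" "sect (d - 1) W s'"
    "\<And>v. v \<in> cone W \<Longrightarrow> s v = v $ i * s' v"
proof -
  obtain F G m n where s: "homogeneous (Suc m) F" "homogeneous n G" "int (Suc m) - int n = d"
    "p \<in> basic_open G" "basic_open G \<subseteq> V"
    "\<forall>v. v \<noteq> 0 \<longrightarrow> peval G v \<noteq> 0 \<longrightarrow> s v = peval F v / peval G v"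
    using sectD[OF s V(2)] by (elim exE conjE) (rule that)
  have Gp: "peval G (rep_proj3 p) \<noteq> 0"
    using s(4) pt_in_basic_open_iff[OF s(2) rep_proj3_nonzero, of p] by simp
  have oG: "open (basic_open G)" using open_basic_open s(2) by blast
  show thesis
  proof (cases "p \<in> chart i")
    case True
    let ?W = "basic_open G \<inter> chart i"
    have W: "open ?W" using oG by auto
    have "sect d ?W s" by (rule sect_mono[OF \<open>sect d V s\<close>]) (use W s(5) in auto)
    from sect_divide_coord_power[OF this W, of i 1]
    have "sect (d - 1) ?W (\<lambda>v. s v / v $ i)" by simp
    then show ?thesis
      by (rule that[rotated 3]) (use W True s(4,5) in \<open>auto simp: cone_Int cone_chart\<close>)
  next
    case False
    then have p0: "rep_proj3 p $ i = 0" by (simp add: in_chart_iff)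
    obtain W F' G' where A: "open W" "p \<in> W" "W \<subseteq> V" "polyfun F'" "polyfun G'"
      "\<forall>v\<in>cone W. G' v \<noteq> 0 \<and> A v = F' v / G' v"
      using ratD[OF A V(2)] by (elim exE conjE) (rule that)
    have G'p: "G' (rep_proj3 p) \<noteq> 0" using A(2,6) by simp
    have "v $ i * (F' v * peval G v) - P v * (peval F v * G' v) = 0" for v
    proof (rule polyfun_eq_zero_dense[of _ "W \<inter> basic_open G" p])
      show "polyfun (\<lambda>v. v $ i * (F' v * peval G v) - P v * (peval F v * G' v))"
        using A P by (intro polyfun_diff polyfun_mult) auto
      fix v assume "v \<in> cone (W \<inter> basic_open G)"
      then have v: "v \<in> cone W" "v \<in> cone (basic_open G)" by (auto simp: cone_Int)
      then have "v \<in> cone V" using cone_mono[OF A(3)] by auto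
      then have "v $ i * (F' v / G' v) = P v * (peval F v / peval G v)"
        using eq[of v] bspec[OF A(6) v(1)] s(6) v by (simp add: cone_basic_open[OF s(2)])
      moreover have "G' v \<noteq> 0" "peval G v \<noteq> 0" using A(6) v by (auto simp: cone_basic_open[OF s(2)])
      ultimately show "v $ i * (F' v * peval G v) - P v * (peval F v * G' v) = 0"
        by (simp add: field_simps)
    qed (use A oG s(4) in auto)
    then have *: "P v * (peval F v * G' v) = 0" if "v $ i = 0" for v
      using that by (metis diff_0 mult_zero_left neg_equal_0_iff_equal)
    let ?E = "{v :: 'a ^ 4. v $ i = 0}"
    have "(\<forall>v\<in>?E. P v = 0) \<or> (\<forall>v\<in>?E. peval F v * G' v = 0)"
      by (rule polyfun_mult_zero) (use P A * in \<open>auto intro: polyfun_mult\<close>)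
    then have "\<forall>v\<in>?E. peval F v * G' v = 0" using P by blast
    then have "(\<forall>v\<in>?E. peval F v = 0) \<or> (\<forall>v\<in>?E. G' v = 0)"
      by (intro polyfun_mult_zero) (use A in auto)
    then have "\<forall>v\<in>?E. peval F v = 0" using G'p p0 by blast
    then obtain F1 where F1: "homogeneous m F1" "\<And>v. peval F v = v $ i * peval F1 v"
      using homogeneous_divide_coord[OF s(1), of i] by auto
    have "sect (d - 1) (basic_open G) (\<lambda>v. peval F1 v / peval G v)"
      by (rule sectI[OF oG], rule exI[of _ F1], rule exI[of _ G], rule exI[of _ m], rule exI[of _ n])
         (use F1 s in auto)
    then show ?thesis
      by (rule that[rotated 3]) (use s oG F1 in \<open>auto simp: cone_basic_open[OF s(2)]\<close>)
  qed
qed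

lemma sect_divisible_by_coord_power:
  fixes s :: "'a::field_char_0 ^ 4 \<Rightarrow> 'a"
  assumes "open V" "p \<in> V" "sect d V s" "rat V A"
    and "polyfun P" "P w \<noteq> 0" "w $ i = 0"
    and "\<And>v. v \<in> cone V \<Longrightarrow> v $ i ^ m * A v = P v * s v"
  obtains W s' where "open W" "p \<in> W" "W \<subseteq> V" "sect (d - int m) W s'"
    "\<And>v. v \<in> cone W \<Longrightarrow> s v = v $ i ^ m * s' v"
  using assms
proof (induction m arbitrary: thesis d s V)
  case 0
  show ?case by (rule "0.prems"(1)[of V s]) (use 0 in auto)
next
  case (Suc m)
  note V = Suc.prems(2,3) and s = Suc.prems(4) and A = Suc.prems(5)
    and P = Suc.prems(6-8) and eq = Suc.prems(9)
  have "rat V (\<lambda>v. v $ i ^ m * A v)"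
    using A V by (intro rat_mult rat_power rat_coord) auto
  then obtain W s1 where W: "open W" "p \<in> W" "W \<subseteq> V" "sect (d - 1) W s1"
    "\<And>v. v \<in> cone W \<Longrightarrow> s v = v $ i * s1 v"
    using sect_divisible_by_coord[OF V s _ P, of "\<lambda>v. v $ i ^ m * A v"] eq
    by (auto simp: mult.assoc)
  have rW: "rat W A" by (rule rat_mono[OF A W(1,3)])
  have diffz: "v $ i ^ m * A v - P v * s1 v = 0" if "v \<in> cone W" for v
  proof (rule rat_cancel[of W "\<lambda>v. v $ i ^ m * A v - P v * s1 v" "\<lambda>v. v $ i" 1])
    show "rat W (\<lambda>v. v $ i ^ m * A v - P v * s1 v)"
      by (rule rat_diff[OF rat_mult[OF rat_power[OF rat_coord[OF W(1)] W(1)] rW]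
            rat_mult[OF rat_of_polyfun[OF P(1) W(1)] rat_of_sect[OF W(4)]]])
    show "u $ i * (u $ i ^ m * A u - P u * s1 u) = 0" if "u \<in> cone W" for u
      using eq[of u] W(5)[OF that] that cone_mono[OF W(3)] by (auto simp: algebra_simps)
  qed (use that in auto)
  obtain W' s' where W': "open W'" "p \<in> W'" "W' \<subseteq> W" "sect (d - 1 - int m) W' s'"
    "\<And>v. v \<in> cone W' \<Longrightarrow> s1 v = v $ i ^ m * s' v"
    by (rule Suc.IH[OF _ W(1,2,4) rW P]) (use diffz in auto)
  show ?case
    by (rule Suc.prems(1)[of W' s'])
       (use W W' cone_mono[OF W'(3)] in \<open>auto simp: mult.assoc algebra_simps\<close>)
qed

section \<open>Syzygies of the pencil and of three quadrics\<close>

lemma UNIV_4: "(UNIV :: 4 set) = {0, 1, 2, 3}"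
proof -
  have "card {0, 1, 2, 3 :: 4} = 4" by (simp add: card_insert_if)
  then show ?thesis by (intro card_subset_eq[symmetric]) auto
qed

lemma all_4: "(\<forall>i::4. P i) \<longleftrightarrow> P 0 \<and> P 1 \<and> P 2 \<and> P 3"
  using UNIV_4 by (metis UNIV_I insertE singletonD)

lemma sum_4: "(\<Sum>i\<in>(UNIV :: 4 set). h i) = h 0 + h 1 + h 2 + h 3"
  unfolding UNIV_4 by (simp add: add.assoc)

lemmas rat_intros = rat_const rat_coord rat_power rat_add rat_diff rat_mult rat_uminus
lemmas polyfun_intros = polyfun_const polyfun_coord polyfun_power polyfun_add polyfun_diff polyfun_mult polyfun_minus

lemma rat_eqI:
  fixes s :: "'a::field_char_0 ^ 4 \<Rightarrow> 'a"
  assumes "polyfun P" "P u \<noteq> 0" "\<And>v. v \<in> cone U \<Longrightarrow> P v * s v = P v * t v" "v \<in> cone U"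
    and "rat U s" "rat U t"
  shows "s v = t v"
  using rat_cancel[OF rat_diff[OF assms(5,6)] assms(1,2) _ assms(4)] assms(3)
  by (simp add: right_diff_distrib)

lemma sect_times_coord_power:
  assumes "sect e U s" "open U" "d = e + int m"
  shows "sect d U (\<lambda>v. v $ i ^ m * s v)"
  using sect_mult[OF sect_coord_power[OF assms(2)] assms(1,2)] assms(3) by (simp add: add.commute)

lemma sect_times_coord:
  assumes "sect e U s" "open U" "d = e + 1"
  shows "sect d U (\<lambda>v. v $ i * s v)"
  using sect_times_coord_power[of e U s d 1] assms by simp

text \<open>
  The hypotheses on \<open>b0, \<dots>, b3\<close> are the two Jacobian equations of the pencil. Five divisions by
  powers of coordinates, each forced by one of the equations, solve them up to one equation with
  quadratic coefficients. Every division passes to a smaller neighbourhood of \<open>p\<close>.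
\<close>

lemma jacobian_syzygy_reduce:
  fixes b0 b1 b2 b3 :: "'a::field_char_0 ^ 4 \<Rightarrow> 'a" and k :: nat
  defines "\<alpha> \<equiv> of_nat (k + 2) / (of_nat (k + 1) :: 'a)"
  assumes V: "open V" "p \<in> V"
    and b: "sect (int k + 2) V b0" "sect (int k + 2) V b1" "sect (int k + 2) V b2" "sect (int k + 2) V b3"
    and J1: "\<And>v. v \<in> cone V \<Longrightarrow> v $ 1 ^ (k + 2) * b0 v + of_nat (k + 2) * v $ 0 * v $ 1 ^ (k + 1) * b1 v +
      (of_nat (k + 3) * v $ 2 ^ (k + 2) + of_nat (k + 2) * v $ 2 ^ (k + 1) * v $ 3) * b2 v
      + v $ 2 ^ (k + 2) * b3 v = 0"
    and J2: "\<And>v. v \<in> cone V \<Longrightarrow> - of_nat (k + 1) * v $ 2 * v $ 3 * v $ 1 ^ k * b1 v +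
      v $ 3 * (of_nat (k + 2) * v $ 2 ^ (k + 1) - v $ 1 ^ (k + 1)) * b2 v
      + v $ 2 * (v $ 2 ^ (k + 1) - v $ 1 ^ (k + 1)) * b3 v = 0"
  obtains W A T C where "open W" "p \<in> W" "W \<subseteq> V" "sect 1 W A" "sect 1 W T" "sect 1 W C"
    "\<And>v. v \<in> cone W \<Longrightarrow> (v $ 1)\<^sup>2 * A v + (\<alpha> * v $ 0 * v $ 1 + v $ 2 * v $ 3) * T v
      + of_nat (k + 3) * (v $ 2)\<^sup>2 * C v = 0"
    "\<And>v. v \<in> cone W \<Longrightarrow> b0 v = v $ 2 ^ (k + 1) * A v + \<alpha> * v $ 0 * v $ 1 ^ k * T v
      - of_nat (k + 2) * v $ 0 * v $ 1 ^ k * C v"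
    "\<And>v. v \<in> cone W \<Longrightarrow> b1 v = (v $ 2 ^ (k + 1) - v $ 1 ^ (k + 1)) * T v / of_nat (k + 1)
      + v $ 1 ^ (k + 1) * C v"
    "\<And>v. v \<in> cone W \<Longrightarrow> b2 v = v $ 2 * v $ 1 ^ k * C v"
    "\<And>v. v \<in> cone W \<Longrightarrow> b3 v = v $ 3 * (v $ 1 ^ k * T v - of_nat (k + 2) * v $ 1 ^ k * C v)"
proof -
  let ?N = "of_nat :: nat \<Rightarrow> 'a"
  note rb = b[THEN rat_of_sect]
  have nz: "?N (k + 1) \<noteq> 0" "?N (k + 2) \<noteq> 0" "?N (k + 3) \<noteq> 0"
    by (simp_all del: of_nat_add of_nat_Suc add: of_nat_eq_0_iff)
  define ones :: "'a ^ 4" where "ones = (\<chi> i. 1)"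
  define e1 e2 no2 :: "'a ^ 4" where "e1 = (\<chi> i. if i = 1 then 1 else 0)"
    and "e2 = (\<chi> i. if i = 2 then 1 else 0)" and "no2 = (\<chi> i. if i = 2 then 0 else 1)"
  note u = ones_def e1_def e2_def no2_def
  \<comment> \<open>modulo \<open>z\<close> the second equation reads \<open>w y\<^sup>k\<^sup>+\<^sup>1 b\<^sub>2 = 0\<close>\<close>
  obtain W1 c1 where W1: "open W1" "p \<in> W1" "W1 \<subseteq> V" "sect (int k + 2 - 1) W1 c1"
    "\<And>v. v \<in> cone W1 \<Longrightarrow> b2 v = v $ 2 * c1 v"
  proof (rule sect_divisible_by_coord[where i = 2 and s = b2 and p = p and w = no2 and
        P = "\<lambda>v. - (v $ 3 * v $ 1 ^ (k + 1))" and
        A = "\<lambda>v. ?N (k + 1) * (v $ 3 * v $ 1 ^ k * b1 v) - (v $ 2 ^ (k + 1) - v $ 1 ^ (k + 1)) * b3 v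
          - ?N (k + 2) * (v $ 3 * v $ 2 ^ k * b2 v)", OF V b(3)])
    show "rat V (\<lambda>v. ?N (k + 1) * (v $ 3 * v $ 1 ^ k * b1 v) - (v $ 2 ^ (k + 1) - v $ 1 ^ (k + 1)) * b3 v
          - ?N (k + 2) * (v $ 3 * v $ 2 ^ k * b2 v))"
      by (intro rat_intros V rb)
    show "polyfun (\<lambda>v :: 'a ^ 4. - (v $ 3 * v $ 1 ^ (k + 1)))" by (intro polyfun_intros)
    show "v $ 2 * (?N (k + 1) * (v $ 3 * v $ 1 ^ k * b1 v) - (v $ 2 ^ (k + 1) - v $ 1 ^ (k + 1)) * b3 v
          - ?N (k + 2) * (v $ 3 * v $ 2 ^ k * b2 v)) = - (v $ 3 * v $ 1 ^ (k + 1)) * b2 v"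
      if "v \<in> cone V" for v
      using J2[OF that] by (simp add: algebra_simps)
  qed (auto simp: u)
  note inV = subsetD[OF cone_mono[OF W1(3)]]
  have rb1: "rat W1 b0" "rat W1 b1" "rat W1 b2" "rat W1 b3" "rat W1 c1"
    using rb rat_mono[OF _ W1(1,3)] rat_of_sect[OF W1(4)] by auto
  have J2': "v $ 3 * (?N (k + 1) * (v $ 1 ^ k * b1 v) - (?N (k + 2) * v $ 2 ^ (k + 1) - v $ 1 ^ (k + 1)) * c1 v)
      = (v $ 2 ^ (k + 1) - v $ 1 ^ (k + 1)) * b3 v" if "v \<in> cone W1" for v
  proof (rule rat_eqI[where P = "\<lambda>v. v $ 2" and u = ones and U = W1 and v = v])
    show "v $ 2 * (v $ 3 * (?N (k + 1) * (v $ 1 ^ k * b1 v) - (?N (k + 2) * v $ 2 ^ (k + 1) - v $ 1 ^ (k + 1)) * c1 v))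
      = v $ 2 * ((v $ 2 ^ (k + 1) - v $ 1 ^ (k + 1)) * b3 v)" if "v \<in> cone W1" for v
      using J2[OF inV[OF that]] W1(5)[OF that] by (simp add: algebra_simps)
  qed (use that in \<open>auto simp: u simp del: of_nat_add intro!: rat_intros W1 rb1\<close>)
  \<comment> \<open>after division by \<open>z\<close>, modulo \<open>w\<close> it reads \<open>(z\<^sup>k\<^sup>+\<^sup>1 - y\<^sup>k\<^sup>+\<^sup>1) b\<^sub>3 = 0\<close>\<close>
  obtain W2 d1 where W2: "open W2" "p \<in> W2" "W2 \<subseteq> W1" "sect (int k + 2 - 1) W2 d1"
    "\<And>v. v \<in> cone W2 \<Longrightarrow> b3 v = v $ 3 * d1 v"
  proof (rule sect_divisible_by_coord[where i = 3 and s = b3 and p = p and w = e2 and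
        P = "\<lambda>v. v $ 2 ^ (k + 1) - v $ 1 ^ (k + 1)" and
        A = "\<lambda>v. ?N (k + 1) * (v $ 1 ^ k * b1 v) - (?N (k + 2) * v $ 2 ^ (k + 1) - v $ 1 ^ (k + 1)) * c1 v",
        OF W1(1,2) sect_mono[OF b(4) W1(1,3)]])
    show "rat W1 (\<lambda>v. ?N (k + 1) * (v $ 1 ^ k * b1 v) - (?N (k + 2) * v $ 2 ^ (k + 1) - v $ 1 ^ (k + 1)) * c1 v)"
      by (intro rat_intros W1 rb1)
    show "polyfun (\<lambda>v :: 'a ^ 4. v $ 2 ^ (k + 1) - v $ 1 ^ (k + 1))" by (intro polyfun_intros)
  qed (use J2' in \<open>auto simp: u\<close>)
  note inW1 = subsetD[OF cone_mono[OF W2(3)]]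
  have rb2: "rat W2 b0" "rat W2 b1" "rat W2 c1" "rat W2 d1"
    using rb1 rat_mono[OF _ W2(1,3)] rat_of_sect[OF W2(4)] by auto
  have eq3: "?N (k + 1) * (v $ 1 ^ k * b1 v) - (?N (k + 2) * v $ 2 ^ (k + 1) - v $ 1 ^ (k + 1)) * c1 v
      = (v $ 2 ^ (k + 1) - v $ 1 ^ (k + 1)) * d1 v" if "v \<in> cone W2" for v
  proof (rule rat_eqI[where P = "\<lambda>v. v $ 3" and u = ones and U = W2 and v = v])
    show "v $ 3 * (?N (k + 1) * (v $ 1 ^ k * b1 v) - (?N (k + 2) * v $ 2 ^ (k + 1) - v $ 1 ^ (k + 1)) * c1 v)
      = v $ 3 * ((v $ 2 ^ (k + 1) - v $ 1 ^ (k + 1)) * d1 v)" if "v \<in> cone W2" for v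
      using J2'[OF inW1[OF that]] W2(5)[OF that] by (simp add: algebra_simps)
  qed (use that in \<open>auto simp: u simp del: of_nat_add intro!: rat_intros W2 rb2\<close>)
  \<comment> \<open>the second equation has become \<open>y\<^sup>k h = z\<^sup>k\<^sup>+\<^sup>1 e\<close> with coprime coefficients, so
    \<open>e = y\<^sup>k T\<close> and \<open>h = z\<^sup>k\<^sup>+\<^sup>1 T\<close>\<close>
  let ?e = "\<lambda>v. ?N (k + 2) * c1 v + d1 v" and ?h = "\<lambda>v. ?N (k + 1) * b1 v + v $ 1 * (c1 v + d1 v)"
  have se: "sect (int k + 1) W2 ?e"
    using sect_add[OF sect_cmult[OF sect_mono[OF W1(4) W2(1,3)] W2(1)] W2(4,1), of "?N (k + 2)"] by (simp add: add.commute del: of_nat_add)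
  have rh: "rat W2 ?h" by (intro rat_intros W2 rb2)
  have eh: "v $ 1 ^ k * ?h v = v $ 2 ^ (k + 1) * ?e v" if "v \<in> cone W2" for v
    using eq3[OF that] by (simp add: algebra_simps)
  obtain W3 T where W3: "open W3" "p \<in> W3" "W3 \<subseteq> W2" "sect (int k + 1 - int k) W3 T"
    "\<And>v. v \<in> cone W3 \<Longrightarrow> ?e v = v $ 1 ^ k * T v"
    by (rule sect_divisible_by_coord_power[OF W2(1,2) se rh, where i = 1 and m = k and w = e2 and
        P = "\<lambda>v. v $ 2 ^ (k + 1)"]) (use eh in \<open>auto simp: u intro!: polyfun_intros\<close>)
  note inW2 = subsetD[OF cone_mono[OF W3(3)]]
  have rb3: "rat W3 b0" "rat W3 b1" "rat W3 c1" "rat W3 d1" "rat W3 T"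
    using rb2 rat_mono[OF _ W3(1,3)] rat_of_sect[OF W3(4)] by auto
  have hT: "?h v = v $ 2 ^ (k + 1) * T v" if "v \<in> cone W3" for v
  proof (rule rat_eqI[where P = "\<lambda>v. v $ 1 ^ k" and u = ones and U = W3 and v = v])
    show "v $ 1 ^ k * ?h v = v $ 1 ^ k * (v $ 2 ^ (k + 1) * T v)" if "v \<in> cone W3" for v
      using eh[OF inW2[OF that]] W3(5)[OF that] by (simp only: mult.left_commute)
  qed (use that in \<open>auto simp: u simp del: of_nat_add intro!: rat_intros polyfun_intros W3 rb3\<close>)
  \<comment> \<open>the terms with \<open>w\<close> of the first equation combine to a multiple of \<open>e\<close>, so that modulo \<open>y\<^sup>k\<close>
    only \<open>(k + 3) z\<^sup>k\<^sup>+\<^sup>3 c1 = 0\<close> remains\<close>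
  have eq4: "v $ 1 ^ k * ((v $ 1)\<^sup>2 * b0 v + ?N (k + 2) * (v $ 0 * v $ 1 * b1 v) + v $ 2 ^ (k + 2) * v $ 3 * T v)
     = - (?N (k + 3) * v $ 2 ^ (k + 3)) * c1 v" if v: "v \<in> cone W3" for v
  proof -
    have v1: "v \<in> cone W1" "v \<in> cone V" using v inW2 inW1 inV by blast+
    have d: "d1 v = v $ 1 ^ k * T v - ?N (k + 2) * c1 v" using W3(5)[OF v] by (simp add: algebra_simps)
    show ?thesis
      using J1[OF v1(2)] unfolding W1(5)[OF v1(1)] W2(5)[OF inW2[OF v]] d mult_minus_left eq_neg_iff_add_eq_0
      by (simp add: algebra_simps power2_eq_square power_add eval_nat_numeral)
  qed
  obtain W4 C where W4: "open W4" "p \<in> W4" "W4 \<subseteq> W3" "sect (int k + 2 - 1 - int k) W4 C"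
    "\<And>v. v \<in> cone W4 \<Longrightarrow> c1 v = v $ 1 ^ k * C v"
  proof (rule sect_divisible_by_coord_power[OF W3(1,2) sect_mono[OF W1(4) W3(1)], where i = 1 and m = k and w = e2 and
        P = "\<lambda>v. - (?N (k + 3) * v $ 2 ^ (k + 3))" and
        A = "\<lambda>v. (v $ 1)\<^sup>2 * b0 v + ?N (k + 2) * (v $ 0 * v $ 1 * b1 v) + v $ 2 ^ (k + 2) * v $ 3 * T v"])
    show "W3 \<subseteq> W1" using W3 W2 by blast
    show "rat W3 (\<lambda>v. (v $ 1)\<^sup>2 * b0 v + ?N (k + 2) * (v $ 0 * v $ 1 * b1 v) + v $ 2 ^ (k + 2) * v $ 3 * T v)"
      by (intro rat_intros W3 rb3)
    show "polyfun (\<lambda>v :: 'a ^ 4. - (?N (k + 3) * v $ 2 ^ (k + 3)))" by (intro polyfun_intros)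
    show "- (?N (k + 3) * e2 $ 2 ^ (k + 3)) \<noteq> 0" using nz(3) by (simp add: u del: of_nat_add)
  qed (use eq4 in \<open>auto simp: u\<close>)
  note inW3 = subsetD[OF cone_mono[OF W4(3)]]
  have rb4: "rat W4 b0" "rat W4 b1" "rat W4 T" "rat W4 C"
    using rb3 rat_mono[OF _ W4(1,3)] rat_of_sect[OF W4(4)] by auto
  have sTC: "sect 1 W4 T" "sect 1 W4 C" using W4(4) sect_mono[OF W3(4) W4(1,3)] by simp_all
  have eq5: "(v $ 1)\<^sup>2 * b0 v + ?N (k + 2) * (v $ 0 * v $ 1 * b1 v) + v $ 2 ^ (k + 2) * v $ 3 * T v
     = - (?N (k + 3) * v $ 2 ^ (k + 3)) * C v" if "v \<in> cone W4" for v
  proof (rule rat_eqI[where P = "\<lambda>v. v $ 1 ^ k" and u = ones and U = W4 and v = v])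
    show "v $ 1 ^ k * ((v $ 1)\<^sup>2 * b0 v + ?N (k + 2) * (v $ 0 * v $ 1 * b1 v) + v $ 2 ^ (k + 2) * v $ 3 * T v)
       = v $ 1 ^ k * (- (?N (k + 3) * v $ 2 ^ (k + 3)) * C v)" if "v \<in> cone W4" for v
      using eq4[OF inW3[OF that]] W4(5)[OF that] by (simp only: mult.left_commute)
  qed (use that in \<open>auto simp: u simp del: of_nat_add intro!: rat_intros polyfun_intros W4 rb4\<close>)
  have b1: "b1 v = (v $ 2 ^ (k + 1) - v $ 1 ^ (k + 1)) * T v / ?N (k + 1) + v $ 1 ^ (k + 1) * C v"
    if v: "v \<in> cone W4" for v
  proof -
    have d: "d1 v = v $ 1 ^ k * T v - ?N (k + 2) * c1 v" using W3(5)[OF inW3[OF v]] by (simp add: algebra_simps)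
    have "?N (k + 1) * b1 v = (v $ 2 ^ (k + 1) - v $ 1 ^ (k + 1)) * T v + ?N (k + 1) * (v $ 1 ^ (k + 1) * C v)"
      using hT[OF inW3[OF v]] unfolding d W4(5)[OF v] by (simp add: algebra_simps)
    then show ?thesis using nz(1) by (simp add: field_simps del: of_nat_add)
  qed
  \<comment> \<open>\<open>a'\<close> collects the terms of the first equation that are divisible by \<open>y\<^sup>2\<close>\<close>
  define a' where "a' = (\<lambda>v. b0 v - \<alpha> * (v $ 0 * (v $ 1 ^ k * T v)) + ?N (k + 2) * (v $ 0 * (v $ 1 ^ k * C v)))"
  have sa: "sect (int k + 2) W4 a'"
  proof -
    have *: "sect (int k + 2) W4 (\<lambda>v. v $ 0 * (v $ 1 ^ k * s v))" if "sect 1 W4 s" for s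
      by (rule sect_times_coord[OF sect_times_coord_power[OF that W4(1) refl] W4(1)]) simp
    have "W4 \<subseteq> V" using W4 W3 W2 W1 by blast
    then have "sect (int k + 2) W4 b0" using b(1) W4(1) sect_mono by blast
    then show ?thesis unfolding a'_def
      by (intro sect_add sect_diff sect_cmult * sTC W4)
  qed
  have eq6: "v $ 2 ^ (k + 1) * (\<alpha> * (v $ 0 * v $ 1 * T v) + v $ 2 * v $ 3 * T v + ?N (k + 3) * ((v $ 2)\<^sup>2 * C v))
     = - ((v $ 1)\<^sup>2) * a' v" if v: "v \<in> cone W4" for v
  proof -
    have *: "?N (k + 2) * (v $ 0 * v $ 1 * b1 v) = \<alpha> * (v $ 0 * v $ 1 * ((v $ 2 ^ (k + 1) - v $ 1 ^ (k + 1)) * T v))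
        + ?N (k + 2) * (v $ 0 * v $ 1 * (v $ 1 ^ (k + 1) * C v))"
      unfolding b1[OF v] by (simp add: \<alpha>_def field_simps del: of_nat_add)
    then show ?thesis
      using eq5[OF v] unfolding * a'_def mult_minus_left eq_neg_iff_add_eq_0
      by (simp add: algebra_simps power2_eq_square power_add eval_nat_numeral del: of_nat_add)
  qed
  obtain W5 A where W5: "open W5" "p \<in> W5" "W5 \<subseteq> W4" "sect (int k + 2 - int (k + 1)) W5 A"
    "\<And>v. v \<in> cone W5 \<Longrightarrow> a' v = v $ 2 ^ (k + 1) * A v"
  proof (rule sect_divisible_by_coord_power[OF W4(1,2) sa, where i = 2 and m = "k + 1" and w = e1 and
        P = "\<lambda>v. - ((v $ 1)\<^sup>2)" and
        A = "\<lambda>v. \<alpha> * (v $ 0 * v $ 1 * T v) + v $ 2 * v $ 3 * T v + ?N (k + 3) * ((v $ 2)\<^sup>2 * C v)"])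
    show "rat W4 (\<lambda>v. \<alpha> * (v $ 0 * v $ 1 * T v) + v $ 2 * v $ 3 * T v + ?N (k + 3) * ((v $ 2)\<^sup>2 * C v))"
      by (intro rat_intros W4 rb4)
    show "polyfun (\<lambda>v :: 'a ^ 4. - ((v $ 1)\<^sup>2))" by (intro polyfun_intros)
  qed (use eq6 in \<open>auto simp: u\<close>)
  note inW4 = subsetD[OF cone_mono[OF W5(3)]]
  have rb5: "rat W5 A" "rat W5 T" "rat W5 C"
    using rb4 rat_mono[OF _ W5(1,3)] rat_of_sect[OF W5(4)] by auto
  have rel: "\<alpha> * (v $ 0 * v $ 1 * T v) + v $ 2 * v $ 3 * T v + ?N (k + 3) * ((v $ 2)\<^sup>2 * C v) = - ((v $ 1)\<^sup>2) * A v"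
    if "v \<in> cone W5" for v
  proof (rule rat_eqI[where P = "\<lambda>v. v $ 2 ^ (k + 1)" and u = ones and U = W5 and v = v])
    show "v $ 2 ^ (k + 1) * (\<alpha> * (v $ 0 * v $ 1 * T v) + v $ 2 * v $ 3 * T v + ?N (k + 3) * ((v $ 2)\<^sup>2 * C v))
       = v $ 2 ^ (k + 1) * (- ((v $ 1)\<^sup>2) * A v)" if "v \<in> cone W5" for v
      using eq6[OF inW4[OF that]] W5(5)[OF that] by (simp only: mult.left_commute)
  qed (use that in \<open>auto simp: u simp del: of_nat_add power_Suc intro!: rat_intros polyfun_intros W5 rb5\<close>)
  show thesis
  proof (rule that[of W5 A T C])
    show "open W5" "p \<in> W5" "W5 \<subseteq> V" using W5 W4 W3 W2 W1 by blast+
    show "sect 1 W5 A" using W5(4) by simp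
    show "sect 1 W5 T" "sect 1 W5 C" using sTC sect_mono W5 by blast+
    fix v assume v: "v \<in> cone W5"
    then have v': "v \<in> cone W4" "v \<in> cone W3" "v \<in> cone W2" "v \<in> cone W1"
      using inW4 inW3 inW2 inW1 by blast+
    show "(v $ 1)\<^sup>2 * A v + (\<alpha> * v $ 0 * v $ 1 + v $ 2 * v $ 3) * T v + ?N (k + 3) * (v $ 2)\<^sup>2 * C v = 0"
      using rel[OF v] by (simp add: algebra_simps del: of_nat_add)
    show "b0 v = v $ 2 ^ (k + 1) * A v + \<alpha> * v $ 0 * v $ 1 ^ k * T v - ?N (k + 2) * v $ 0 * v $ 1 ^ k * C v"
      using W5(5)[OF v] unfolding a'_def by (simp add: algebra_simps del: of_nat_add)
    show "b1 v = (v $ 2 ^ (k + 1) - v $ 1 ^ (k + 1)) * T v / ?N (k + 1) + v $ 1 ^ (k + 1) * C v"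
      by (rule b1[OF v'(1)])
    show "b2 v = v $ 2 * v $ 1 ^ k * C v" using W1(5)[OF v'(4)] W4(5)[OF v'(1)] by simp
    have "d1 v = v $ 1 ^ k * T v - ?N (k + 2) * c1 v" using W3(5)[OF v'(2)] by (simp add: algebra_simps)
    then show "b3 v = v $ 3 * (v $ 1 ^ k * T v - ?N (k + 2) * v $ 1 ^ k * C v)"
      using W2(5)[OF v'(3)] W4(5)[OF v'(1)] by (simp add: mult.assoc)
  qed
qed

lemma sect_div_coord:
  assumes "sect e U s" "open U" "U \<subseteq> chart i" "d = e - int m"
  shows "sect d U (\<lambda>v. s v / v $ i ^ m)"
  using sect_divide_coord_power[OF assms(1-3), of m] assms(4) by simp

lemma divide_by_square:
  fixes d :: "'a::field"
  assumes "d \<noteq> 0" "d\<^sup>2 * c = n - d * m"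
  shows "c = n / d\<^sup>2 - m / d"
  using assms by (simp add: field_simps power2_eq_square)

text \<open>
  Let \<open>q = a v\<^sub>i v\<^sub>j + b v\<^sub>l v\<^sub>m\<close>. Modulo \<open>q\<close> the squares of \<open>a v\<^sub>i v\<^sub>j\<close> and \<open>b v\<^sub>l v\<^sub>m\<close> agree. The relation,
  multiplied by the square of \<open>a v\<^sub>i\<close>, therefore has the form \<open>v\<^sub>l\<^sup>2 L = - q R\<close> with
  \<open>L = (b v\<^sub>m)\<^sup>2 A + (a v\<^sub>i)\<^sup>2 C\<close>. As \<open>v\<^sub>l\<close> does not divide \<open>q\<close>, its square divides \<open>R\<close>; the quotient is \<open>S\<close>.
\<close>

lemma quadric_relation_divide:
  fixes A T C :: "'a::field_char_0 ^ 4 \<Rightarrow> 'a"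
  assumes V: "open V" "p \<in> V" and a: "a \<noteq> 0" and il: "i \<noteq> l" "j \<noteq> l"
    and s: "sect 1 V A" "sect 1 V T" "sect 1 V C"
    and rel: "\<And>v. v \<in> cone V \<Longrightarrow>
      (v $ j)\<^sup>2 * A v + (a * v $ i * v $ j + b * v $ l * v $ m) * T v + (v $ l)\<^sup>2 * C v = 0"
  obtains W S where "open W" "p \<in> W" "W \<subseteq> V" "sect 1 W S"
    "\<And>v. v \<in> cone W \<Longrightarrow> (a * v $ i)\<^sup>2 * T v =
      v $ l * (v $ l * S v + b * (v $ m * A v)) - a * v $ i * (v $ j * A v)"
    "\<And>v. v \<in> cone W \<Longrightarrow> (a * v $ i)\<^sup>2 * C v =
      - (b * v $ m * (v $ l * S v + b * (v $ m * A v))) - a * v $ i * (v $ j * S v)"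
proof -
  let ?q = "\<lambda>v :: 'a ^ 4. a * v $ i * v $ j + b * v $ l * v $ m"
  define u ones :: "'a ^ 4" where "u = (\<chi> n. if n = i \<or> n = j then 1 else 0)" and "ones = (\<chi> n. 1)"
  note r = s[THEN rat_of_sect]
  let ?R = "\<lambda>v. a * (v $ i * (v $ j * A v)) - b * (v $ l * (v $ m * A v)) + a\<^sup>2 * (v $ i * (v $ i * T v))"
  let ?L = "\<lambda>v. (b * v $ m)\<^sup>2 * A v + (a * v $ i)\<^sup>2 * C v"
  have s3: "sect 3 V (\<lambda>v. v $ n * (v $ n' * h v))" if "sect 1 V h" for n n' h
    by (rule sect_times_coord[OF sect_times_coord[OF that V(1) refl] V(1)]) simp
  have sR: "sect 3 V ?R" by (intro sect_add sect_diff sect_cmult s3 s V)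
  have eq: "v $ l ^ 2 * ?L v = - ?q v * ?R v" if "v \<in> cone V" for v
  proof -
    have "v $ l ^ 2 * ?L v + ?q v * ?R v = (a * v $ i)\<^sup>2 * ((v $ j)\<^sup>2 * A v + ?q v * T v + (v $ l)\<^sup>2 * C v)"
      by (simp add: algebra_simps power2_eq_square)
    then show ?thesis using rel[OF that] unfolding mult_minus_left eq_neg_iff_add_eq_0 by simp
  qed
  have rL: "rat V ?L" by (intro rat_intros V r)
  have pq: "polyfun (\<lambda>v. - ?q v)" by (intro polyfun_intros)
  obtain W S where W: "open W" "p \<in> W" "W \<subseteq> V" "sect (3 - int 2) W S"
    "\<And>v. v \<in> cone W \<Longrightarrow> ?R v = v $ l ^ 2 * S v"
    by (rule sect_divisible_by_coord_power[OF V sR rL pq, where i = l and m = 2 and w = u])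
       (use eq a il in \<open>auto simp: u_def\<close>)
  have rW: "rat W A" "rat W C" "rat W S"
    using r rat_mono[OF _ W(1,3)] rat_of_sect[OF W(4)] by auto
  have LS: "?L v = - ?q v * S v" if "v \<in> cone W" for v
  proof (rule rat_eqI[where P = "\<lambda>v. v $ l ^ 2" and u = ones and U = W and v = v])
    show "v $ l ^ 2 * ?L v = v $ l ^ 2 * (- ?q v * S v)" if "v \<in> cone W" for v
      using eq W(5)[OF that] subsetD[OF cone_mono[OF W(3)] that] by (simp only: mult.left_commute)
  qed (use that in \<open>auto simp: ones_def intro!: rat_intros polyfun_intros W rW\<close>)
  show thesis
  proof (rule that[OF W(1-3)])
    show "sect 1 W S" using W(4) by simp
    fix v assume v: "v \<in> cone W"
    show "(a * v $ i)\<^sup>2 * T v = v $ l * (v $ l * S v + b * (v $ m * A v)) - a * v $ i * (v $ j * A v)"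
      using W(5)[OF v] by (simp add: algebra_simps power2_eq_square)
    show "(a * v $ i)\<^sup>2 * C v = - (b * v $ m * (v $ l * S v + b * (v $ m * A v))) - a * v $ i * (v $ j * S v)"
      using LS[OF v] by (simp add: eq_diff_eq eq_neg_iff_add_eq_0 algebra_simps power2_eq_square)
  qed
qed

text \<open>
  Given \<open>A, T, C\<close>, the \<open>e\<^sub>l\<close> are only unique up to multiples of \<open>(y, - \<alpha> x, w, - z)\<close>. On each chart one
  of them can thus be made zero. Where \<open>y\<close> or \<open>z\<close> is invertible, the other three are obtained by solving
  linear equations. Where \<open>x\<close> or \<open>w\<close> is invertible, one equation still has to be divided by \<open>z\<close> or \<open>y\<close>,
  which is the quotient \<open>S\<close> of \<open>quadric_relation_divide\<close>; the two cases are interchanged by the symmetry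
  that reverses the order of the coordinates.
\<close>

lemma quadric_syzygy_lift:
  fixes A T C :: "'a::field_char_0 ^ 4 \<Rightarrow> 'a"
  assumes V: "open V" "p \<in> V" and \<alpha>: "\<alpha> \<noteq> 0"
    and s: "sect 1 V A" "sect 1 V T" "sect 1 V C"
    and rel: "\<And>v. v \<in> cone V \<Longrightarrow>
      (v $ 1)\<^sup>2 * A v + (\<alpha> * v $ 0 * v $ 1 + v $ 2 * v $ 3) * T v + (v $ 2)\<^sup>2 * C v = 0"
  obtains W e0 e1 e2 e3 where "open W" "p \<in> W" "W \<subseteq> V"
    "sect 0 W e0" "sect 0 W e1" "sect 0 W e2" "sect 0 W e3"
    "\<And>v. v \<in> cone W \<Longrightarrow> \<alpha> * v $ 0 * e0 v + v $ 1 * e1 v + v $ 2 * e2 v + v $ 3 * e3 v = 0"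
    "\<And>v. v \<in> cone W \<Longrightarrow> A v = - v $ 2 * e1 v + \<alpha> * v $ 0 * e3 v"
    "\<And>v. v \<in> cone W \<Longrightarrow> T v = - v $ 2 * e0 v - v $ 1 * e3 v"
    "\<And>v. v \<in> cone W \<Longrightarrow> C v = v $ 3 * e0 v - v $ 1 * e2 v"
proof -
  obtain i where i: "p \<in> chart i" using ex_chart by blast
  have sV: "sect 1 W A" "sect 1 W T" "sect 1 W C" if "open W" "W \<subseteq> V" for W
    using s that sect_mono by blast+
  consider "i = 0" | "i = 1" | "i = 2" | "i = 3"
    using all_4[of "\<lambda>i. i = 0 \<or> i = 1 \<or> i = 2 \<or> i = 3"] by auto
  then show thesis
  proof cases
    case 1
    have rel': "(v $ 1)\<^sup>2 * A v + (\<alpha> * v $ 0 * v $ 1 + 1 * v $ 2 * v $ 3) * T v + (v $ 2)\<^sup>2 * C v = 0"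
      if "v \<in> cone V" for v using rel[OF that] by simp
    have "(0::4) \<noteq> 2" "(1::4) \<noteq> 2" by simp_all
    from quadric_relation_divide[OF V \<alpha> this s rel']
    obtain W S where W: "open W" "p \<in> W" "W \<subseteq> V" "sect 1 W S"
      and T: "\<And>v. v \<in> cone W \<Longrightarrow> (\<alpha> * v $ 0)\<^sup>2 * T v =
        v $ 2 * (v $ 2 * S v + 1 * (v $ 3 * A v)) - \<alpha> * v $ 0 * (v $ 1 * A v)"
      and C: "\<And>v. v \<in> cone W \<Longrightarrow> (\<alpha> * v $ 0)\<^sup>2 * C v =
        - (1 * v $ 3 * (v $ 2 * S v + 1 * (v $ 3 * A v))) - \<alpha> * v $ 0 * (v $ 1 * S v)"
      by blast
    let ?W = "W \<inter> chart 0"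
    have oW: "open ?W" using W(1) by auto
    have WV: "?W \<subseteq> V" using W(3) by blast
    note sW = sV[OF oW WV]
    have sS: "sect 1 ?W S" using sect_mono[OF W(4) oW] by simp
    show ?thesis
    proof (rule that[of ?W "\<lambda>v. - (1 / \<alpha>\<^sup>2) * ((v $ 2 * S v + v $ 3 * A v) / v $ 0 ^ 2)" "\<lambda>v. 0"
          "\<lambda>v. (1 / \<alpha>) * (S v / v $ 0 ^ 1)" "\<lambda>v. (1 / \<alpha>) * (A v / v $ 0 ^ 1)"])
      show "sect 0 ?W (\<lambda>v. (1 / \<alpha>) * (S v / v $ 0 ^ 1))" "sect 0 ?W (\<lambda>v. (1 / \<alpha>) * (A v / v $ 0 ^ 1))"
        by (intro sect_cmult oW sect_div_coord[OF sS] sect_div_coord[OF sW(1)]; simp)+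
      have "sect 2 ?W (\<lambda>v. v $ 2 * S v + v $ 3 * A v)"
        by (intro sect_add sect_times_coord[OF sS] sect_times_coord[OF sW(1)] oW; simp)
      then show "sect 0 ?W (\<lambda>v. - (1 / \<alpha>\<^sup>2) * ((v $ 2 * S v + v $ 3 * A v) / v $ 0 ^ 2))"
        by (intro sect_cmult oW sect_div_coord[OF _ oW]) auto
      show "sect 0 ?W (\<lambda>v. 0)" by (rule sect_zero[OF oW])
      fix v assume "v \<in> cone ?W"
      then have v: "v \<in> cone W" "v $ 0 \<noteq> 0" by (auto simp: cone_Int cone_chart)
      show "\<alpha> * v $ 0 * (- (1 / \<alpha>\<^sup>2) * ((v $ 2 * S v + v $ 3 * A v) / v $ 0 ^ 2)) + v $ 1 * 0 +
          v $ 2 * ((1 / \<alpha>) * (S v / v $ 0 ^ 1)) + v $ 3 * ((1 / \<alpha>) * (A v / v $ 0 ^ 1)) = 0"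
        using v(2) \<alpha> by (simp add: field_simps power2_eq_square)
      show "A v = - v $ 2 * 0 + \<alpha> * v $ 0 * ((1 / \<alpha>) * (A v / v $ 0 ^ 1))"
        using v(2) \<alpha> by simp
      have "(\<alpha> * v $ 0)\<^sup>2 * T v = v $ 2 * (v $ 2 * S v + v $ 3 * A v) - \<alpha> * v $ 0 * (v $ 1 * A v)"
        using T[OF v(1)] by (simp add: algebra_simps)
      from divide_by_square[OF _ this] show "T v = - v $ 2 * (- (1 / \<alpha>\<^sup>2) * ((v $ 2 * S v + v $ 3 * A v) / v $ 0 ^ 2)) -
          v $ 1 * ((1 / \<alpha>) * (A v / v $ 0 ^ 1))"
        using v(2) \<alpha> by (simp add: power_mult_distrib)
      have "(\<alpha> * v $ 0)\<^sup>2 * C v = - (v $ 3 * (v $ 2 * S v + v $ 3 * A v)) - \<alpha> * v $ 0 * (v $ 1 * S v)"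
        using C[OF v(1)] by simp
      from divide_by_square[OF _ this] show "C v = v $ 3 * (- (1 / \<alpha>\<^sup>2) * ((v $ 2 * S v + v $ 3 * A v) / v $ 0 ^ 2)) -
          v $ 1 * ((1 / \<alpha>) * (S v / v $ 0 ^ 1))"
        using v(2) \<alpha> by (simp add: power_mult_distrib)
    qed (use W i 1 in auto)
  next
    case 4
    have rel': "(v $ 2)\<^sup>2 * C v + (1 * v $ 3 * v $ 2 + \<alpha> * v $ 1 * v $ 0) * T v + (v $ 1)\<^sup>2 * A v = 0"
      if "v \<in> cone V" for v using rel[OF that] by (simp add: algebra_simps)
    have "(1::'a) \<noteq> 0" "(3::4) \<noteq> 1" "(2::4) \<noteq> 1" by simp_all
    from quadric_relation_divide[OF V this s(3,2,1) rel']
    obtain W S where W: "open W" "p \<in> W" "W \<subseteq> V" "sect 1 W S"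
      and T: "\<And>v. v \<in> cone W \<Longrightarrow> (1 * v $ 3)\<^sup>2 * T v =
        v $ 1 * (v $ 1 * S v + \<alpha> * (v $ 0 * C v)) - 1 * v $ 3 * (v $ 2 * C v)"
      and A: "\<And>v. v \<in> cone W \<Longrightarrow> (1 * v $ 3)\<^sup>2 * A v =
        - (\<alpha> * v $ 0 * (v $ 1 * S v + \<alpha> * (v $ 0 * C v))) - 1 * v $ 3 * (v $ 2 * S v)"
      by blast
    let ?W = "W \<inter> chart 3"
    have oW: "open ?W" using W(1) by auto
    have WV: "?W \<subseteq> V" using W(3) by blast
    note sW = sV[OF oW WV]
    have sS: "sect 1 ?W S" using sect_mono[OF W(4) oW] by simp
    show ?thesis
    proof (rule that[of ?W "\<lambda>v. C v / v $ 3 ^ 1" "\<lambda>v. S v / v $ 3 ^ 1" "\<lambda>v. 0"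
          "\<lambda>v. - 1 * ((\<alpha> * (v $ 0 * C v) + v $ 1 * S v) / v $ 3 ^ 2)"])
      show "sect 0 ?W (\<lambda>v. C v / v $ 3 ^ 1)" "sect 0 ?W (\<lambda>v. S v / v $ 3 ^ 1)"
        by (intro oW sect_div_coord[OF sS] sect_div_coord[OF sW(3)]; simp)+
      have "sect 2 ?W (\<lambda>v. \<alpha> * (v $ 0 * C v) + v $ 1 * S v)"
        by (intro sect_add sect_cmult sect_times_coord[OF sS] sect_times_coord[OF sW(3)] oW; simp)
      then show "sect 0 ?W (\<lambda>v. - 1 * ((\<alpha> * (v $ 0 * C v) + v $ 1 * S v) / v $ 3 ^ 2))"
        by (intro sect_cmult oW sect_div_coord[OF _ oW]) auto
      show "sect 0 ?W (\<lambda>v. 0)" by (rule sect_zero[OF oW])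
      fix v assume "v \<in> cone ?W"
      then have v: "v \<in> cone W" "v $ 3 \<noteq> 0" by (auto simp: cone_Int cone_chart)
      show "\<alpha> * v $ 0 * (C v / v $ 3 ^ 1) + v $ 1 * (S v / v $ 3 ^ 1) + v $ 2 * 0 +
          v $ 3 * (- 1 * ((\<alpha> * (v $ 0 * C v) + v $ 1 * S v) / v $ 3 ^ 2)) = 0"
        using v(2) by (simp add: field_simps power2_eq_square)
      show "C v = v $ 3 * (C v / v $ 3 ^ 1) - v $ 1 * 0"
        using v(2) by simp
      have "(v $ 3)\<^sup>2 * T v = v $ 1 * (\<alpha> * (v $ 0 * C v) + v $ 1 * S v) - v $ 2 * (v $ 3 * C v)"
        using T[OF v(1)] by (simp add: algebra_simps)
      then show "T v = - v $ 2 * (C v / v $ 3 ^ 1) -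
          v $ 1 * (- 1 * ((\<alpha> * (v $ 0 * C v) + v $ 1 * S v) / v $ 3 ^ 2))"
        using v(2) by (simp add: field_simps power2_eq_square)
      have "(v $ 3)\<^sup>2 * A v = - (\<alpha> * v $ 0 * (\<alpha> * (v $ 0 * C v) + v $ 1 * S v)) - v $ 3 * (v $ 2 * S v)"
        using A[OF v(1)] by (simp add: add.commute)
      from divide_by_square[OF _ this] show "A v = - v $ 2 * (S v / v $ 3 ^ 1) +
          \<alpha> * v $ 0 * (- 1 * ((\<alpha> * (v $ 0 * C v) + v $ 1 * S v) / v $ 3 ^ 2))"
        using v(2) by (simp add: diff_divide_distrib add_divide_distrib algebra_simps eq_neg_iff_add_eq_0)
    qed (use W i 4 in auto)
  next
    case 3
    let ?W = "V \<inter> chart 2"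
    have oW: "open ?W" using V(1) by auto
    note sW = sV[OF oW Int_lower1]
    show ?thesis
    proof (rule that[of ?W "\<lambda>v. - 1 * (T v / v $ 2 ^ 1)" "\<lambda>v. - 1 * (A v / v $ 2 ^ 1)"
          "\<lambda>v. (\<alpha> * (v $ 0 * T v) + v $ 1 * A v) / v $ 2 ^ 2" "\<lambda>v. 0"])
      show "sect 0 ?W (\<lambda>v. - 1 * (T v / v $ 2 ^ 1))" "sect 0 ?W (\<lambda>v. - 1 * (A v / v $ 2 ^ 1))"
        by (intro sect_cmult oW sect_div_coord[OF sW(1)] sect_div_coord[OF sW(2)]; simp)+
      have "sect 2 ?W (\<lambda>v. \<alpha> * (v $ 0 * T v) + v $ 1 * A v)"
        by (intro sect_add sect_cmult sect_times_coord[OF sW(2)] sect_times_coord[OF sW(1)] oW; simp)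
      then show "sect 0 ?W (\<lambda>v. (\<alpha> * (v $ 0 * T v) + v $ 1 * A v) / v $ 2 ^ 2)"
        by (intro oW sect_div_coord[OF _ oW]) auto
      show "sect 0 ?W (\<lambda>v. 0)" by (rule sect_zero[OF oW])
      fix v assume "v \<in> cone ?W"
      then have v: "v \<in> cone V" "v $ 2 \<noteq> 0" by (auto simp: cone_Int cone_chart)
      show "\<alpha> * v $ 0 * (- 1 * (T v / v $ 2 ^ 1)) + v $ 1 * (- 1 * (A v / v $ 2 ^ 1)) +
          v $ 2 * ((\<alpha> * (v $ 0 * T v) + v $ 1 * A v) / v $ 2 ^ 2) + v $ 3 * 0 = 0"
        using v(2) by (simp add: field_simps power2_eq_square)
      show "A v = - v $ 2 * (- 1 * (A v / v $ 2 ^ 1)) + \<alpha> * v $ 0 * 0"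
        "T v = - v $ 2 * (- 1 * (T v / v $ 2 ^ 1)) - v $ 1 * 0"
        using v(2) by simp_all
      have "(v $ 2)\<^sup>2 * C v = - (v $ 3 * v $ 2 * T v) - v $ 1 * (\<alpha> * (v $ 0 * T v) + v $ 1 * A v)"
        using rel[OF v(1)] by (simp add: algebra_simps power2_eq_square eq_neg_iff_add_eq_0 eq_diff_eq)
      then show "C v = v $ 3 * (- 1 * (T v / v $ 2 ^ 1)) - v $ 1 * ((\<alpha> * (v $ 0 * T v) + v $ 1 * A v) / v $ 2 ^ 2)"
        using v(2) by (simp add: field_simps power2_eq_square)
    qed (use V i 3 in auto)
  next
    case 2
    let ?W = "V \<inter> chart 1"
    have oW: "open ?W" using V(1) by auto
    note sW = sV[OF oW Int_lower1]
    show ?thesis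
    proof (rule that[of ?W "\<lambda>v. 0" "\<lambda>v. (v $ 2 * C v + v $ 3 * T v) / v $ 1 ^ 2"
          "\<lambda>v. - 1 * (C v / v $ 1 ^ 1)" "\<lambda>v. - 1 * (T v / v $ 1 ^ 1)"])
      show "sect 0 ?W (\<lambda>v. - 1 * (C v / v $ 1 ^ 1))" "sect 0 ?W (\<lambda>v. - 1 * (T v / v $ 1 ^ 1))"
        by (intro sect_cmult oW sect_div_coord[OF sW(3)] sect_div_coord[OF sW(2)]; simp)+
      have "sect 2 ?W (\<lambda>v. v $ 2 * C v + v $ 3 * T v)"
        by (intro sect_add sect_times_coord[OF sW(2)] sect_times_coord[OF sW(3)] oW; simp)
      then show "sect 0 ?W (\<lambda>v. (v $ 2 * C v + v $ 3 * T v) / v $ 1 ^ 2)"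
        by (intro oW sect_div_coord[OF _ oW]) auto
      show "sect 0 ?W (\<lambda>v. 0)" by (rule sect_zero[OF oW])
      fix v assume "v \<in> cone ?W"
      then have v: "v \<in> cone V" "v $ 1 \<noteq> 0" by (auto simp: cone_Int cone_chart)
      show "\<alpha> * v $ 0 * 0 + v $ 1 * ((v $ 2 * C v + v $ 3 * T v) / v $ 1 ^ 2) +
          v $ 2 * (- 1 * (C v / v $ 1 ^ 1)) + v $ 3 * (- 1 * (T v / v $ 1 ^ 1)) = 0"
        using v(2) by (simp add: field_simps power2_eq_square)
      show "T v = - v $ 2 * 0 - v $ 1 * (- 1 * (T v / v $ 1 ^ 1))"
        "C v = v $ 3 * 0 - v $ 1 * (- 1 * (C v / v $ 1 ^ 1))"
        using v(2) by simp_all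
      have "(v $ 1)\<^sup>2 * A v = - (v $ 2 * (v $ 2 * C v + v $ 3 * T v)) - v $ 1 * (\<alpha> * v $ 0 * T v)"
        using rel[OF v(1)] by (simp add: algebra_simps power2_eq_square eq_neg_iff_add_eq_0 eq_diff_eq)
      from divide_by_square[OF _ this] show "A v = - v $ 2 * ((v $ 2 * C v + v $ 3 * T v) / v $ 1 ^ 2) + \<alpha> * v $ 0 * (- 1 * (T v / v $ 1 ^ 1))"
        using v(2) by (simp add: power_mult_distrib)
    qed (use V i 2 in auto)
  qed
qed

text \<open>
  On the chart of an invertible coordinate, \<open>\<mu>\<close> is, up to a constant factor, the quotient of one of the
  \<open>e\<^sub>l\<close> by it. The other \<open>e\<^sub>l\<close> follow from the equations, in part after cancelling \<open>y\<close> or \<open>z\<close>.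
\<close>

lemma contact_kernel:
  fixes e0 e1 e2 e3 :: "'a::field_char_0 ^ 4 \<Rightarrow> 'a"
  assumes V: "open V" "p \<in> V" and \<alpha>: "\<alpha> \<noteq> 0"
    and s: "sect 0 V e0" "sect 0 V e1" "sect 0 V e2" "sect 0 V e3"
    and A: "\<And>v. v \<in> cone V \<Longrightarrow> v $ 2 * e1 v = \<alpha> * v $ 0 * e3 v"
    and T: "\<And>v. v \<in> cone V \<Longrightarrow> v $ 2 * e0 v = - (v $ 1 * e3 v)"
    and C: "\<And>v. v \<in> cone V \<Longrightarrow> v $ 3 * e0 v = v $ 1 * e2 v"
  obtains W \<mu> where "open W" "p \<in> W" "W \<subseteq> V" "sect (-1) W \<mu>"
    "\<And>v. v \<in> cone W \<Longrightarrow> e0 v = v $ 1 * \<mu> v \<and> e1 v = - (\<alpha> * v $ 0 * \<mu> v) \<and>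
      e2 v = v $ 3 * \<mu> v \<and> e3 v = - (v $ 2 * \<mu> v)"
proof -
  define ones :: "'a ^ 4" where "ones = (\<chi> i. 1)"
  have cancel: "h v = h' v" if "\<And>v. v \<in> cone W \<Longrightarrow> v $ i * h v = v $ i * h' v" "v \<in> cone W" "rat W h" "rat W h'"
    for W i h h' and v :: "'a ^ 4"
    by (rule rat_eqI[where P = "\<lambda>v. v $ i" and u = ones and U = W and v = v])
       (use that in \<open>auto simp: ones_def\<close>)
  obtain i where i: "p \<in> chart i" using ex_chart by blast
  let ?W = "V \<inter> chart i"
  have oW: "open ?W" using V(1) by auto
  have sW: "sect 0 ?W e0" "sect 0 ?W e1" "sect 0 ?W e2" "sect 0 ?W e3"
    using s sect_mono[OF _ oW Int_lower1] by blast+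
  note rW = sW[THEN rat_of_sect]
  have A: "v $ 2 * e1 v = \<alpha> * v $ 0 * e3 v" and T: "v $ 2 * e0 v = - (v $ 1 * e3 v)"
    and C: "v $ 3 * e0 v = v $ 1 * e2 v" and vi: "v $ i \<noteq> 0" if "v \<in> cone ?W" for v
    using that A T C by (auto simp: cone_Int cone_chart)
  consider "i = 0" | "i = 1" | "i = 2" | "i = 3"
    using all_4[of "\<lambda>i. i = 0 \<or> i = 1 \<or> i = 2 \<or> i = 3"] by auto
  then show thesis
  proof cases
    case 1
    define \<mu> where "\<mu> = (\<lambda>v. - (1 / \<alpha>) * (e1 v / v $ 0 ^ 1))"
    have s\<mu>: "sect (-1) ?W \<mu>"
      unfolding \<mu>_def by (intro sect_cmult oW sect_div_coord[OF sW(2) oW]) (auto simp: 1)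
    note r = rat_of_sect[OF s\<mu>]
    have *: "e1 v = - (\<alpha> * v $ 0 * \<mu> v)" "e3 v = - (v $ 2 * \<mu> v)" if "v \<in> cone ?W" for v
      using A[OF that] vi[OF that] \<alpha> by (auto simp: \<mu>_def 1 field_simps)
    have e0: "e0 v = v $ 1 * \<mu> v" if "v \<in> cone ?W" for v
      by (rule cancel[where i = 2, OF _ that]) (use T * in \<open>auto intro!: rat_intros rW r oW\<close>)
    have e2: "e2 v = v $ 3 * \<mu> v" if "v \<in> cone ?W" for v
      by (rule cancel[where i = 1, OF _ that]) (use e0 in \<open>auto simp: C[symmetric] mult.left_commute intro!: rat_intros rW r oW\<close>)
    show ?thesis by (rule that[OF oW _ _ s\<mu>]) (use * e0 e2 V i in auto)
  next
    case 2
    define \<mu> where "\<mu> = (\<lambda>v. e0 v / v $ 1 ^ 1)"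
    have s\<mu>: "sect (-1) ?W \<mu>"
      unfolding \<mu>_def by (intro oW sect_div_coord[OF sW(1) oW]) (auto simp: 2)
    note r = rat_of_sect[OF s\<mu>]
    have *: "e0 v = v $ 1 * \<mu> v" "e3 v = - (v $ 2 * \<mu> v)" "e2 v = v $ 3 * \<mu> v" if "v \<in> cone ?W" for v
      using T[OF that] C[OF that] vi[OF that] by (auto simp: \<mu>_def 2 field_simps)
    have e1: "e1 v = - (\<alpha> * v $ 0 * \<mu> v)" if "v \<in> cone ?W" for v
      by (rule cancel[where i = 2, OF _ that]) (use A * in \<open>auto intro!: rat_intros rW r oW\<close>)
    show ?thesis by (rule that[OF oW _ _ s\<mu>]) (use * e1 V i in auto)
  next
    case 3
    define \<mu> where "\<mu> = (\<lambda>v. - 1 * (e3 v / v $ 2 ^ 1))"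
    have s\<mu>: "sect (-1) ?W \<mu>"
      unfolding \<mu>_def by (intro sect_cmult oW sect_div_coord[OF sW(4) oW]) (auto simp: 3)
    note r = rat_of_sect[OF s\<mu>]
    have *: "e3 v = - (v $ 2 * \<mu> v)" "e0 v = v $ 1 * \<mu> v" "e1 v = - (\<alpha> * v $ 0 * \<mu> v)" if "v \<in> cone ?W" for v
      using T[OF that] A[OF that] vi[OF that] by (auto simp: \<mu>_def 3 field_simps)
    have e2: "e2 v = v $ 3 * \<mu> v" if "v \<in> cone ?W" for v
      by (rule cancel[where i = 1, OF _ that]) (use * in \<open>auto simp: C[symmetric] mult.left_commute intro!: rat_intros rW r oW\<close>)
    show ?thesis by (rule that[OF oW _ _ s\<mu>]) (use * e2 V i in auto)
  next
    case 4
    define \<mu> where "\<mu> = (\<lambda>v. e2 v / v $ 3 ^ 1)"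
    have s\<mu>: "sect (-1) ?W \<mu>"
      unfolding \<mu>_def by (intro oW sect_div_coord[OF sW(3) oW]) (auto simp: 4)
    note r = rat_of_sect[OF s\<mu>]
    have *: "e2 v = v $ 3 * \<mu> v" "e0 v = v $ 1 * \<mu> v" if "v \<in> cone ?W" for v
      using C[OF that] vi[OF that] by (auto simp: \<mu>_def 4 field_simps)
    have e3: "e3 v = - (v $ 2 * \<mu> v)" if "v \<in> cone ?W" for v
    proof (rule cancel[where i = 1, OF _ that])
      show "v $ 1 * e3 v = v $ 1 * - (v $ 2 * \<mu> v)" if "v \<in> cone ?W" for v
        using T[OF that] *(2)[OF that] by (simp add: minus_equation_iff mult.left_commute)
    qed (auto intro!: rat_intros rW r oW)
    have e1: "e1 v = - (\<alpha> * v $ 0 * \<mu> v)" if "v \<in> cone ?W" for v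
      by (rule cancel[where i = 2, OF _ that]) (use A e3 in \<open>auto intro!: rat_intros rW r oW\<close>)
    show ?thesis by (rule that[OF oW _ _ s\<mu>]) (use * e1 e3 V i in auto)
  qed
qed

section \<open>Tangent vectors\<close>

lemma regular_at_iff: "regular_at p b \<longleftrightarrow> (\<exists>U. open U \<and> p \<in> U \<and> sect 0 U (\<lambda>v. b (pt v)))"
  by (simp add: regular_at_def regular_on_iff_sect)

lemma regular_onD:
  assumes "regular_on U b" "p \<in> U"
  shows "\<exists>V F G d. open V \<and> p \<in> V \<and> V \<subseteq> U \<and> homogeneous d F \<and> homogeneous d G \<and>
     (\<forall>v\<in>cone V. peval G v \<noteq> 0 \<and> b (pt v) = peval F v / peval G v)"
  using assms unfolding regular_on_def by (rule bspec)

lemma regular_at_add: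
  assumes "regular_at p b" "regular_at p c" shows "regular_at p (\<lambda>q. b q + c q)"
proof -
  obtain U V where "open U" "p \<in> U" "sect 0 U (\<lambda>v. b (pt v))" "open V" "p \<in> V" "sect 0 V (\<lambda>v. c (pt v))"
    using assms unfolding regular_at_iff by blast
  then have "sect 0 (U \<inter> V) (\<lambda>v. b (pt v) + c (pt v))"
    by (intro sect_add sect_mono[of 0 U _ "U \<inter> V"] sect_mono[of 0 V _ "U \<inter> V"] open_Int) auto
  then show ?thesis unfolding regular_at_iff
    using \<open>open U\<close> \<open>open V\<close> \<open>p \<in> U\<close> \<open>p \<in> V\<close> by blast
qed

lemma regular_at_mult:
  assumes "regular_at p b" "regular_at p c" shows "regular_at p (\<lambda>q. b q * c q)"
proof -
  obtain U V where "open U" "p \<in> U" "sect 0 U (\<lambda>v. b (pt v))" "open V" "p \<in> V" "sect 0 V (\<lambda>v. c (pt v))"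
    using assms unfolding regular_at_iff by blast
  then have "sect (0 + 0) (U \<inter> V) (\<lambda>v. b (pt v) * c (pt v))"
    by (intro sect_mult sect_mono[of 0 U _ "U \<inter> V"] sect_mono[of 0 V _ "U \<inter> V"] open_Int) auto
  then show ?thesis unfolding regular_at_iff
    using \<open>open U\<close> \<open>open V\<close> \<open>p \<in> U\<close> \<open>p \<in> V\<close> by auto
qed

lemma regular_at_const: "regular_at p (\<lambda>q. c)"
  unfolding regular_at_iff using sect_const[of UNIV c] by auto

text \<open>
  The tangent vectors without their convention about values at functions that are not regular;
  that convention is not preserved by linear combinations.
\<close>

definition derivation :: "'a::field proj3 \<Rightarrow> (('a proj3 \<Rightarrow> 'a) \<Rightarrow> 'a) \<Rightarrow> bool" where
  "derivation p D \<longleftrightarrow>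
     (\<forall>b c. regular_at p b \<and> regular_at p c \<longrightarrow>
        ((\<exists>U. open U \<and> p \<in> U \<and> (\<forall>q\<in>U. b q = c q)) \<longrightarrow> D b = D c) \<and>
        D (\<lambda>q. b q + c q) = D b + D c \<and>
        D (\<lambda>q. b q * c q) = b p * D c + c p * D b) \<and>
     (\<forall>r b. regular_at p b \<longrightarrow> D (\<lambda>q. r * b q) = r * D b)"

lemma tangent_space_eq: "tangent_space p = {D \<in> extensional {b. regular_at p b}. derivation p D}"
  by (simp add: tangent_space_def derivation_def)

lemma derivation_local:
  "derivation p D \<Longrightarrow> regular_at p b \<Longrightarrow> regular_at p c \<Longrightarrow> open U \<Longrightarrow> p \<in> U \<Longrightarrow>
    (\<And>q. q \<in> U \<Longrightarrow> b q = c q) \<Longrightarrow> D b = D c"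
  unfolding derivation_def by metis

lemma derivation_add: "derivation p D \<Longrightarrow> regular_at p b \<Longrightarrow> regular_at p c \<Longrightarrow>
    D (\<lambda>q. b q + c q) = D b + D c"
  and derivation_mult: "derivation p D \<Longrightarrow> regular_at p b \<Longrightarrow> regular_at p c \<Longrightarrow>
    D (\<lambda>q. b q * c q) = b p * D c + c p * D b"
  and derivation_scale: "derivation p D \<Longrightarrow> regular_at p b \<Longrightarrow> D (\<lambda>q. r * b q) = r * D b"
  unfolding derivation_def by blast+

lemma derivation_const:
  assumes "derivation p D" shows "D (\<lambda>q. c) = 0"
proof -
  have "D (\<lambda>q. 1 * 1) = 1 * D (\<lambda>q. 1) + 1 * D (\<lambda>q. 1)"
    by (rule derivation_mult[OF assms regular_at_const regular_at_const])
  then have "D (\<lambda>q. 1) + 0 = D (\<lambda>q. 1) + D (\<lambda>q. 1)" by (simp only: mult_1 add_0_right)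
  then have "D (\<lambda>q. 1) = 0" by (simp only: add_left_cancel)
  then show ?thesis using derivation_scale[OF assms regular_at_const, of c 1] by simp
qed

lemma derivation_combination:
  assumes "\<And>j. j \<in> A \<Longrightarrow> derivation p (D j)"
  shows "derivation p (\<lambda>b. \<Sum>j\<in>A. r j * D j b)"
  unfolding derivation_def
proof (intro allI impI conjI)
  fix b c assume bc: "regular_at p b \<and> regular_at p c"
  show "(\<Sum>j\<in>A. r j * D j (\<lambda>q. b q + c q)) = (\<Sum>j\<in>A. r j * D j b) + (\<Sum>j\<in>A. r j * D j c)"
    unfolding sum.distrib[symmetric] using derivation_add[OF assms] bc
    by (intro sum.cong) (auto simp: algebra_simps)
  show "(\<Sum>j\<in>A. r j * D j (\<lambda>q. b q * c q)) = b p * (\<Sum>j\<in>A. r j * D j c) + c p * (\<Sum>j\<in>A. r j * D j b)"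
    unfolding sum_distrib_left sum.distrib[symmetric] using derivation_mult[OF assms] bc
    by (intro sum.cong) (auto simp: algebra_simps)
  assume "\<exists>U. open U \<and> p \<in> U \<and> (\<forall>q\<in>U. b q = c q)"
  then obtain U where U: "open U" "p \<in> U" "\<And>q. q \<in> U \<Longrightarrow> b q = c q" by blast
  show "(\<Sum>j\<in>A. r j * D j b) = (\<Sum>j\<in>A. r j * D j c)"
    using derivation_local[OF assms conjunct1[OF bc] conjunct2[OF bc] U] by (intro sum.cong) auto
next
  fix s b assume b: "regular_at p b"
  show "(\<Sum>j\<in>A. r j * D j (\<lambda>q. s * b q)) = s * (\<Sum>j\<in>A. r j * D j b)"
    unfolding sum_distrib_left using derivation_scale[OF assms b]
    by (intro sum.cong) (auto simp: algebra_simps)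
qed

definition coord :: "4 \<Rightarrow> 4 \<Rightarrow> 'a::field proj3 \<Rightarrow> 'a" where
  "coord i j q = rep_proj3 q $ j / rep_proj3 q $ i"

lemma coord_pt: "v \<noteq> 0 \<Longrightarrow> coord i j (pt v) = v $ j / v $ i"
  by (rule rep_pt[of v]) (auto simp: coord_def)

lemma sect_coord_quotient:
  assumes "open U" "U \<subseteq> chart i"
  shows "sect 0 U (\<lambda>v. coord i j (pt v))"
proof -
  have "sect 0 U (\<lambda>v. v $ j / v $ i ^ 1)"
    by (rule sect_div_coord[OF sect_coord[OF assms(1)] assms]) simp
  then show ?thesis by (subst sect_cong[of U _ "\<lambda>v. v $ j / v $ i ^ 1"]) (auto simp: cone_def coord_pt)
qed

lemma regular_at_coord: "p \<in> chart i \<Longrightarrow> regular_at p (coord i j)"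
  unfolding regular_at_iff using sect_coord_quotient[of "chart i" i j] open_chart by blast

text \<open>
  The functions killed by a derivation form a ring. If it contains the affine coordinates, it contains
  all polynomials in them, and a regular function is locally a quotient of two such polynomials.
\<close>

lemma derivation_eq_zero:
  fixes Z :: "('a::field_char_0 proj3 \<Rightarrow> 'a) \<Rightarrow> 'a"
  assumes Z: "derivation p Z" and p: "p \<in> chart i" and co: "\<And>j. Z (coord i j) = 0"
    and b: "regular_at p b"
  shows "Z b = 0"
proof -
  define K where "K = {b. regular_at p b \<and> Z b = 0}"
  have K_const: "(\<lambda>q. c) \<in> K" for c
    by (simp add: K_def regular_at_const derivation_const[OF Z])
  have K_coord: "coord i j \<in> K" for j
    by (simp add: K_def regular_at_coord[OF p] co)
  have K_add: "(\<lambda>q. b q + c q) \<in> K" if "b \<in> K" "c \<in> K" for b c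
    using that by (simp add: K_def regular_at_add derivation_add[OF Z])
  have K_mult: "(\<lambda>q. b q * c q) \<in> K" if "b \<in> K" "c \<in> K" for b c
    using that by (simp add: K_def regular_at_mult derivation_mult[OF Z])
  have K_sum: "(\<lambda>q. \<Sum>j\<in>A. h j q) \<in> K" if "\<And>j. j \<in> A \<Longrightarrow> h j \<in> K"
    for A :: "(4 \<Rightarrow>\<^sub>0 nat) set" and h
    using that by (induction A rule: infinite_finite_induct) (auto intro: K_const K_add)
  have K_power: "(\<lambda>q. b q ^ m) \<in> K" if "b \<in> K" for b and m :: nat
    using that by (induction m) (auto intro: K_const K_mult)
  have K_prod: "(\<lambda>q. \<Prod>j\<in>A. h j q) \<in> K" if "\<And>j. j \<in> A \<Longrightarrow> h j \<in> K"
    for A :: "4 set" and h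
    using that by (induction A rule: infinite_finite_induct) (auto intro: K_const K_mult)
  let ?\<phi> = "\<lambda>F q. peval F (\<chi> j. coord i j q)"
  have K_poly: "?\<phi> F \<in> K" for F
    unfolding peval_def by (intro K_sum K_mult K_const K_prod) (auto intro: K_power K_coord)
  obtain U where U: "open U" "p \<in> U" "regular_on U b" using b by (auto simp: regular_at_def)
  obtain V F G d where V: "open V" "p \<in> V" "homogeneous d F" "homogeneous d G"
     "\<forall>v\<in>cone V. peval G v \<noteq> 0 \<and> b (pt v) = peval F v / peval G v"
    using regular_onD[OF U(3,2)] by (elim exE conjE) (rule that)
  have hom: "?\<phi> H q = (1 / rep_proj3 q $ i) ^ d * peval H (rep_proj3 q)" if "homogeneous d H" for H q
  proof -
    have "(\<chi> j. coord i j q) = (1 / rep_proj3 q $ i) *s rep_proj3 q"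
      by (simp add: vec_eq_iff coord_def)
    then show ?thesis using peval_scale[OF that] by metis
  qed
  have rG: "regular_at p (?\<phi> G)" "Z (?\<phi> G) = 0" and rF: "regular_at p (?\<phi> F)" "Z (?\<phi> F) = 0"
    using K_poly[of G] K_poly[of F] by (auto simp: K_def)
  have "Z (\<lambda>q. b q * ?\<phi> G q) = Z (?\<phi> F)"
  proof (rule derivation_local[OF Z regular_at_mult[OF b rG(1)] rF(1)])
    show "open (V \<inter> chart i)" "p \<in> V \<inter> chart i" using V p by auto
    fix q assume "q \<in> V \<inter> chart i"
    then have "rep_proj3 q \<in> cone V" by simp
    then have "peval G (rep_proj3 q) \<noteq> 0 \<and> b q = peval F (rep_proj3 q) / peval G (rep_proj3 q)"
      using V(5) by fastforce
    then show "b q * ?\<phi> G q = ?\<phi> F q" by (simp add: hom[OF V(3)] hom[OF V(4)])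
  qed
  moreover have "Z (\<lambda>q. b q * ?\<phi> G q) = ?\<phi> G p * Z b"
    using derivation_mult[OF Z b rG(1)] rG(2) by simp
  moreover have "?\<phi> G p \<noteq> 0"
    using p V(2,5) by (simp add: hom[OF V(4)] in_chart_iff)
  ultimately show ?thesis using rF(2) by simp
qed

text \<open>
  \<open>d\<close> is the \<open>l\<close>-th partial derivative at \<open>v\<close> of the function on the cone that \<open>b\<close> induces, computed by
  the quotient rule from some local representation of \<open>b\<close>.
\<close>

definition has_dir :: "4 \<Rightarrow> 'a::field ^ 4 \<Rightarrow> ('a proj3 \<Rightarrow> 'a) \<Rightarrow> 'a \<Rightarrow> bool" where
  "has_dir l v b d \<longleftrightarrow> (\<exists>V F G m. open V \<and> pt v \<in> V \<and> homogeneous m F \<and> homogeneous m G \<and>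
     (\<forall>u\<in>cone V. peval G u \<noteq> 0 \<and> b (pt u) = peval F u / peval G u) \<and>
     d = (pd l F v * peval G v - peval F v * pd l G v) / (peval G v)\<^sup>2)"

definition Dir :: "'a::field ^ 4 \<Rightarrow> 4 \<Rightarrow> ('a proj3 \<Rightarrow> 'a) \<Rightarrow> 'a" where
  "Dir v l = (\<lambda>b\<in>{b. regular_at (pt v) b}. THE d. has_dir l v b d)"

lemma has_dirI:
  assumes "open V" "pt v \<in> V" "homogeneous m F" "homogeneous m G"
    "\<And>u. u \<in> cone V \<Longrightarrow> peval G u \<noteq> 0 \<and> b (pt u) = peval F u / peval G u"
    "d = (pd l F v * peval G v - peval F v * pd l G v) / (peval G v)\<^sup>2"
  shows "has_dir l v b d"
  unfolding has_dir_def
  by (rule exI[of _ V], rule exI[of _ F], rule exI[of _ G], rule exI[of _ m]) (use assms in blast)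

lemma has_dir_unique:
  fixes b :: "'a::field_char_0 proj3 \<Rightarrow> 'a"
  assumes "v \<noteq> 0" "has_dir l v b d" "has_dir l v b d'"
  shows "d = d'"
proof -
  obtain V F G m where V: "open V" "pt v \<in> V"
     "\<forall>u\<in>cone V. peval G u \<noteq> 0 \<and> b (pt u) = peval F u / peval G u"
     and d: "d = (pd l F v * peval G v - peval F v * pd l G v) / (peval G v)\<^sup>2"
    using assms(2) unfolding has_dir_def by (elim exE conjE) (rule that)
  obtain V' F' G' m' where V': "open V'" "pt v \<in> V'"
     "\<forall>u\<in>cone V'. peval G' u \<noteq> 0 \<and> b (pt u) = peval F' u / peval G' u"
     and d': "d' = (pd l F' v * peval G' v - peval F' v * pd l G' v) / (peval G' v)\<^sup>2"
    using assms(3) unfolding has_dir_def by (elim exE conjE) (rule that)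
  have eq: "peval F u * peval G' u - peval F' u * peval G u = 0" for u
  proof (rule polyfun_eq_zero_dense[of _ "V \<inter> V'" "pt v"])
    show "polyfun (\<lambda>u. peval F u * peval G' u - peval F' u * peval G u)"
      by (intro polyfun_intros polyfun_peval)
    fix u assume "u \<in> cone (V \<inter> V')"
    then have "u \<in> cone V" "u \<in> cone V'" by (auto simp: cone_Int)
    then have "peval G u \<noteq> 0" "peval G' u \<noteq> 0" "peval F u / peval G u = peval F' u / peval G' u"
      using V(3) V'(3) by metis+
    then show "peval F u * peval G' u - peval F' u * peval G u = 0" by (simp add: field_simps)
  qed (use V V' in auto)
  then have "peval (F * G') u = peval (F' * G) u" for u by (simp add: peval_mult)
  from pd_cong[OF this]
  have *: "pd l F v * peval G' v + peval F v * pd l G' v = pd l F' v * peval G v + peval F' v * pd l G v"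
    by (simp add: pd_mult)
  have v: "v \<in> cone V" "v \<in> cone V'" using assms(1) V(2) V'(2) by (auto simp: cone_def)
  then have G: "peval G v \<noteq> 0" "peval G' v \<noteq> 0" using V(3) V'(3) by auto
  define c where "c = b (pt v)"
  have F: "peval F v = c * peval G v"
    using bspec[OF V(3) v(1)] by (simp add: c_def)
  have F': "peval F' v = c * peval G' v"
    using bspec[OF V'(3) v(2)] by (simp add: c_def)
  note F = F F'
  have "(pd l F v - c * pd l G v) * peval G' v = (pd l F' v - c * pd l G' v) * peval G v"
    using * unfolding F by (simp add: algebra_simps)
  then have "(pd l F v - c * pd l G v) / peval G v = (pd l F' v - c * pd l G' v) / peval G' v"
    using G by (simp add: frac_eq_eq)
  moreover have "d = (pd l F v - c * pd l G v) / peval G v"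
    unfolding d F using G by (simp add: field_simps power2_eq_square)
  moreover have "d' = (pd l F' v - c * pd l G' v) / peval G' v"
    unfolding d' F using G by (simp add: field_simps power2_eq_square)
  ultimately show ?thesis by simp
qed

lemma has_dir_regular_at:
  assumes "has_dir l v b d"
  shows "regular_at (pt v) b"
proof -
  obtain V F G m where V: "open V" "pt v \<in> V" "homogeneous m F" "homogeneous m G"
     "\<forall>u\<in>cone V. peval G u \<noteq> 0 \<and> b (pt u) = peval F u / peval G u"
    using assms unfolding has_dir_def by (elim exE conjE) (rule that)
  have "regular_on V b" unfolding regular_on_def using V by blast
  then show ?thesis using V unfolding regular_at_def by blast
qed

lemma Dir_eq:
  fixes b :: "'a::field_char_0 proj3 \<Rightarrow> 'a"
  assumes "v \<noteq> 0" "has_dir l v b d"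
  shows "Dir v l b = d"
  using assms has_dir_regular_at[OF assms(2)] has_dir_unique[OF assms(1)]
  by (auto simp: Dir_def intro!: the_equality)

lemma has_dir_Dir:
  fixes b :: "'a::field_char_0 proj3 \<Rightarrow> 'a"
  assumes "v \<noteq> 0" "regular_at (pt v) b"
  shows "has_dir l v b (Dir v l b)"
proof -
  obtain U where U: "open U" "pt v \<in> U" "regular_on U b" using assms by (auto simp: regular_at_def)
  obtain V F G d where V: "open V" "pt v \<in> V" "homogeneous d F" "homogeneous d G"
     "\<forall>u\<in>cone V. peval G u \<noteq> 0 \<and> b (pt u) = peval F u / peval G u"
    using regular_onD[OF U(3,2)] by (elim exE conjE) (rule that)
  have "has_dir l v b ((pd l F v * peval G v - peval F v * pd l G v) / (peval G v)\<^sup>2)"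
    by (rule has_dirI[OF V(1-4)]) (use V(5) in auto)
  with Dir_eq[OF assms(1) this] show ?thesis by simp
qed

lemma derivation_Dir:
  fixes v :: "'a::field_char_0 ^ 4"
  assumes v: "v \<noteq> 0"
  shows "derivation (pt v) (Dir v l)"
proof -
  have sum_prod: "has_dir l v (\<lambda>q. b q + c q) (Dir v l b + Dir v l c) \<and>
      has_dir l v (\<lambda>q. b q * c q) (b (pt v) * Dir v l c + c (pt v) * Dir v l b) \<and>
      ((\<exists>U. open U \<and> pt v \<in> U \<and> (\<forall>q\<in>U. b q = c q)) \<longrightarrow> has_dir l v c (Dir v l b))"
    if bc: "regular_at (pt v) b" "regular_at (pt v) c" for b c
  proof -
    obtain V F G m where V: "open V" "pt v \<in> V" "homogeneous m F" "homogeneous m G"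
       "\<forall>u\<in>cone V. peval G u \<noteq> 0 \<and> b (pt u) = peval F u / peval G u"
       and d: "Dir v l b = (pd l F v * peval G v - peval F v * pd l G v) / (peval G v)\<^sup>2"
      using has_dir_Dir[OF v bc(1), of l] unfolding has_dir_def by (elim exE conjE) (rule that)
    obtain V' F' G' m' where V': "open V'" "pt v \<in> V'" "homogeneous m' F'" "homogeneous m' G'"
       "\<forall>u\<in>cone V'. peval G' u \<noteq> 0 \<and> c (pt u) = peval F' u / peval G' u"
       and d': "Dir v l c = (pd l F' v * peval G' v - peval F' v * pd l G' v) / (peval G' v)\<^sup>2"
      using has_dir_Dir[OF v bc(2), of l] unfolding has_dir_def by (elim exE conjE) (rule that)
    have v: "v \<in> cone V" "v \<in> cone V'" using v V(2) V'(2) by (auto simp: cone_def)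
    then have G: "peval G v \<noteq> 0" "peval G' v \<noteq> 0" using V(5) V'(5) by auto
    have bv: "b (pt v) = peval F v / peval G v" "c (pt v) = peval F' v / peval G' v"
      using v V(5) V'(5) by auto
    have VV: "open (V \<inter> V')" "pt v \<in> V \<inter> V'" using V V' by auto
    have hFG': "homogeneous (m + m') (F * G')" and hF'G: "homogeneous (m + m') (F' * G)"
      and hFF': "homogeneous (m + m') (F * F')" and hGG': "homogeneous (m + m') (G * G')"
      using homogeneous_mult[OF V(3) V'(4)] homogeneous_mult[OF V'(3) V(4)]
        homogeneous_mult[OF V(3) V'(3)] homogeneous_mult[OF V(4) V'(4)]
      by (simp_all add: add.commute)
    have "has_dir l v (\<lambda>q. b q + c q) (Dir v l b + Dir v l c)"
    proof (rule has_dirI[OF VV homogeneous_add[OF hFG' hF'G] hGG'])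
      fix u assume "u \<in> cone (V \<inter> V')"
      then have "u \<in> cone V" "u \<in> cone V'" by (auto simp: cone_Int)
      then show "peval (G * G') u \<noteq> 0 \<and>
          b (pt u) + c (pt u) = peval (F * G' + F' * G) u / peval (G * G') u"
        using V(5) V'(5) by (simp add: peval_add peval_mult add_frac_eq)
    qed (use G in \<open>simp add: d d' pd_add pd_mult peval_add peval_mult field_simps power2_eq_square\<close>)
    moreover have "has_dir l v (\<lambda>q. b q * c q) (b (pt v) * Dir v l c + c (pt v) * Dir v l b)"
    proof (rule has_dirI[OF VV hFF' hGG'])
      fix u assume "u \<in> cone (V \<inter> V')"
      then have "u \<in> cone V" "u \<in> cone V'" by (auto simp: cone_Int)
      then show "peval (G * G') u \<noteq> 0 \<and> b (pt u) * c (pt u) = peval (F * F') u / peval (G * G') u"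
        using V(5) V'(5) by (simp add: peval_mult)
    qed (use G in \<open>simp add: d d' bv pd_mult peval_mult field_simps power2_eq_square\<close>)
    moreover have "has_dir l v c (Dir v l b)" if U: "open U" "pt v \<in> U" "\<forall>q\<in>U. b q = c q" for U
    proof (rule has_dirI[OF _ _ V(3,4) _ d])
      show "open (U \<inter> V)" "pt v \<in> U \<inter> V" using U V by auto
      fix u assume "u \<in> cone (U \<inter> V)"
      then have "u \<in> cone V" "pt u \<in> U" by (auto simp: cone_def)
      then show "peval G u \<noteq> 0 \<and> c (pt u) = peval F u / peval G u" using V(5) U(3) by metis
    qed
    ultimately show ?thesis by blast
  qed
  have const: "Dir v l (\<lambda>q. r) = 0" for r
    by (rule Dir_eq[OF v has_dirI[OF open_UNIV UNIV_I homogeneous_const[of r] homogeneous_one]])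
       (use pd_const[of l 1 v] in \<open>auto simp: pd_const single_one\<close>)
  show ?thesis
    unfolding derivation_def
  proof (intro allI impI conjI)
    fix b c assume bc: "regular_at (pt v) b \<and> regular_at (pt v) c"
    note * = sum_prod[OF conjunct1[OF bc] conjunct2[OF bc]]
    show "Dir v l (\<lambda>q. b q + c q) = Dir v l b + Dir v l c"
      by (rule Dir_eq[OF v]) (use * in blast)
    show "Dir v l (\<lambda>q. b q * c q) = b (pt v) * Dir v l c + c (pt v) * Dir v l b"
      by (rule Dir_eq[OF v]) (use * in blast)
    assume "\<exists>U. open U \<and> pt v \<in> U \<and> (\<forall>q\<in>U. b q = c q)"
    then have "has_dir l v c (Dir v l b)" using * by blast
    then show "Dir v l b = Dir v l c" using Dir_eq[OF v] by metis
  next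
    fix r b assume b: "regular_at (pt v) b"
    from sum_prod[OF regular_at_const[of "pt v" r] b]
    have "has_dir l v (\<lambda>q. r * b q) (r * Dir v l b + b (pt v) * Dir v l (\<lambda>q. r))" by blast
    then have "has_dir l v (\<lambda>q. r * b q) (r * Dir v l b)" by (simp add: const)
    then show "Dir v l (\<lambda>q. r * b q) = r * Dir v l b" by (rule Dir_eq[OF v])
  qed
qed

lemma Dir_in_tangent_space:
  fixes v :: "'a::field_char_0 ^ 4"
  shows "v \<noteq> 0 \<Longrightarrow> Dir v l \<in> tangent_space (pt v)"
  by (simp add: tangent_space_eq derivation_Dir) (simp add: Dir_def)

lemma Dir_euler:
  fixes v :: "'a::field_char_0 ^ 4"
  assumes v: "v \<noteq> 0" and b: "regular_at (pt v) b"
  shows "(\<Sum>l\<in>UNIV. v $ l * Dir v l b) = 0"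
proof -
  obtain U where U: "open U" "pt v \<in> U" "regular_on U b" using b by (auto simp: regular_at_def)
  obtain V F G d where V: "open V" "pt v \<in> V" "homogeneous d F" "homogeneous d G"
     "\<forall>u\<in>cone V. peval G u \<noteq> 0 \<and> b (pt u) = peval F u / peval G u"
    using regular_onD[OF U(3,2)] by (elim exE conjE) (rule that)
  have D: "Dir v l b = (pd l F v * peval G v - peval F v * pd l G v) / (peval G v)\<^sup>2" for l
    by (rule Dir_eq[OF v has_dirI[OF V(1-4)]]) (use V(5) in auto)
  have "(\<Sum>l\<in>UNIV. v $ l * Dir v l b) =
      ((\<Sum>l\<in>UNIV. v $ l * pd l F v) * peval G v - peval F v * (\<Sum>l\<in>UNIV. v $ l * pd l G v)) / (peval G v)\<^sup>2"
    unfolding D sum_distrib_left sum_distrib_right sum_subtractf[symmetric] sum_divide_distrib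
    by (intro sum.cong) (auto simp: algebra_simps)
  then show ?thesis by (simp add: euler_identity[OF V(3)] euler_identity[OF V(4)])
qed

lemma Dir_coord:
  fixes v :: "'a::field_char_0 ^ 4"
  assumes "v $ i \<noteq> 0"
  shows "Dir v l (coord i j) = ((if j = l then 1 else 0) * v $ i - v $ j * (if i = l then 1 else 0)) / (v $ i)\<^sup>2"
proof -
  have v: "v \<noteq> 0" using assms by auto
  show ?thesis
    by (rule Dir_eq[OF v has_dirI[OF open_chart[of i] _ homogeneous_X[of j] homogeneous_X[of i]]])
       (use v assms in \<open>auto simp: pt_in_chart pd_X cone_chart coord_pt cone_def\<close>)
qed

text \<open>
  Both sides are derivations, and \<open>Dir_coord\<close> shows that they agree at the affine coordinates.
\<close>

lemma tangent_expansion: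
  fixes v :: "'a::field_char_0 ^ 4"
  assumes vi: "v $ i \<noteq> 0" and D: "D \<in> tangent_space (pt v)" and b: "regular_at (pt v) b"
  shows "D b = (\<Sum>l\<in>UNIV. v $ i * D (coord i l) * Dir v l b)"
proof -
  have v: "v \<noteq> 0" using vi by auto
  have p: "pt v \<in> chart i" using v vi by (simp add: pt_in_chart)
  have dD: "derivation (pt v) D" using D by (simp add: tangent_space_eq)
  define E where "E = (\<lambda>b. \<Sum>l\<in>UNIV. v $ i * D (coord i l) * Dir v l b)"
  have dE: "derivation (pt v) E" unfolding E_def by (rule derivation_combination[OF derivation_Dir[OF v]])
  have dZ: "derivation (pt v) (\<lambda>b. \<Sum>j\<in>UNIV. (if j then 1 else - 1) * (if j then D else E) b)"
    by (rule derivation_combination) (use dD dE in auto)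
  have Zeq: "(\<lambda>b. \<Sum>j\<in>UNIV. (if j then 1 else - 1) * (if j then D else E) b) = (\<lambda>b. D b - E b)"
    by (rule ext) (simp add: UNIV_bool)
  have one: "D (coord i i) = 0"
  proof -
    have "D (coord i i) = D (\<lambda>q. 1)"
      by (rule derivation_local[OF dD regular_at_coord[OF p] regular_at_const open_chart p])
         (simp add: coord_def in_chart_iff)
    then show ?thesis using derivation_const[OF dD] by simp
  qed
  have "E (coord i j) = D (coord i j)" for j
  proof -
    have "E (coord i j) = (\<Sum>l\<in>UNIV. (if l = j then D (coord i j) else 0) - (if l = i then v $ j / v $ i * D (coord i i) else 0))"
      unfolding E_def Dir_coord[OF vi]
      by (intro sum.cong) (use vi in \<open>auto simp: field_simps power2_eq_square\<close>)
    also have "\<dots> = D (coord i j)" by (simp add: sum_subtractf one)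
    finally show ?thesis .
  qed
  then have "D b - E b = 0"
    using derivation_eq_zero[OF dZ[unfolded Zeq] p _ b] by simp
  then show ?thesis by (simp add: E_def)
qed

lemma sect_Dir:
  fixes b :: "'a::field_char_0 proj3 \<Rightarrow> 'a"
  assumes V: "open V" and b: "regular_on V b"
  shows "sect (-1) V (\<lambda>v. Dir v l b)"
proof (rule sectI[OF V])
  fix p assume p: "p \<in> V"
  have sb: "sect 0 V (\<lambda>v. b (pt v))" using b by (simp add: regular_on_iff_sect)
  obtain F G m n where s: "homogeneous (Suc m) F" "homogeneous n G" "int (Suc m) - int n = 0"
    "p \<in> basic_open G" "basic_open G \<subseteq> V"
    "\<forall>v. v \<noteq> 0 \<longrightarrow> peval G v \<noteq> 0 \<longrightarrow> b (pt v) = peval F v / peval G v"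
    using sectD[OF sb p] by (elim exE conjE) (rule that)
  have n: "n = Suc m" using s(3) by simp
  have hG: "homogeneous (Suc m) G" using s(2) n by simp
  let ?N = "partial_deriv l F * G + Poly_Mapping.single 0 (-1) * (F * partial_deriv l G)"
  have h1: "homogeneous (m + Suc m) (partial_deriv l F * G)"
    by (rule homogeneous_mult[OF homogeneous_partial_deriv[OF s(1)] hG])
  have h2: "homogeneous (0 + (Suc m + m)) (Poly_Mapping.single 0 (-1) * (F * partial_deriv l G))"
    by (intro homogeneous_mult homogeneous_const s(1) homogeneous_partial_deriv hG)
  have hN: "homogeneous (Suc (m + m)) ?N"
    by (rule homogeneous_add) (use h1 h2 in simp_all)
  show "\<exists>F G m n. homogeneous m F \<and> homogeneous n G \<and> int m - int n = - 1 \<and> p \<in> basic_open G \<and>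
      (\<forall>v\<in>cone V. peval G v \<noteq> 0 \<longrightarrow> Dir v l b = peval F v / peval G v)"
  proof (intro exI conjI ballI impI)
    show "homogeneous (Suc (m + m)) ?N" by (rule hN)
    show "homogeneous (Suc m + Suc m) (G * G)" by (rule homogeneous_mult[OF hG hG])
    show "int (Suc (m + m)) - int (Suc m + Suc m) = - 1" by simp
    show "p \<in> basic_open (G * G)" using basic_open_mult[OF hG hG] s(4) by simp
    fix v assume v: "v \<in> cone V" "peval (G * G) v \<noteq> 0"
    then have v0: "v \<noteq> 0" and G: "peval G v \<noteq> 0" by (auto simp: cone_def peval_mult)
    have "Dir v l b = (pd l F v * peval G v - peval F v * pd l G v) / (peval G v)\<^sup>2"
    proof (rule Dir_eq[OF v0 has_dirI[OF open_basic_open[OF hG] _ s(1) hG]])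
      show "pt v \<in> basic_open G" using v0 G pt_in_basic_open_iff[OF hG] by blast
    qed (use s(6) in \<open>auto simp: cone_basic_open[OF hG]\<close>)
    then show "Dir v l b = peval ?N v / peval (G * G) v"
      by (simp add: peval_add peval_mult pd_def power2_eq_square)
  qed
qed

section \<open>Twisting sheaves of modules\<close>

lemma structure_ring_simps [simp]:
  "carrier (structure_ring U) = {s \<in> extensional U. regular_on U s}"
  "s \<oplus>\<^bsub>structure_ring U\<^esub> t = (\<lambda>p\<in>U. s p + t p)"
  "s \<otimes>\<^bsub>structure_ring U\<^esub> t = (\<lambda>p\<in>U. s p * t p)"
  "\<zero>\<^bsub>structure_ring U\<^esub> = (\<lambda>p\<in>U. 0)"
  "\<one>\<^bsub>structure_ring U\<^esub> = (\<lambda>p\<in>U. 1)"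
  by (simp_all add: structure_ring_def)

lemma regular_on_const: "open U \<Longrightarrow> regular_on U (\<lambda>p. c)"
  by (simp add: regular_on_iff_sect sect_const)

lemma regular_on_add: "open U \<Longrightarrow> regular_on U s \<Longrightarrow> regular_on U t \<Longrightarrow> regular_on U (\<lambda>p. s p + t p)"
  by (simp add: regular_on_iff_sect sect_add)

lemma regular_on_mult: "open U \<Longrightarrow> regular_on U s \<Longrightarrow> regular_on U t \<Longrightarrow> regular_on U (\<lambda>p. s p * t p)"
  using sect_mult[of 0 U "\<lambda>v. s (pt v)" 0 "\<lambda>v. t (pt v)"] by (simp add: regular_on_iff_sect)

lemma regular_on_power: "open U \<Longrightarrow> regular_on U s \<Longrightarrow> regular_on U (\<lambda>p. s p ^ m)"
  by (induction m) (auto intro: regular_on_const regular_on_mult)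

lemma regular_on_restrict [simp]: "regular_on U (restrict s U) \<longleftrightarrow> regular_on U s"
  by (rule regular_on_cong) simp

lemma regular_on_mono: "regular_on U s \<Longrightarrow> open V \<Longrightarrow> V \<subseteq> U \<Longrightarrow> regular_on V s"
  using sect_mono by (auto simp: regular_on_iff_sect)

lemma regular_on_coord: "open U \<Longrightarrow> U \<subseteq> chart i \<Longrightarrow> regular_on U (coord i j)"
  by (simp add: regular_on_iff_sect sect_coord_quotient)

lemma restrict_restrict_subset: "V \<subseteq> U \<Longrightarrow> restrict (restrict a U) V = restrict a V"
  by (auto simp: restrict_def fun_eq_iff)

lemma regular_on_uminus: "open U \<Longrightarrow> regular_on U s \<Longrightarrow> regular_on U (\<lambda>p. - s p)"
  using regular_on_mult[OF _ regular_on_const, of U s "-1"] by simp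

lemma cring_structure_ring:
  assumes U: "open U"
  shows "cring (structure_ring U)"
proof (rule cringI)
  have unit: "(\<lambda>p\<in>U. (\<lambda>p\<in>U. 0) p + x p) = x" "(\<lambda>p\<in>U. (\<lambda>p\<in>U. 1) p * x p) = x"
    if "x \<in> extensional U" for x :: "'a proj3 \<Rightarrow> 'a"
    using that by (auto simp: fun_eq_iff restrict_def extensional_def)
  show "abelian_group (structure_ring U)"
  proof (rule abelian_groupI, goal_cases)
    case (1 x y) then show ?case by (simp add: regular_on_add U)
  next
    case 2 show ?case by (simp add: regular_on_const U)
  next
    case (3 x y z) show ?case
      unfolding structure_ring_simps by (rule restrict_ext) (simp add: add.assoc)
  next
    case (4 x y) show ?case
      unfolding structure_ring_simps by (rule restrict_ext) (simp add: add.commute)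
  next
    case (5 x) then have "x \<in> extensional U" by simp
    then show ?case unfolding structure_ring_simps by (rule unit(1))
  next
    case (6 x)
    have "(\<lambda>p\<in>U. (\<lambda>p\<in>U. - x p) p + x p) = (\<lambda>p\<in>U. 0)" by (rule restrict_ext) simp
    with 6 show ?case
      by (intro bexI[of _ "\<lambda>p\<in>U. - x p"]) (auto intro!: regular_on_uminus U)
  qed
  show "Group.comm_monoid (structure_ring U)"
  proof (rule comm_monoidI, goal_cases)
    case (1 x y) then show ?case by (simp add: regular_on_mult U)
  next
    case 2 show ?case by (simp add: regular_on_const U)
  next
    case (3 x y z) show ?case
      unfolding structure_ring_simps by (rule restrict_ext) (simp add: mult.assoc)
  next
    case (4 x) then have "x \<in> extensional U" by simp
    then show ?case unfolding structure_ring_simps by (rule unit(2))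
  next
    case (5 x y) show ?case
      unfolding structure_ring_simps by (rule restrict_ext) (simp add: mult.commute)
  qed
  show "(x \<oplus>\<^bsub>structure_ring U\<^esub> y) \<otimes>\<^bsub>structure_ring U\<^esub> z =
      x \<otimes>\<^bsub>structure_ring U\<^esub> z \<oplus>\<^bsub>structure_ring U\<^esub> y \<otimes>\<^bsub>structure_ring U\<^esub> z" for x y z
    unfolding structure_ring_simps by (rule restrict_ext) (simp add: distrib_right)
qed

lemma transition_eq_coord: "transition d i j p = (coord j i p) powi d"
  by (simp add: transition_def coord_def)

lemma transition_self: "p \<in> chart i \<Longrightarrow> transition d i i p = 1"
  by (simp add: transition_def in_chart_iff)

lemma transition_cocycle:
  "p \<in> chart j \<Longrightarrow> transition d i j p * transition d j l p = transition d i l p"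
  by (simp add: transition_def in_chart_iff flip: power_int_mult_distrib)

lemma transition_swap: "transition (- d) i j p = transition d j i p"
  by (simp add: transition_def power_int_minus flip: power_int_inverse)

lemma transition_regular:
  assumes "open U" "U \<subseteq> chart i" "U \<subseteq> chart j"
  shows "restrict (transition d i j) U \<in> carrier (structure_ring U)"
proof -
  have "regular_on U (transition d i j)"
  proof (cases "d \<ge> 0")
    case True
    then have eq: "transition d i j = (\<lambda>p. coord j i p ^ nat d)"
      by (auto simp: transition_eq_coord power_int_def)
    show ?thesis unfolding eq by (intro regular_on_power regular_on_coord assms)
  next
    case False
    then have eq: "transition d i j = (\<lambda>p. coord i j p ^ nat (- d))"
      by (auto simp: transition_def coord_def power_int_def)
    show ?thesis unfolding eq by (intro regular_on_power regular_on_coord assms)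
  qed
  then show ?thesis by simp
qed

lemma sec_twist: "s \<in> sec (twist d F) U \<longleftrightarrow> (\<forall>i. s i \<in> sec F (U \<inter> chart i)) \<and>
    (\<forall>i j. res F (U \<inter> chart j) (U \<inter> chart i \<inter> chart j) (s j) =
      restrict (transition d i j) (U \<inter> chart i \<inter> chart j) \<odot>\<^bsub>sections F (U \<inter> chart i \<inter> chart j)\<^esub>
        res F (U \<inter> chart i) (U \<inter> chart i \<inter> chart j) (s i))"
  by (simp add: twist_def mk_module_def Let_def)

lemma twist_simps [simp]:
  "s \<oplus>\<^bsub>sections (twist d F) U\<^esub> t = (\<lambda>i. s i \<oplus>\<^bsub>sections F (U \<inter> chart i)\<^esub> t i)"
  "\<zero>\<^bsub>sections (twist d F) U\<^esub> = (\<lambda>i. \<zero>\<^bsub>sections F (U \<inter> chart i)\<^esub>)"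
  "a \<odot>\<^bsub>sections (twist d F) U\<^esub> s = (\<lambda>i. restrict a (U \<inter> chart i) \<odot>\<^bsub>sections F (U \<inter> chart i)\<^esub> s i)"
  "res (twist d F) U V s = (\<lambda>i. res F (U \<inter> chart i) (V \<inter> chart i) (s i))"
  by (simp_all add: twist_def mk_module_def)

lemma restrict_in_structure_ring:
  "a \<in> carrier (structure_ring U) \<Longrightarrow> open V \<Longrightarrow> V \<subseteq> U \<Longrightarrow> restrict a V \<in> carrier (structure_ring V)"
  by (auto intro: regular_on_mono)

locale module_presheaf =
  fixes F :: "('a::field, 's) presheaf"
  assumes presheaf: "presheaf_of_modules F"
begin

lemma sections_module: "open U \<Longrightarrow> Module.module (structure_ring U) (sections F U)"
  using presheaf[unfolded presheaf_of_modules_def, THEN conjunct1] by simp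

lemma res_closed: "open U \<Longrightarrow> open V \<Longrightarrow> V \<subseteq> U \<Longrightarrow> s \<in> sec F U \<Longrightarrow> res F U V s \<in> sec F V"
  and res_add: "open U \<Longrightarrow> open V \<Longrightarrow> V \<subseteq> U \<Longrightarrow> s \<in> sec F U \<Longrightarrow> t \<in> sec F U \<Longrightarrow>
     res F U V (s \<oplus>\<^bsub>sections F U\<^esub> t) = res F U V s \<oplus>\<^bsub>sections F V\<^esub> res F U V t"
  and res_smult: "open U \<Longrightarrow> open V \<Longrightarrow> V \<subseteq> U \<Longrightarrow> a \<in> carrier (structure_ring U) \<Longrightarrow> s \<in> sec F U \<Longrightarrow>
     res F U V (a \<odot>\<^bsub>sections F U\<^esub> s) = restrict a V \<odot>\<^bsub>sections F V\<^esub> res F U V s"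
proof -
  note P = presheaf[unfolded presheaf_of_modules_def, THEN conjunct2, THEN conjunct1]
  assume U: "open U" "open V" "V \<subseteq> U"
  note P = P[THEN spec[of _ U], THEN spec[of _ V], THEN mp, OF conjI[OF U(1) conjI[OF U(2,3)]]]
  show "res F U V s \<in> sec F V" if "s \<in> sec F U" using P[THEN conjunct1] that by blast
  show "res F U V (s \<oplus>\<^bsub>sections F U\<^esub> t) = res F U V s \<oplus>\<^bsub>sections F V\<^esub> res F U V t"
    if "s \<in> sec F U" "t \<in> sec F U" using P[THEN conjunct2, THEN conjunct1] that by blast
  show "res F U V (a \<odot>\<^bsub>sections F U\<^esub> s) = restrict a V \<odot>\<^bsub>sections F V\<^esub> res F U V s"
    if "a \<in> carrier (structure_ring U)" "s \<in> sec F U"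
    using P[THEN conjunct2, THEN conjunct2] that by blast
qed

lemma res_id: "open U \<Longrightarrow> s \<in> sec F U \<Longrightarrow> res F U U s = s"
  using presheaf[unfolded presheaf_of_modules_def, THEN conjunct2, THEN conjunct2, THEN conjunct1] by blast

lemma res_res: "open U \<Longrightarrow> open V \<Longrightarrow> open W \<Longrightarrow> W \<subseteq> V \<Longrightarrow> V \<subseteq> U \<Longrightarrow> s \<in> sec F U \<Longrightarrow>
     res F V W (res F U V s) = res F U W s"
  using presheaf[unfolded presheaf_of_modules_def, THEN conjunct2, THEN conjunct2, THEN conjunct2] by blast

lemma smult_closed: "open U \<Longrightarrow> a \<in> carrier (structure_ring U) \<Longrightarrow> s \<in> sec F U \<Longrightarrow>
    a \<odot>\<^bsub>sections F U\<^esub> s \<in> sec F U"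
  using module.smult_closed[OF sections_module] .

lemma add_closed: "open U \<Longrightarrow> s \<in> sec F U \<Longrightarrow> t \<in> sec F U \<Longrightarrow> s \<oplus>\<^bsub>sections F U\<^esub> t \<in> sec F U"
  using abelian_monoid.a_closed[OF abelian_group.axioms(1)[OF module.axioms(2)[OF sections_module]]] .

lemma zero_closed: "open U \<Longrightarrow> \<zero>\<^bsub>sections F U\<^esub> \<in> sec F U"
  using abelian_monoid.zero_closed[OF abelian_group.axioms(1)[OF module.axioms(2)[OF sections_module]]] .

lemma smult_smult: "open U \<Longrightarrow> a \<in> carrier (structure_ring U) \<Longrightarrow> b \<in> carrier (structure_ring U) \<Longrightarrow>
   s \<in> sec F U \<Longrightarrow> a \<odot>\<^bsub>sections F U\<^esub> (b \<odot>\<^bsub>sections F U\<^esub> s) = (\<lambda>p\<in>U. a p * b p) \<odot>\<^bsub>sections F U\<^esub> s"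
  using module.smult_assoc1[OF sections_module, of U a b s] by simp

lemma smult_add: "open U \<Longrightarrow> a \<in> carrier (structure_ring U) \<Longrightarrow> s \<in> sec F U \<Longrightarrow> t \<in> sec F U \<Longrightarrow>
   a \<odot>\<^bsub>sections F U\<^esub> (s \<oplus>\<^bsub>sections F U\<^esub> t) = a \<odot>\<^bsub>sections F U\<^esub> s \<oplus>\<^bsub>sections F U\<^esub> a \<odot>\<^bsub>sections F U\<^esub> t"
  using module.smult_r_distr[OF sections_module, of U a s t] .

lemma add_smult: "open U \<Longrightarrow> a \<in> carrier (structure_ring U) \<Longrightarrow> b \<in> carrier (structure_ring U) \<Longrightarrow>
   s \<in> sec F U \<Longrightarrow> (\<lambda>p\<in>U. a p + b p) \<odot>\<^bsub>sections F U\<^esub> s = a \<odot>\<^bsub>sections F U\<^esub> s \<oplus>\<^bsub>sections F U\<^esub> b \<odot>\<^bsub>sections F U\<^esub> s"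
  using module.smult_l_distr[OF sections_module, of U a b s] by simp

lemma one_smult: "open U \<Longrightarrow> s \<in> sec F U \<Longrightarrow> (\<lambda>p\<in>U. 1) \<odot>\<^bsub>sections F U\<^esub> s = s"
  using module.smult_one[OF sections_module, of U s] by simp

lemma zero_smult: "open U \<Longrightarrow> s \<in> sec F U \<Longrightarrow> (\<lambda>p\<in>U. 0) \<odot>\<^bsub>sections F U\<^esub> s = \<zero>\<^bsub>sections F U\<^esub>"
  using module.smult_l_null[OF sections_module, of U s] by simp

lemma smult_zero: "open U \<Longrightarrow> a \<in> carrier (structure_ring U) \<Longrightarrow>
    a \<odot>\<^bsub>sections F U\<^esub> \<zero>\<^bsub>sections F U\<^esub> = \<zero>\<^bsub>sections F U\<^esub>"
  using module.smult_r_null[OF sections_module, of U a] .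

lemma res_zero:
  assumes "open U" "open V" "V \<subseteq> U"
  shows "res F U V \<zero>\<^bsub>sections F U\<^esub> = \<zero>\<^bsub>sections F V\<^esub>"
proof -
  have z: "(\<lambda>p\<in>U. 0) \<in> carrier (structure_ring U)" using assms by (simp add: regular_on_const)
  have "restrict (\<lambda>p\<in>U. 0::'a) V = (\<lambda>p\<in>V. 0)" by (rule restrict_restrict_subset[OF assms(3)])
  then show ?thesis
    using res_smult[OF assms z zero_closed[OF assms(1)]] res_closed[OF assms zero_closed[OF assms(1)]] assms
    by (simp add: zero_smult zero_closed)
qed

lemma open_Int_chart: "open U \<Longrightarrow> open (U \<inter> chart i)" "open U \<Longrightarrow> open (U \<inter> chart i \<inter> chart j)"
  by (simp_all add: open_Int)

text \<open>
  All operations are those of \<open>F\<close> over the charts. The transition equations survive them because the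
  transition functions are regular and restriction is semilinear.
\<close>

lemma presheaf_twist: "presheaf_of_modules (twist d F)"
proof -
  note op = open_Int_chart
  have tr: "restrict (transition d i j) (U \<inter> chart i \<inter> chart j) \<in> carrier (structure_ring (U \<inter> chart i \<inter> chart j))"
    if "open U" for U i j by (rule transition_regular[OF op(2)[OF that]]) auto
  have sub: "U \<inter> chart i \<inter> chart j \<subseteq> U \<inter> chart i" "U \<inter> chart i \<inter> chart j \<subseteq> U \<inter> chart j" for U i j
    by auto
  have tD: "s i \<in> sec F (U \<inter> chart i)"
    "res F (U \<inter> chart j) (U \<inter> chart i \<inter> chart j) (s j) =
      restrict (transition d i j) (U \<inter> chart i \<inter> chart j) \<odot>\<^bsub>sections F (U \<inter> chart i \<inter> chart j)\<^esub>
        res F (U \<inter> chart i) (U \<inter> chart i \<inter> chart j) (s i)"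
    if "s \<in> sec (twist d F) U" for s U i j
    using that unfolding sec_twist by blast+
  have r1: "res F (U \<inter> chart i) (U \<inter> chart i \<inter> chart j) t \<in> sec F (U \<inter> chart i \<inter> chart j)"
    if "open U" "t \<in> sec F (U \<inter> chart i)" for U i j t
    using res_closed[OF op(1)[OF that(1)] op(2)[OF that(1)] sub(1) that(2)] .
  have rU: "restrict a (U \<inter> chart i) \<in> carrier (structure_ring (U \<inter> chart i))"
    "restrict a (U \<inter> chart i \<inter> chart j) \<in> carrier (structure_ring (U \<inter> chart i \<inter> chart j))"
    if "open U" "a \<in> carrier (structure_ring U)" for U a i j
    by (rule restrict_in_structure_ring[OF that(2) op(1)[OF that(1)]], blast)
      (rule restrict_in_structure_ring[OF that(2) op(2)[OF that(1)]], blast)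
  have add_cl: "(\<lambda>i. s i \<oplus>\<^bsub>sections F (U \<inter> chart i)\<^esub> t i) \<in> sec (twist d F) U"
    if U: "open U" and s: "s \<in> sec (twist d F) U" and t: "t \<in> sec (twist d F) U" for s t U
    unfolding sec_twist using tD(1)[OF s] tD(1)[OF t]
    by (simp add: add_closed op[OF U] res_add[OF op(1)[OF U] op(2)[OF U] sub(1)]
        res_add[OF op(1)[OF U] op(2)[OF U] sub(2)] smult_add tr[OF U] r1[OF U] tD(2)[OF s] tD(2)[OF t] del: structure_ring_simps)
  have zero_cl: "(\<lambda>i. \<zero>\<^bsub>sections F (U \<inter> chart i)\<^esub>) \<in> sec (twist d F) U" if U: "open U" for U
    unfolding sec_twist
    by (simp only: zero_closed op[OF U] res_zero[OF op(1)[OF U] op(2)[OF U] sub(1)]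
        res_zero[OF op(1)[OF U] op(2)[OF U] sub(2)] smult_zero tr[OF U] simp_thms)
  have smult_cl: "(\<lambda>i. restrict a (U \<inter> chart i) \<odot>\<^bsub>sections F (U \<inter> chart i)\<^esub> s i) \<in> sec (twist d F) U"
    if U: "open U" and a: "a \<in> carrier (structure_ring U)" and s: "s \<in> sec (twist d F) U" for a s U
    unfolding sec_twist
  proof (intro conjI allI)
    show "restrict a (U \<inter> chart i) \<odot>\<^bsub>sections F (U \<inter> chart i)\<^esub> s i \<in> sec F (U \<inter> chart i)" for i
      by (intro smult_closed op U rU a tD(1) s)
    fix i j
    let ?W = "U \<inter> chart i \<inter> chart j"
    have rr: "restrict (restrict a (U \<inter> chart i)) ?W = restrict a ?W" "restrict (restrict a (U \<inter> chart j)) ?W = restrict a ?W"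
      by (auto simp: restrict_def fun_eq_iff)
    have comm: "(\<lambda>p\<in>?W. restrict a ?W p * restrict (transition d i j) ?W p) =
       (\<lambda>p\<in>?W. restrict (transition d i j) ?W p * restrict a ?W p)" by (simp add: mult.commute)
    note ri = r1[OF U tD(1)[OF s], of i j]
    have "res F (U \<inter> chart j) ?W (restrict a (U \<inter> chart j) \<odot>\<^bsub>sections F (U \<inter> chart j)\<^esub> s j) =
       restrict a ?W \<odot>\<^bsub>sections F ?W\<^esub> res F (U \<inter> chart j) ?W (s j)"
      unfolding rr(2)[symmetric] by (rule res_smult[OF op(1)[OF U] op(2)[OF U] sub(2) rU(1)[OF U a] tD(1)[OF s]])
    also have "\<dots> = restrict (transition d i j) ?W \<odot>\<^bsub>sections F ?W\<^esub> (restrict a ?W \<odot>\<^bsub>sections F ?W\<^esub> res F (U \<inter> chart i) ?W (s i))"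
      unfolding tD(2)[OF s] smult_smult[OF op(2)[OF U] rU(2)[OF U a] tr[OF U] ri]
        smult_smult[OF op(2)[OF U] tr[OF U] rU(2)[OF U a] ri] comm ..
    also have "restrict a ?W \<odot>\<^bsub>sections F ?W\<^esub> res F (U \<inter> chart i) ?W (s i) =
       res F (U \<inter> chart i) ?W (restrict a (U \<inter> chart i) \<odot>\<^bsub>sections F (U \<inter> chart i)\<^esub> s i)"
      unfolding rr(1)[symmetric] by (rule res_smult[OF op(1)[OF U] op(2)[OF U] sub(1) rU(1)[OF U a] tD(1)[OF s], symmetric])
    finally show "res F (U \<inter> chart j) ?W (restrict a (U \<inter> chart j) \<odot>\<^bsub>sections F (U \<inter> chart j)\<^esub> s j) =
       restrict (transition d i j) ?W \<odot>\<^bsub>sections F ?W\<^esub>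
       res F (U \<inter> chart i) ?W (restrict a (U \<inter> chart i) \<odot>\<^bsub>sections F (U \<inter> chart i)\<^esub> s i)" .
  qed
  have am: "abelian_group (sections F U)" if "open U" for U using module.axioms(2)[OF sections_module[OF that]] .
  note AM = abelian_group.axioms(1)[OF am]
  have rsum: "restrict (\<lambda>p\<in>U. a p + b p) (U \<inter> chart i) = (\<lambda>p\<in>U \<inter> chart i. restrict a (U \<inter> chart i) p + restrict b (U \<inter> chart i) p)"
    and rprod: "restrict (\<lambda>p\<in>U. a p * b p) (U \<inter> chart i) = (\<lambda>p\<in>U \<inter> chart i. restrict a (U \<inter> chart i) p * restrict b (U \<inter> chart i) p)"
    and rconst: "restrict (\<lambda>p\<in>U. c) (U \<inter> chart i) = (\<lambda>p\<in>U \<inter> chart i. c)"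
    for a b :: "'a proj3 \<Rightarrow> 'a" and c :: 'a and U i by (auto simp: restrict_def fun_eq_iff)
  have module: "Module.module (structure_ring U) (sections (twist d F) U)" if U: "open U" for U
  proof (rule moduleI)
    show "cring (structure_ring U)" by (rule cring_structure_ring[OF U])
    show "abelian_group (sections (twist d F) U)"
    proof (rule abelian_groupI, goal_cases)
      case (1 x y) then show ?case using add_cl[OF U] by simp
    next
      case 2 show ?case using zero_cl[OF U] by simp
    next
      case (3 x y z) then show ?case
        using tD(1) abelian_monoid.a_assoc[OF AM[OF op(1)[OF U]]] by (simp add: fun_eq_iff)
    next
      case (4 x y) then show ?case
        using tD(1) abelian_monoid.a_comm[OF AM[OF op(1)[OF U]]] by (simp add: fun_eq_iff)
    next
      case (5 x) then show ?case
        using tD(1) abelian_monoid.l_zero[OF AM[OF op(1)[OF U]]] by (simp add: fun_eq_iff)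
    next
      case (6 x)
      have m1: "(\<lambda>p\<in>V. c) \<in> carrier (structure_ring V)" if "open V" for V and c :: 'a
        using that by (simp add: regular_on_const)
      let ?y = "\<lambda>i. restrict (\<lambda>p\<in>U. -1) (U \<inter> chart i) \<odot>\<^bsub>sections F (U \<inter> chart i)\<^esub> x i"
      have "?y i \<oplus>\<^bsub>sections F (U \<inter> chart i)\<^esub> x i = \<zero>\<^bsub>sections F (U \<inter> chart i)\<^esub>" for i
      proof -
        let ?W = "U \<inter> chart i"
        have W: "open ?W" using op U by blast
        have xi: "x i \<in> sec F ?W" using tD(1)[OF 6] .
        have z: "(\<lambda>p\<in>?W. (\<lambda>p\<in>?W. - 1 :: 'a) p + (\<lambda>p\<in>?W. 1) p) = (\<lambda>p\<in>?W. 0)" by auto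
        have "?y i \<oplus>\<^bsub>sections F ?W\<^esub> x i = ?y i \<oplus>\<^bsub>sections F ?W\<^esub> ((\<lambda>p\<in>?W. 1) \<odot>\<^bsub>sections F ?W\<^esub> x i)"
          by (simp only: one_smult[OF W xi])
        also have "\<dots> = \<zero>\<^bsub>sections F ?W\<^esub>"
          unfolding rconst add_smult[OF W m1[OF W] m1[OF W] xi, symmetric] z zero_smult[OF W xi] ..
        finally show ?thesis .
      qed
      then show ?case using smult_cl[OF U m1[OF U] 6, of "-1"] by (intro bexI[of _ ?y]) (simp_all only: twist_simps)
    qed
  next
    fix a x assume "a \<in> carrier (structure_ring U)" "x \<in> sec (twist d F) U"
    then show "a \<odot>\<^bsub>sections (twist d F) U\<^esub> x \<in> sec (twist d F) U" using smult_cl[OF U] by (simp only: twist_simps)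
  next
    fix a b x assume a: "a \<in> carrier (structure_ring U)" and b: "b \<in> carrier (structure_ring U)" and x: "x \<in> sec (twist d F) U"
    note * = add_smult[OF op(1)[OF U] rU(1)[OF U a] rU(1)[OF U b] tD(1)[OF x]]
    show "(a \<oplus>\<^bsub>structure_ring U\<^esub> b) \<odot>\<^bsub>sections (twist d F) U\<^esub> x =
        a \<odot>\<^bsub>sections (twist d F) U\<^esub> x \<oplus>\<^bsub>sections (twist d F) U\<^esub> b \<odot>\<^bsub>sections (twist d F) U\<^esub> x"
      unfolding twist_simps structure_ring_simps rsum * ..
    note * = smult_smult[OF op(1)[OF U] rU(1)[OF U a] rU(1)[OF U b] tD(1)[OF x]]
    show "(a \<otimes>\<^bsub>structure_ring U\<^esub> b) \<odot>\<^bsub>sections (twist d F) U\<^esub> x =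
        a \<odot>\<^bsub>sections (twist d F) U\<^esub> (b \<odot>\<^bsub>sections (twist d F) U\<^esub> x)"
      unfolding twist_simps structure_ring_simps rprod * ..
  next
    fix a x y assume a: "a \<in> carrier (structure_ring U)" and x: "x \<in> sec (twist d F) U" and y: "y \<in> sec (twist d F) U"
    note * = smult_add[OF op(1)[OF U] rU(1)[OF U a] tD(1)[OF x] tD(1)[OF y]]
    show "a \<odot>\<^bsub>sections (twist d F) U\<^esub> (x \<oplus>\<^bsub>sections (twist d F) U\<^esub> y) =
        a \<odot>\<^bsub>sections (twist d F) U\<^esub> x \<oplus>\<^bsub>sections (twist d F) U\<^esub> a \<odot>\<^bsub>sections (twist d F) U\<^esub> y"
      unfolding twist_simps * ..
  next
    fix x assume x: "x \<in> sec (twist d F) U"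
    note * = one_smult[OF op(1)[OF U] tD(1)[OF x]]
    show "\<one>\<^bsub>structure_ring U\<^esub> \<odot>\<^bsub>sections (twist d F) U\<^esub> x = x"
      unfolding twist_simps structure_ring_simps rconst * ..
  qed
  have subVU: "V \<inter> chart i \<subseteq> U \<inter> chart i" if "V \<subseteq> U" for U V i using that by auto
  have res_cl: "(\<lambda>i. res F (U \<inter> chart i) (V \<inter> chart i) (s i)) \<in> sec (twist d F) V"
    if U: "open U" and V: "open V" "V \<subseteq> U" and s: "s \<in> sec (twist d F) U" for U V s
    unfolding sec_twist
  proof (intro conjI allI)
    show "res F (U \<inter> chart i) (V \<inter> chart i) (s i) \<in> sec F (V \<inter> chart i)" for i
      by (intro res_closed op subVU U V tD(1) s)
    fix i j
    let ?W = "U \<inter> chart i \<inter> chart j" and ?W' = "V \<inter> chart i \<inter> chart j"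
    have WW: "?W' \<subseteq> ?W" "?W' \<subseteq> U \<inter> chart i" "?W' \<subseteq> U \<inter> chart j" using V by auto
    note ri = r1[OF U tD(1)[OF s], of i j]
    have "res F (V \<inter> chart j) ?W' (res F (U \<inter> chart j) (V \<inter> chart j) (s j)) = res F ?W ?W' (res F (U \<inter> chart j) ?W (s j))"
      unfolding res_res[OF op(1)[OF U] op(1)[OF V(1)] op(2)[OF V(1)] sub(2) subVU[OF V(2)] tD(1)[OF s]]
        res_res[OF op(1)[OF U] op(2)[OF U] op(2)[OF V(1)] WW(1) sub(2) tD(1)[OF s]] ..
    also have "\<dots> = restrict (restrict (transition d i j) ?W) ?W' \<odot>\<^bsub>sections F ?W'\<^esub> res F ?W ?W' (res F (U \<inter> chart i) ?W (s i))"
      unfolding tD(2)[OF s] by (rule res_smult[OF op(2)[OF U] op(2)[OF V(1)] WW(1) tr[OF U] ri])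
    also have "restrict (restrict (transition d i j) ?W) ?W' = restrict (transition d i j) ?W'"
      by (rule restrict_restrict_subset[OF WW(1)])
    also have "res F ?W ?W' (res F (U \<inter> chart i) ?W (s i)) = res F (V \<inter> chart i) ?W' (res F (U \<inter> chart i) (V \<inter> chart i) (s i))"
      unfolding res_res[OF op(1)[OF U] op(1)[OF V(1)] op(2)[OF V(1)] sub(1) subVU[OF V(2)] tD(1)[OF s]]
        res_res[OF op(1)[OF U] op(2)[OF U] op(2)[OF V(1)] WW(1) sub(1) tD(1)[OF s]] ..
    finally show "res F (V \<inter> chart j) ?W' (res F (U \<inter> chart j) (V \<inter> chart j) (s j)) =
       restrict (transition d i j) ?W' \<odot>\<^bsub>sections F ?W'\<^esub>
       res F (V \<inter> chart i) ?W' (res F (U \<inter> chart i) (V \<inter> chart i) (s i))" .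
  qed
  show ?thesis
    unfolding presheaf_of_modules_def
  proof (intro conjI allI impI)
    fix U :: "'a proj3 set" assume "open U"
    then show "Module.module (structure_ring U) (sections (twist d F) U)" by (rule module)
  next
    fix U V :: "'a proj3 set" assume UV: "open U \<and> open V \<and> V \<subseteq> U"
    then have U: "open U" and V: "open V" "V \<subseteq> U" by auto
    show "res (twist d F) U V \<in> sec (twist d F) U \<rightarrow> sec (twist d F) V"
      using res_cl[OF U V] by simp
    show "\<forall>s\<in>sec (twist d F) U. \<forall>t\<in>sec (twist d F) U. res (twist d F) U V (s \<oplus>\<^bsub>sections (twist d F) U\<^esub> t) =
        res (twist d F) U V s \<oplus>\<^bsub>sections (twist d F) V\<^esub> res (twist d F) U V t"
    proof (intro ballI)
      fix s t assume s: "s \<in> sec (twist d F) U" and t: "t \<in> sec (twist d F) U"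
      note * = res_add[OF op(1)[OF U] op(1)[OF V(1)] subVU[OF V(2)] tD(1)[OF s] tD(1)[OF t]]
      show "res (twist d F) U V (s \<oplus>\<^bsub>sections (twist d F) U\<^esub> t) =
        res (twist d F) U V s \<oplus>\<^bsub>sections (twist d F) V\<^esub> res (twist d F) U V t"
        unfolding twist_simps * ..
    qed
    show "\<forall>a\<in>carrier (structure_ring U). \<forall>s\<in>sec (twist d F) U. res (twist d F) U V (a \<odot>\<^bsub>sections (twist d F) U\<^esub> s) =
        restrict a V \<odot>\<^bsub>sections (twist d F) V\<^esub> res (twist d F) U V s"
    proof (intro ballI)
      fix a s assume a: "a \<in> carrier (structure_ring U)" and s: "s \<in> sec (twist d F) U"
      note * = res_smult[OF op(1)[OF U] op(1)[OF V(1)] subVU[OF V(2)] rU(1)[OF U a] tD(1)[OF s]]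
      have rr: "restrict (restrict a (U \<inter> chart i)) (V \<inter> chart i) = restrict (restrict a V) (V \<inter> chart i)" for i
        using V(2) by (auto simp: restrict_def fun_eq_iff)
      show "res (twist d F) U V (a \<odot>\<^bsub>sections (twist d F) U\<^esub> s) =
        restrict a V \<odot>\<^bsub>sections (twist d F) V\<^esub> res (twist d F) U V s"
        unfolding twist_simps * rr ..
    qed
  next
    fix U :: "'a proj3 set" assume U: "open U"
    show "\<forall>s\<in>sec (twist d F) U. res (twist d F) U U s = s"
      using tD(1) res_id[OF op(1)[OF U]] by simp
  next
    fix U V W :: "'a proj3 set" assume "open U \<and> open V \<and> open W \<and> W \<subseteq> V \<and> V \<subseteq> U"
    then have UVW: "open U" "open V" "open W" "W \<subseteq> V" "V \<subseteq> U" by auto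
    show "\<forall>s\<in>sec (twist d F) U. res (twist d F) V W (res (twist d F) U V s) = res (twist d F) U W s"
      using tD(1) by (simp add: res_res[OF op(1)[OF UVW(1)] op(1)[OF UVW(2)] op(1)[OF UVW(3)] subVU[OF UVW(4)] subVU[OF UVW(5)]])
  qed
qed

end

lemma (in module_presheaf) module_presheaf_twist: "module_presheaf (twist d F)"
  by (rule module_presheaf.intro[OF presheaf_twist])

locale module_sheaf = module_presheaf +
  assumes sheaf: "sheaf_of_modules F"
begin

text \<open>
  The gluing axiom is indexed by the open sets themselves. Here the index set is arbitrary, so that
  different indices may have the same open set.
\<close>

lemma glue_sections:
  assumes U: "\<And>a. a \<in> A \<Longrightarrow> open (U a)" and s: "\<And>a. a \<in> A \<Longrightarrow> s a \<in> sec F (U a)"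
    and Y: "Y = (\<Union>a\<in>A. U a)"
    and compat: "\<And>a b. a \<in> A \<Longrightarrow> b \<in> A \<Longrightarrow>
      res F (U a) (U a \<inter> U b) (s a) = res F (U b) (U a \<inter> U b) (s b)"
  shows "\<exists>!t. t \<in> sec F Y \<and> (\<forall>a\<in>A. res F Y (U a) t = s a)"
proof -
  define s' where "s' W = s (SOME a. a \<in> A \<and> U a = W)" for W
  have s': "s' (U a) = s a" if a: "a \<in> A" for a
  proof -
    define b where "b = (SOME b. b \<in> A \<and> U b = U a)"
    have b: "b \<in> A" "U b = U a"
      using someI[of "\<lambda>b. b \<in> A \<and> U b = U a" a] a by (auto simp: b_def)
    have "s b = s a"
      using compat[OF a b(1)] res_id[OF U[OF a] s[OF a]] res_id[OF U[OF b(1)] s[OF b(1)]] b(2) by simp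
    then show ?thesis by (simp add: s'_def b_def)
  qed
  have un: "\<Union>(U ` A) = Y" by (simp add: Y)
  have "(\<forall>V\<in>U ` A. open V \<and> s' V \<in> sec F V) \<and>
        (\<forall>V\<in>U ` A. \<forall>W\<in>U ` A. res F V (V \<inter> W) (s' V) = res F W (V \<inter> W) (s' W))"
    using U s compat by (auto simp: s')
  then have "\<exists>!t. t \<in> sec F (\<Union>(U ` A)) \<and> (\<forall>V\<in>U ` A. res F (\<Union>(U ` A)) V t = s' V)"
    by (rule sheaf[unfolded sheaf_of_modules_def, THEN conjunct2, THEN spec[of _ "U ` A"], THEN spec[of _ s'], THEN mp])
  then show ?thesis unfolding un by (simp add: s')
qed

lemma sections_eqI:
  assumes U: "\<And>a. a \<in> A \<Longrightarrow> open (U a)" and Y: "Y = (\<Union>a\<in>A. U a)"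
    and t: "t \<in> sec F Y" "t' \<in> sec F Y" and eq: "\<And>a. a \<in> A \<Longrightarrow> res F Y (U a) t = res F Y (U a) t'"
  shows "t = t'"
proof -
  have oX: "open Y" unfolding Y using U by auto
  have sub: "U a \<subseteq> Y" if "a \<in> A" for a using that Y by blast
  have ex: "\<exists>!u. u \<in> sec F Y \<and> (\<forall>a\<in>A. res F Y (U a) u = res F Y (U a) t)"
  proof (rule glue_sections[OF U _ Y])
    show "res F Y (U a) t \<in> sec F (U a)" if "a \<in> A" for a
      by (rule res_closed[OF oX U[OF that] sub[OF that] t(1)])
    fix a b assume a: "a \<in> A" and b: "b \<in> A"
    have o: "open (U a \<inter> U b)" using U a b by blast
    show "res F (U a) (U a \<inter> U b) (res F Y (U a) t) = res F (U b) (U a \<inter> U b) (res F Y (U b) t)"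
      unfolding res_res[OF oX U[OF a] o Int_lower1 sub[OF a] t(1)] res_res[OF oX U[OF b] o Int_lower2 sub[OF b] t(1)] ..
  qed
  have "(THE u. u \<in> sec F Y \<and> (\<forall>a\<in>A. res F Y (U a) u = res F Y (U a) t)) = t"
    by (rule the1_equality[OF ex]) (use t in blast)
  moreover have "(THE u. u \<in> sec F Y \<and> (\<forall>a\<in>A. res F Y (U a) u = res F Y (U a) t)) = t'"
    by (rule the1_equality[OF ex]) (use t eq in simp)
  ultimately show ?thesis by simp
qed

text \<open>
  The components over the charts are glued one by one; the transition equations of the result hold
  locally, hence globally.
\<close>

lemma sheaf_twist: "sheaf_of_modules (twist d F)"
  unfolding sheaf_of_modules_def
proof (intro conjI allI impI)
  show "presheaf_of_modules (twist d F)" by (rule presheaf_twist)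
  fix C and s :: "'a proj3 set \<Rightarrow> 4 \<Rightarrow> 'b"
  assume *: "(\<forall>U\<in>C. open U \<and> s U \<in> sec (twist d F) U) \<and>
    (\<forall>U\<in>C. \<forall>V\<in>C. res (twist d F) U (U \<inter> V) (s U) = res (twist d F) V (U \<inter> V) (s V))"
  have C: "\<And>U. U \<in> C \<Longrightarrow> open U" and s: "\<And>U. U \<in> C \<Longrightarrow> s U \<in> sec (twist d F) U"
    using * by blast+
  have compat: "res F (U \<inter> chart i) (U \<inter> V \<inter> chart i) (s U i) = res F (V \<inter> chart i) (U \<inter> V \<inter> chart i) (s V i)"
    if "U \<in> C" "V \<in> C" for U V i
  proof -
    have "res (twist d F) U (U \<inter> V) (s U) = res (twist d F) V (U \<inter> V) (s V)" using * that by blast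
    from fun_cong[OF this, of i] show ?thesis by simp
  qed
  let ?X = "\<Union>C"
  have oX: "open ?X" using C by blast
  note oX1 = open_Int_chart[OF oX]
  have oC: "\<And>U i. U \<in> C \<Longrightarrow> open (U \<inter> chart i)" using C open_Int_chart(1) by blast
  have X1: "?X \<inter> chart i = (\<Union>U\<in>C. U \<inter> chart i)" for i by blast
  have si: "s U i \<in> sec F (U \<inter> chart i)" if "U \<in> C" for U i
    using s[OF that] unfolding sec_twist by blast
  have ex: "\<exists>!t. t \<in> sec F (?X \<inter> chart i) \<and> (\<forall>U\<in>C. res F (?X \<inter> chart i) (U \<inter> chart i) t = s U i)" for i
  proof (rule glue_sections[OF oC si X1])
    fix U V assume UV: "U \<in> C" "V \<in> C"
    have eq: "U \<inter> chart i \<inter> (V \<inter> chart i) = U \<inter> V \<inter> chart i" by blast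
    show "res F (U \<inter> chart i) (U \<inter> chart i \<inter> (V \<inter> chart i)) (s U i) =
        res F (V \<inter> chart i) (U \<inter> chart i \<inter> (V \<inter> chart i)) (s V i)"
      unfolding eq by (rule compat[OF UV])
  qed
  define t where "t i = (THE t. t \<in> sec F (?X \<inter> chart i) \<and> (\<forall>U\<in>C. res F (?X \<inter> chart i) (U \<inter> chart i) t = s U i))" for i
  have t: "t i \<in> sec F (?X \<inter> chart i)" "\<And>U. U \<in> C \<Longrightarrow> res F (?X \<inter> chart i) (U \<inter> chart i) (t i) = s U i" for i
    using theI'[OF ex[of i]] by (auto simp: t_def)
  have tX: "t \<in> sec (twist d F) ?X"
    unfolding sec_twist
  proof (intro conjI allI)
    show "t i \<in> sec F (?X \<inter> chart i)" for i by (rule t(1))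
    fix i j
    let ?W = "?X \<inter> chart i \<inter> chart j"
    have tr: "restrict (transition d i j) ?W \<in> carrier (structure_ring ?W)"
      by (rule transition_regular[OF oX1(2)]) auto
    have Wi: "?W \<subseteq> ?X \<inter> chart i" and Wj: "?W \<subseteq> ?X \<inter> chart j" by auto
    note ri = res_closed[OF oX1(1) oX1(2) Wi t(1)] and rj = res_closed[OF oX1(1) oX1(2) Wj t(1)]
    show "res F (?X \<inter> chart j) ?W (t j) = restrict (transition d i j) ?W \<odot>\<^bsub>sections F ?W\<^esub> res F (?X \<inter> chart i) ?W (t i)"
    proof (rule sections_eqI[where A = C and U = "\<lambda>U. U \<inter> chart i \<inter> chart j"])
      show "?W = (\<Union>U\<in>C. U \<inter> chart i \<inter> chart j)" by blast
      show "restrict (transition d i j) ?W \<odot>\<^bsub>sections F ?W\<^esub> res F (?X \<inter> chart i) ?W (t i) \<in> sec F ?W"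
        by (rule smult_closed[OF oX1(2) tr ri])
      fix U assume U: "U \<in> C"
      let ?V = "U \<inter> chart i \<inter> chart j"
      show oV: "open ?V" using open_Int_chart[OF C[OF U]] by blast
      have sub: "?V \<subseteq> ?W" "?V \<subseteq> U \<inter> chart i" "?V \<subseteq> U \<inter> chart j" "U \<inter> chart i \<subseteq> ?X \<inter> chart i" "U \<inter> chart j \<subseteq> ?X \<inter> chart j"
        using U by auto
      have j: "res F ?W ?V (res F (?X \<inter> chart j) ?W (t j)) = res F (U \<inter> chart j) ?V (s U j)"
        unfolding res_res[OF oX1(1) oX1(2) oV sub(1) Wj t(1)] t(2)[OF U, symmetric]
          res_res[OF oX1(1) oC[OF U] oV sub(3,5) t(1)] ..
      have i: "res F ?W ?V (res F (?X \<inter> chart i) ?W (t i)) = res F (U \<inter> chart i) ?V (s U i)"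
        unfolding res_res[OF oX1(1) oX1(2) oV sub(1) Wi t(1)] t(2)[OF U, symmetric]
          res_res[OF oX1(1) oC[OF U] oV sub(2,4) t(1)] ..
      have "res F (U \<inter> chart j) ?V (s U j) = restrict (transition d i j) ?V \<odot>\<^bsub>sections F ?V\<^esub> res F (U \<inter> chart i) ?V (s U i)"
        using s[OF U] unfolding sec_twist by blast
      then show "res F ?W ?V (res F (?X \<inter> chart j) ?W (t j)) =
         res F ?W ?V (restrict (transition d i j) ?W \<odot>\<^bsub>sections F ?W\<^esub> res F (?X \<inter> chart i) ?W (t i))"
        unfolding res_smult[OF oX1(2) oV sub(1) tr ri] i j restrict_restrict_subset[OF sub(1)] .
    qed (rule rj)
  qed
  show "\<exists>!t. t \<in> sec (twist d F) ?X \<and> (\<forall>U\<in>C. res (twist d F) ?X U t = s U)"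
  proof (rule ex1I[of _ t])
    show "t \<in> sec (twist d F) ?X \<and> (\<forall>U\<in>C. res (twist d F) ?X U t = s U)"
      using tX t(2) by (simp add: fun_eq_iff)
    fix u assume u: "u \<in> sec (twist d F) ?X \<and> (\<forall>U\<in>C. res (twist d F) ?X U u = s U)"
    have "u i = t i" for i
    proof -
      have "u i \<in> sec F (?X \<inter> chart i)" using u unfolding sec_twist by blast
      moreover have "\<forall>U\<in>C. res F (?X \<inter> chart i) (U \<inter> chart i) (u i) = s U i" using u by (auto simp: fun_eq_iff)
      ultimately show "u i = t i" unfolding t_def by (intro the1_equality[OF ex, symmetric] conjI)
    qed
    then show "u = t" by blast
  qed
qed

lemma UN_charts: "(\<Union>i\<in>UNIV. U \<inter> chart i) = U"
  using ex_chart by blast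

text \<open>
  Over the chart of \<open>x\<^sub>j\<close> a section \<open>s\<close> is to be written as a section of \<open>F(d)\<close> times \<open>x\<^sub>j\<^sup>-\<^sup>d\<close>, that is, as
  \<open>(s \<otimes> x\<^sub>j\<^sup>d) \<otimes> x\<^sub>j\<^sup>-\<^sup>d\<close>. Over the chart of \<open>x\<^sub>i\<close> the first factor has the component \<open>(x\<^sub>j / x\<^sub>i)\<^sup>d s\<close>, which explains
  \<open>\<phi>\<close>. Conversely \<open>s\<close> is glued from the diagonal components, where \<open>i = j\<close>.
\<close>

lemma twist_untwist: "F \<simeq>\<^sub>s twist (- d) (twist d F)"
proof -
  let ?T = "twist d F" and ?TT = "twist (- d) (twist d F)"
  interpret T: module_presheaf "?T" by (rule module_presheaf_twist)
  define \<phi> where "\<phi> U s = (\<lambda>j i. restrict (transition d j i) (U \<inter> chart j \<inter> chart i)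
      \<odot>\<^bsub>sections F (U \<inter> chart j \<inter> chart i)\<^esub> res F U (U \<inter> chart j \<inter> chart i) s)" for U s
  note o1 = open_Int_chart(1) and o2 = open_Int_chart(2)
  have o3: "open (U \<inter> chart i \<inter> chart j \<inter> chart l)" if "open U" for U i j l using that by (simp add: open_Int)
  have tr: "restrict (transition d i j) W \<in> carrier (structure_ring W)" if "open W" "W \<subseteq> chart i" "W \<subseteq> chart j" for W d i j
    using transition_regular[OF that] .
  have sub2: "U \<inter> chart j \<inter> chart i \<subseteq> U" for U i j by auto
  have res_tr: "res F W W' (restrict (transition d j i) W \<odot>\<^bsub>sections F W\<^esub> res F U W s) =
      restrict (transition d j i) W' \<odot>\<^bsub>sections F W'\<^esub> res F U W' s"
    if "open U" "open W" "open W'" "W' \<subseteq> W" "W \<subseteq> U" "W \<subseteq> chart j" "W \<subseteq> chart i" "s \<in> sec F U" for U W W' i j s d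
    unfolding res_smult[OF that(2,3,4) tr[OF that(2,6,7)] res_closed[OF that(1,2,5,8)]]
      restrict_restrict_subset[OF that(4)] res_res[OF that(1,2,3,4,5,8)] ..
  have tr_tr: "restrict (transition d i j) W \<odot>\<^bsub>sections F W\<^esub> (restrict (transition d' i' j') W \<odot>\<^bsub>sections F W\<^esub> x) =
      restrict (transition e l m) W \<odot>\<^bsub>sections F W\<^esub> x"
    if "open W" "W \<subseteq> chart i" "W \<subseteq> chart j" "W \<subseteq> chart i'" "W \<subseteq> chart j'" "x \<in> sec F W"
      "\<And>p. p \<in> W \<Longrightarrow> transition d i j p * transition d' i' j' p = transition e l m p" for d d' e i j i' j' l m W x
  proof -
    have "(\<lambda>p\<in>W. restrict (transition d i j) W p * restrict (transition d' i' j') W p) = restrict (transition e l m) W"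
      using that(7) by (auto simp: restrict_def fun_eq_iff)
    then show ?thesis using smult_smult[OF that(1) tr[OF that(1-3)] tr[OF that(1,4,5)] that(6)] by simp
  qed
  have \<phi>_inner: "\<phi> U s j \<in> sec ?T (U \<inter> chart j)" if U: "open U" and s: "s \<in> sec F U" for U s j
    unfolding sec_twist \<phi>_def
  proof (intro conjI allI)
    fix i show "restrict (transition d j i) (U \<inter> chart j \<inter> chart i) \<odot>\<^bsub>sections F (U \<inter> chart j \<inter> chart i)\<^esub>
        res F U (U \<inter> chart j \<inter> chart i) s \<in> sec F (U \<inter> chart j \<inter> chart i)"
      by (rule smult_closed[OF o2[OF U] tr[OF o2[OF U]] res_closed[OF U o2[OF U] sub2 s]]) auto
  next
    fix i i'
    let ?Wi = "U \<inter> chart j \<inter> chart i" and ?Wi' = "U \<inter> chart j \<inter> chart i'" and ?W = "U \<inter> chart j \<inter> chart i \<inter> chart i'"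
    have 1: "res F ?Wi' ?W (restrict (transition d j i') ?Wi' \<odot>\<^bsub>sections F ?Wi'\<^esub> res F U ?Wi' s) =
        restrict (transition d j i') ?W \<odot>\<^bsub>sections F ?W\<^esub> res F U ?W s"
      by (rule res_tr[OF U o2[OF U] o3[OF U] _ _ _ _ s]) auto
    have 2: "res F ?Wi ?W (restrict (transition d j i) ?Wi \<odot>\<^bsub>sections F ?Wi\<^esub> res F U ?Wi s) =
        restrict (transition d j i) ?W \<odot>\<^bsub>sections F ?W\<^esub> res F U ?W s"
      by (rule res_tr[OF U o2[OF U] o3[OF U] _ _ _ _ s]) auto
    have 3: "restrict (transition d i i') ?W \<odot>\<^bsub>sections F ?W\<^esub> (restrict (transition d j i) ?W \<odot>\<^bsub>sections F ?W\<^esub> res F U ?W s) =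
        restrict (transition d j i') ?W \<odot>\<^bsub>sections F ?W\<^esub> res F U ?W s"
      by (rule tr_tr[OF o3[OF U] _ _ _ _ res_closed[OF U o3[OF U] _ s]])
         (auto simp: transition_cocycle mult.commute[of "transition d i i' _"])
    show "res F ?Wi' ?W (restrict (transition d j i') ?Wi' \<odot>\<^bsub>sections F ?Wi'\<^esub> res F U ?Wi' s) =
       restrict (transition d i i') ?W \<odot>\<^bsub>sections F ?W\<^esub>
       res F ?Wi ?W (restrict (transition d j i) ?Wi \<odot>\<^bsub>sections F ?Wi\<^esub> res F U ?Wi s)"
      unfolding 1 2 3 ..
  qed
  have \<phi>_closed: "\<phi> U s \<in> sec ?TT U" if U: "open U" and s: "s \<in> sec F U" for U s
    unfolding sec_twist[of _ "- d"]
  proof (intro conjI allI)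
    show "\<phi> U s j \<in> sec ?T (U \<inter> chart j)" for j by (rule \<phi>_inner[OF U s])
    fix j j'
    let ?V = "U \<inter> chart j \<inter> chart j'"
    show "res ?T (U \<inter> chart j') ?V (\<phi> U s j') =
        restrict (transition (- d) j j') ?V \<odot>\<^bsub>sections ?T ?V\<^esub> res ?T (U \<inter> chart j) ?V (\<phi> U s j)"
    proof (simp only: twist_simps, rule ext)
      fix i
      let ?W = "?V \<inter> chart i"
      have 1: "res F (U \<inter> chart j' \<inter> chart i) ?W (\<phi> U s j' i) = restrict (transition d j' i) ?W \<odot>\<^bsub>sections F ?W\<^esub> res F U ?W s"
        unfolding \<phi>_def by (rule res_tr[OF U o2[OF U] o3[OF U] _ _ _ _ s]) auto
      have 2: "res F (U \<inter> chart j \<inter> chart i) ?W (\<phi> U s j i) = restrict (transition d j i) ?W \<odot>\<^bsub>sections F ?W\<^esub> res F U ?W s"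
        unfolding \<phi>_def by (rule res_tr[OF U o2[OF U] o3[OF U] _ _ _ _ s]) auto
      have rr: "restrict (restrict (transition (- d) j j') ?V) ?W = restrict (transition (- d) j j') ?W"
        by (rule restrict_restrict_subset) auto
      have 3: "restrict (transition (- d) j j') ?W \<odot>\<^bsub>sections F ?W\<^esub> (restrict (transition d j i) ?W \<odot>\<^bsub>sections F ?W\<^esub> res F U ?W s) =
          restrict (transition d j' i) ?W \<odot>\<^bsub>sections F ?W\<^esub> res F U ?W s"
        by (rule tr_tr[OF o3[OF U] _ _ _ _ res_closed[OF U o3[OF U] _ s]])
           (auto simp: transition_swap transition_cocycle)
      show "res F (U \<inter> chart j' \<inter> chart i) ?W (\<phi> U s j' i) =
         restrict (restrict (transition (- d) j j') ?V) ?W \<odot>\<^bsub>sections F ?W\<^esub> res F (U \<inter> chart j \<inter> chart i) ?W (\<phi> U s j i)"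
        unfolding 1 2 rr 3 ..
    qed
  qed
  have diag: "\<phi> U s j j = res F U (U \<inter> chart j) s" if U: "open U" and s: "s \<in> sec F U" for U s j
  proof -
    let ?W = "U \<inter> chart j"
    have *: "?W \<inter> chart j = ?W" by blast
    have "restrict (transition d j j) ?W = (\<lambda>p\<in>?W. 1)" by (rule restrict_ext) (simp add: transition_self)
    then show ?thesis unfolding \<phi>_def *
      using one_smult[OF o1[OF U] res_closed[OF U o1[OF U] Int_lower1 s]] by simp
  qed
  have morph: "sheaf_morphism F ?TT \<phi>"
    unfolding sheaf_morphism_def
  proof (intro conjI allI impI ballI)
    fix U :: "'a proj3 set" assume U: "open U"
    show "\<phi> U \<in> sec F U \<rightarrow> sec ?TT U" using \<phi>_closed[OF U] by blast
    have cl: "res F U (U \<inter> chart j \<inter> chart i) s \<in> sec F (U \<inter> chart j \<inter> chart i)" if "s \<in> sec F U" for i j s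
      by (rule res_closed[OF U o2[OF U] sub2 that])
    have trU: "restrict (transition d j i) (U \<inter> chart j \<inter> chart i) \<in> carrier (structure_ring (U \<inter> chart j \<inter> chart i))" for i j
      by (rule tr[OF o2[OF U]]) auto
    show "\<phi> U (s \<oplus>\<^bsub>sections F U\<^esub> t) = \<phi> U s \<oplus>\<^bsub>sections ?TT U\<^esub> \<phi> U t" if "s \<in> sec F U" "t \<in> sec F U" for s t
      unfolding \<phi>_def twist_simps res_add[OF U o2[OF U] sub2 that] smult_add[OF o2[OF U] trU cl[OF that(1)] cl[OF that(2)]] ..
    fix a s assume a: "a \<in> carrier (structure_ring U)" and s: "s \<in> sec F U"
    have aW: "restrict a (U \<inter> chart j \<inter> chart i) \<in> carrier (structure_ring (U \<inter> chart j \<inter> chart i))" for i j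
      by (rule restrict_in_structure_ring[OF a o2[OF U] sub2])
    have rr: "restrict (restrict a (U \<inter> chart j)) (U \<inter> chart j \<inter> chart i) = restrict a (U \<inter> chart j \<inter> chart i)" for i j
      by (rule restrict_restrict_subset) auto
    show "\<phi> U (a \<odot>\<^bsub>sections F U\<^esub> s) = a \<odot>\<^bsub>sections ?TT U\<^esub> \<phi> U s"
      unfolding \<phi>_def twist_simps rr res_smult[OF U o2[OF U] sub2 a s] smult_smult[OF o2[OF U] trU aW cl[OF s]]
        smult_smult[OF o2[OF U] aW trU cl[OF s]] by (simp only: mult.commute)
  next
    fix U V :: "'a proj3 set" and s assume "open U \<and> open V \<and> V \<subseteq> U" and s: "s \<in> sec F U"
    then have U: "open U" and V: "open V" "V \<subseteq> U" by auto
    show "res ?TT U V (\<phi> U s) = \<phi> V (res F U V s)"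
    proof (simp only: twist_simps, intro ext)
      fix j i
      have "res F (U \<inter> chart j \<inter> chart i) (V \<inter> chart j \<inter> chart i) (\<phi> U s j i) =
          restrict (transition d j i) (V \<inter> chart j \<inter> chart i) \<odot>\<^bsub>sections F (V \<inter> chart j \<inter> chart i)\<^esub> res F U (V \<inter> chart j \<inter> chart i) s"
        unfolding \<phi>_def by (rule res_tr[OF U o2[OF U] o2[OF V(1)] _ _ _ _ s]) (use V in auto)
      also have "res F U (V \<inter> chart j \<inter> chart i) s = res F V (V \<inter> chart j \<inter> chart i) (res F U V s)"
        by (rule res_res[OF U V(1) o2[OF V(1)] sub2 V(2) s, symmetric])
      finally show "res F (U \<inter> chart j \<inter> chart i) (V \<inter> chart j \<inter> chart i) (\<phi> U s j i) = \<phi> V (res F U V s) j i"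
        unfolding \<phi>_def .
    qed
  qed
  have bij: "bij_betw (\<phi> U) (sec F U) (sec ?TT U)" if U: "open U" for U
    unfolding bij_betw_def
  proof
    show "inj_on (\<phi> U) (sec F U)"
    proof (rule inj_onI)
      fix s t assume st: "s \<in> sec F U" "t \<in> sec F U" "\<phi> U s = \<phi> U t"
      show "s = t"
        by (rule sections_eqI[OF o1[OF U] UN_charts[symmetric] st(1,2)])
           (metis diag[OF U st(1)] diag[OF U st(2)] st(3))
    qed
    show "\<phi> U ` sec F U = sec ?TT U"
    proof
      show "\<phi> U ` sec F U \<subseteq> sec ?TT U" using \<phi>_closed[OF U] by blast
      show "sec ?TT U \<subseteq> \<phi> U ` sec F U"
      proof
        fix t assume t: "t \<in> sec ?TT U"
        have t1: "t j \<in> sec ?T (U \<inter> chart j)" for j using t unfolding sec_twist[of _ "- d"] by blast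
        have t2: "t j i \<in> sec F (U \<inter> chart j \<inter> chart i)" for i j using t1[of j] unfolding sec_twist by blast
        have inner: "res F (U \<inter> chart j \<inter> chart i') (U \<inter> chart j \<inter> chart i \<inter> chart i') (t j i') =
            restrict (transition d i i') (U \<inter> chart j \<inter> chart i \<inter> chart i') \<odot>\<^bsub>sections F (U \<inter> chart j \<inter> chart i \<inter> chart i')\<^esub>
            res F (U \<inter> chart j \<inter> chart i) (U \<inter> chart j \<inter> chart i \<inter> chart i') (t j i)" for i i' j
          using t1[of j] unfolding sec_twist by blast
        have outer: "res F (U \<inter> chart j' \<inter> chart i) (U \<inter> chart j \<inter> chart j' \<inter> chart i) (t j' i) =
            restrict (transition (- d) j j') (U \<inter> chart j \<inter> chart j' \<inter> chart i) \<odot>\<^bsub>sections F (U \<inter> chart j \<inter> chart j' \<inter> chart i)\<^esub>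
            res F (U \<inter> chart j \<inter> chart i) (U \<inter> chart j \<inter> chart j' \<inter> chart i) (t j i)" for i j j'
        proof -
          have "res ?T (U \<inter> chart j') (U \<inter> chart j \<inter> chart j') (t j') =
             restrict (transition (- d) j j') (U \<inter> chart j \<inter> chart j') \<odot>\<^bsub>sections ?T (U \<inter> chart j \<inter> chart j')\<^esub>
             res ?T (U \<inter> chart j) (U \<inter> chart j \<inter> chart j') (t j)"
            using t unfolding sec_twist[of _ "- d"] by blast
          from fun_cong[OF this, of i] show ?thesis
            unfolding twist_simps restrict_restrict_subset[OF Int_lower1] .
        qed
        have tjj: "t j j \<in> sec F (U \<inter> chart j)" for j
        proof -
          have "U \<inter> chart j \<inter> chart j = U \<inter> chart j" by blast
          then show ?thesis using t2[of j j] by simp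
        qed
        have tji: "t j i = restrict (transition d j i) (U \<inter> chart j \<inter> chart i) \<odot>\<^bsub>sections F (U \<inter> chart j \<inter> chart i)\<^esub>
            res F (U \<inter> chart j) (U \<inter> chart j \<inter> chart i) (t j j)" for i j
        proof -
          have "U \<inter> chart j \<inter> chart j = U \<inter> chart j" by blast
          with inner[of j i j] show ?thesis by (simp only: res_id[OF o2[OF U] t2])
        qed
        have tii: "res F (U \<inter> chart i) (U \<inter> chart j \<inter> chart i) (t i i) = res F (U \<inter> chart j) (U \<inter> chart j \<inter> chart i) (t j j)" for i j
        proof -
          let ?W = "U \<inter> chart j \<inter> chart i"
          have e: "U \<inter> chart i \<inter> chart i = U \<inter> chart i" "?W \<inter> chart i = ?W" by blast+
          have x: "res F (U \<inter> chart j) ?W (t j j) \<in> sec F ?W" by (rule res_closed[OF o1[OF U] o2[OF U] Int_lower1 tjj])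
          have "res F (U \<inter> chart i) ?W (t i i) = restrict (transition (- d) j i) ?W \<odot>\<^bsub>sections F ?W\<^esub> t j i"
            using outer[of i i j] unfolding e res_id[OF o2[OF U] t2] .
          also have "\<dots> = restrict (transition d j j) ?W \<odot>\<^bsub>sections F ?W\<^esub> res F (U \<inter> chart j) ?W (t j j)"
            unfolding tji[of j i] by (rule tr_tr[OF o2[OF U] _ _ _ _ x])
              (auto simp: transition_swap transition_cocycle mult.commute[of "transition d i j _"])
          also have "restrict (transition d j j) ?W = (\<lambda>p\<in>?W. 1)" by (rule restrict_ext) (simp add: transition_self)
          finally show ?thesis by (simp only: one_smult[OF o2[OF U] x])
        qed
        have "\<exists>!s. s \<in> sec F U \<and> (\<forall>j\<in>UNIV. res F U (U \<inter> chart j) s = t j j)"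
        proof (rule glue_sections[OF o1[OF U] tjj UN_charts[symmetric]])
          fix j i
          have "U \<inter> chart j \<inter> (U \<inter> chart i) = U \<inter> chart j \<inter> chart i" by blast
          then show "res F (U \<inter> chart j) (U \<inter> chart j \<inter> (U \<inter> chart i)) (t j j) =
              res F (U \<inter> chart i) (U \<inter> chart j \<inter> (U \<inter> chart i)) (t i i)"
            using tii[of i j] by simp
        qed
        then obtain s where s: "s \<in> sec F U" "\<And>j. res F U (U \<inter> chart j) s = t j j" by blast
        have "\<phi> U s j i = t j i" for j i
          unfolding tji[of j i] \<phi>_def s(2)[symmetric] res_res[OF U o1[OF U] o2[OF U] Int_lower1 Int_lower1 s(1)] ..
        then have "\<phi> U s = t" by blast
        then show "t \<in> \<phi> U ` sec F U" using s(1) by blast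
      qed
    qed
  qed
  show ?thesis unfolding sheaf_isomorphic_def using morph bij by blast
qed

end

section \<open>The sheaf of a pencil\<close>

lemma T_sheaf_simps:
  "s \<oplus>\<^bsub>sections (T_sheaf k \<sigma>) U\<^esub> t = (\<lambda>i. \<lambda>p\<in>U. s i p + t i p)"
  "\<zero>\<^bsub>sections (T_sheaf k \<sigma>) U\<^esub> = (\<lambda>i. \<lambda>p\<in>U. 0)"
  "a \<odot>\<^bsub>sections (T_sheaf k \<sigma>) U\<^esub> s = (\<lambda>i. \<lambda>p\<in>U. a p * s i p)"
  "res (T_sheaf k \<sigma>) U V s = (\<lambda>i. restrict (s i) V)"
  by (simp_all add: T_sheaf_def kernel_sheaf_def power_sheaf_def structure_sheaf_def mk_module_def)

lemma sec_T_sheaf: "s \<in> sec (T_sheaf k (f, g)) U \<longleftrightarrow>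
    (\<forall>i. s i \<in> extensional U \<and> regular_on U (s i)) \<and>
    (\<forall>v\<in>cone U. (\<Sum>i\<in>UNIV. pd i f v * s i (pt v)) = 0 \<and> (\<Sum>i\<in>UNIV. pd i g v * s i (pt v)) = 0)"
proof -
  have two: "(\<forall>r::2. P r) \<longleftrightarrow> P 0 \<and> P 1" for P
  proof -
    have "card {0, 1 :: 2} = 2" by (simp add: card_insert_if)
    then have "(UNIV :: 2 set) = {0, 1}" by (intro card_subset_eq[symmetric]) auto
    then show ?thesis by (metis UNIV_I insertE singletonD)
  qed
  show ?thesis
    by (auto simp: T_sheaf_def kernel_sheaf_def power_sheaf_def structure_sheaf_def O_sheaf_def mk_module_def
        jacobian_map_def pd_def fun_eq_iff two restrict_def)
qed

lemma module_T_sheaf: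
  assumes U: "open U"
  shows "Module.module (structure_ring U) (sections (T_sheaf k (f, g)) U)"
proof -
  have add: "(\<lambda>i. \<lambda>p\<in>U. s i p + t i p) \<in> sec (T_sheaf k (f, g)) U"
    if "s \<in> sec (T_sheaf k (f, g)) U" "t \<in> sec (T_sheaf k (f, g)) U" for s t
    using that unfolding sec_T_sheaf
    by (auto simp: regular_on_add U cone_def distrib_left sum.distrib)
  have zero: "(\<lambda>i. \<lambda>p\<in>U. 0) \<in> sec (T_sheaf k (f, g)) U"
    unfolding sec_T_sheaf by (auto simp: regular_on_const U cone_def)
  have smult: "(\<lambda>i. \<lambda>p\<in>U. a p * s i p) \<in> sec (T_sheaf k (f, g)) U"
    if "regular_on U a" "s \<in> sec (T_sheaf k (f, g)) U" for a s
  proof -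
    have "(\<Sum>i\<in>UNIV. pd i h v * (a (pt v) * s i (pt v))) = a (pt v) * (\<Sum>i\<in>UNIV. pd i h v * s i (pt v))" for v h
      by (simp add: sum_distrib_left mult_ac)
    with that show ?thesis unfolding sec_T_sheaf by (auto simp: regular_on_mult U cone_def)
  qed
  have ext: "s i p = undefined" if "s \<in> sec (T_sheaf k (f, g)) U" "p \<notin> U" for s i p
    using that unfolding sec_T_sheaf by (auto simp: extensional_def)
  show ?thesis
  proof (rule moduleI)
    show "cring (structure_ring U)" by (rule cring_structure_ring[OF U])
    show "abelian_group (sections (T_sheaf k (f, g)) U)"
    proof (rule abelian_groupI, goal_cases)
      case (1 x y) then show ?case by (simp add: T_sheaf_simps add)
    next
      case 2 show ?case by (simp add: T_sheaf_simps zero)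
    next
      case (3 x y z) show ?case by (auto simp: T_sheaf_simps fun_eq_iff restrict_def)
    next
      case (4 x y) show ?case by (auto simp: T_sheaf_simps fun_eq_iff restrict_def)
    next
      case (5 x) then show ?case by (auto simp: T_sheaf_simps fun_eq_iff restrict_def ext)
    next
      case (6 x)
      show ?case
        by (rule bexI[OF _ smult[OF regular_on_const[OF U, of "-1"] 6]])
           (auto simp: T_sheaf_simps fun_eq_iff restrict_def)
    qed
    fix a b x y
    assume x: "x \<in> sec (T_sheaf k (f, g)) U"
    show "\<one>\<^bsub>structure_ring U\<^esub> \<odot>\<^bsub>sections (T_sheaf k (f, g)) U\<^esub> x = x"
      using ext[OF x] by (auto simp: T_sheaf_simps fun_eq_iff restrict_def)
    show "(a \<oplus>\<^bsub>structure_ring U\<^esub> b) \<odot>\<^bsub>sections (T_sheaf k (f, g)) U\<^esub> x =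
        a \<odot>\<^bsub>sections (T_sheaf k (f, g)) U\<^esub> x \<oplus>\<^bsub>sections (T_sheaf k (f, g)) U\<^esub> b \<odot>\<^bsub>sections (T_sheaf k (f, g)) U\<^esub> x"
      by (auto simp: T_sheaf_simps fun_eq_iff restrict_def algebra_simps)
    show "(a \<otimes>\<^bsub>structure_ring U\<^esub> b) \<odot>\<^bsub>sections (T_sheaf k (f, g)) U\<^esub> x =
        a \<odot>\<^bsub>sections (T_sheaf k (f, g)) U\<^esub> (b \<odot>\<^bsub>sections (T_sheaf k (f, g)) U\<^esub> x)"
      by (auto simp: T_sheaf_simps fun_eq_iff restrict_def algebra_simps)
    show "a \<odot>\<^bsub>sections (T_sheaf k (f, g)) U\<^esub> (x \<oplus>\<^bsub>sections (T_sheaf k (f, g)) U\<^esub> y) =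
        a \<odot>\<^bsub>sections (T_sheaf k (f, g)) U\<^esub> x \<oplus>\<^bsub>sections (T_sheaf k (f, g)) U\<^esub> a \<odot>\<^bsub>sections (T_sheaf k (f, g)) U\<^esub> y"
      by (auto simp: T_sheaf_simps fun_eq_iff restrict_def algebra_simps)
    assume "a \<in> carrier (structure_ring U)"
    then show "a \<odot>\<^bsub>sections (T_sheaf k (f, g)) U\<^esub> x \<in> sec (T_sheaf k (f, g)) U"
      using smult[OF _ x] by (simp add: T_sheaf_simps)
  qed
qed

lemma presheaf_T_sheaf: "presheaf_of_modules (T_sheaf k (f, g))"
  unfolding presheaf_of_modules_def
proof (intro conjI allI impI ballI)
  fix U V :: "'a proj3 set" assume UV: "open U \<and> open V \<and> V \<subseteq> U"
  show "res (T_sheaf k (f, g)) U V \<in> sec (T_sheaf k (f, g)) U \<rightarrow> sec (T_sheaf k (f, g)) V"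
  proof
    fix s assume s: "s \<in> sec (T_sheaf k (f, g)) U"
    show "res (T_sheaf k (f, g)) U V s \<in> sec (T_sheaf k (f, g)) V"
      using s UV unfolding sec_T_sheaf T_sheaf_simps
      by (auto simp: cone_def intro: regular_on_mono)
  qed
  fix s t assume "s \<in> sec (T_sheaf k (f, g)) U" "t \<in> sec (T_sheaf k (f, g)) U"
  show "res (T_sheaf k (f, g)) U V (s \<oplus>\<^bsub>sections (T_sheaf k (f, g)) U\<^esub> t) =
      res (T_sheaf k (f, g)) U V s \<oplus>\<^bsub>sections (T_sheaf k (f, g)) V\<^esub> res (T_sheaf k (f, g)) U V t"
    using UV by (auto simp: T_sheaf_simps fun_eq_iff restrict_def)
next
  fix U V :: "'a proj3 set" and a s assume UV: "open U \<and> open V \<and> V \<subseteq> U"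
  then show "res (T_sheaf k (f, g)) U V (a \<odot>\<^bsub>sections (T_sheaf k (f, g)) U\<^esub> s) =
      restrict a V \<odot>\<^bsub>sections (T_sheaf k (f, g)) V\<^esub> res (T_sheaf k (f, g)) U V s"
    by (auto simp: T_sheaf_simps fun_eq_iff restrict_def)
next
  fix U :: "'a proj3 set" and s assume "s \<in> sec (T_sheaf k (f, g)) U"
  then show "res (T_sheaf k (f, g)) U U s = s"
    unfolding sec_T_sheaf T_sheaf_simps by (simp add: extensional_restrict)
next
  fix U V W :: "'a proj3 set" and s assume "open U \<and> open V \<and> open W \<and> W \<subseteq> V \<and> V \<subseteq> U"
  then show "res (T_sheaf k (f, g)) V W (res (T_sheaf k (f, g)) U V s) = res (T_sheaf k (f, g)) U W s"
    by (simp add: T_sheaf_simps Int_absorb1)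
qed (rule module_T_sheaf)

lemma sheaf_T_sheaf: "sheaf_of_modules (T_sheaf k (f, g))"
  unfolding sheaf_of_modules_def
proof (intro conjI allI impI)
  show "presheaf_of_modules (T_sheaf k (f, g))" by (rule presheaf_T_sheaf)
  fix C and s :: "'a proj3 set \<Rightarrow> 4 \<Rightarrow> 'a proj3 \<Rightarrow> 'a"
  assume *: "(\<forall>U\<in>C. open U \<and> s U \<in> sec (T_sheaf k (f, g)) U) \<and>
    (\<forall>U\<in>C. \<forall>V\<in>C. res (T_sheaf k (f, g)) U (U \<inter> V) (s U) = res (T_sheaf k (f, g)) V (U \<inter> V) (s V))"
  have C: "\<And>U. U \<in> C \<Longrightarrow> open U" and s: "\<And>U. U \<in> C \<Longrightarrow> s U \<in> sec (T_sheaf k (f, g)) U"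
    using * by blast+
  have compat: "s U i p = s V i p" if "U \<in> C" "V \<in> C" "p \<in> U" "p \<in> V" for U V i p
  proof -
    have "res (T_sheaf k (f, g)) U (U \<inter> V) (s U) = res (T_sheaf k (f, g)) V (U \<inter> V) (s V)"
      using * that by blast
    from fun_cong[OF fun_cong[OF this, of i], of p]
    have "restrict (s U i) (U \<inter> V) p = restrict (s V i) (U \<inter> V) p"
      unfolding T_sheaf_simps .
    with that show ?thesis by simp
  qed
  define t where "t i = (\<lambda>p\<in>\<Union>C. s (SOME U. U \<in> C \<and> p \<in> U) i p)" for i
  have t: "t i p = s U i p" if U: "U \<in> C" "p \<in> U" for U i p
  proof -
    define V where "V = (SOME U. U \<in> C \<and> p \<in> U)"
    have V: "V \<in> C \<and> p \<in> V"
      unfolding V_def by (rule someI_ex) (use U in blast)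
    have "p \<in> \<Union>C" using U by blast
    then have "t i p = s V i p" by (simp add: t_def V_def)
    also have "\<dots> = s U i p" by (rule compat[OF conjunct1[OF V] U(1) conjunct2[OF V] U(2)])
    finally show ?thesis .
  qed
  have oX: "open (\<Union>C)" by (rule open_Union) (use C in blast)
  show "\<exists>!t. t \<in> sec (T_sheaf k (f, g)) (\<Union>C) \<and> (\<forall>U\<in>C. res (T_sheaf k (f, g)) (\<Union>C) U t = s U)"
  proof (rule ex1I[of _ t], intro conjI ballI)
    show "t \<in> sec (T_sheaf k (f, g)) (\<Union>C)"
      unfolding sec_T_sheaf
    proof (intro conjI allI ballI)
      show "t i \<in> extensional (\<Union>C)" for i by (simp add: t_def)
      show "regular_on (\<Union>C) (t i)" for i
        unfolding regular_on_iff_sect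
      proof (rule sect_local)
        fix p assume "p \<in> \<Union>C"
        then obtain U where U: "U \<in> C" "p \<in> U" by blast
        have "regular_on U (s U i)" using s[OF U(1)] unfolding sec_T_sheaf by blast
        then have "regular_on U (t i)" by (subst regular_on_cong[of U "t i" "s U i"]) (simp_all add: t U(1))
        then show "\<exists>V. open V \<and> p \<in> V \<and> V \<subseteq> \<Union>C \<and> sect 0 V (\<lambda>v. t i (pt v))"
          using U C by (auto simp: regular_on_iff_sect)
      qed
      fix v assume "v \<in> cone (\<Union>C)"
      then obtain U where U: "U \<in> C" "v \<in> cone U" by (auto simp: cone_def)
      then have "t i (pt v) = s U i (pt v)" for i by (intro t) (auto simp: cone_def)
      then show "(\<Sum>i\<in>UNIV. pd i f v * t i (pt v)) = 0" "(\<Sum>i\<in>UNIV. pd i g v * t i (pt v)) = 0"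
        using s[OF U(1)] U(2) unfolding sec_T_sheaf by auto
    qed
    show "res (T_sheaf k (f, g)) (\<Union>C) U t = s U" if U: "U \<in> C" for U
    proof (rule ext)
      fix i
      have "s U i \<in> extensional U" using s[OF U] unfolding sec_T_sheaf by blast
      then show "res (T_sheaf k (f, g)) (\<Union>C) U t i = s U i"
        unfolding T_sheaf_simps by (intro extensionalityI[of _ U]) (auto simp: t[OF U])
    qed
    fix u assume u: "u \<in> sec (T_sheaf k (f, g)) (\<Union>C) \<and> (\<forall>U\<in>C. res (T_sheaf k (f, g)) (\<Union>C) U u = s U)"
    show "u = t"
    proof (rule ext)
      fix i
      have "u i \<in> extensional (\<Union>C)" using u unfolding sec_T_sheaf by blast
      moreover have "u i p = t i p" if p: "p \<in> \<Union>C" for p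
      proof -
        obtain U where U: "U \<in> C" "p \<in> U" using p by blast
        then have "restrict (u i) U p = s U i p" using u unfolding T_sheaf_simps by metis
        then show ?thesis using t[OF U] U(2) by simp
      qed
      ultimately show "u i = t i" by (intro extensionalityI[of _ "\<Union>C"]) (auto simp: t_def)
    qed
  qed
qed

interpretation T_sheaf: module_sheaf "T_sheaf k (f, g)" for k :: nat and f g :: "'a::field poly4"
  by unfold_locales (rule presheaf_T_sheaf sheaf_T_sheaf)+

text \<open>
  A section of \<open>T\<^sub>\<sigma>(m)\<close> with components \<open>t\<^sub>i\<close> corresponds to the vector of functions \<open>x\<^sub>i\<^sup>m t\<^sub>i\<close> of degree
  \<open>m\<close> on the cone; by the transition equations the choice of \<open>i\<close> does not matter.
\<close>

definition cone_coeff :: "nat \<Rightarrow> (4 \<Rightarrow> 4 \<Rightarrow> 'a::field proj3 \<Rightarrow> 'a) \<Rightarrow> 4 \<Rightarrow> 'a ^ 4 \<Rightarrow> 'a" where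
  "cone_coeff m t j v = (let i = SOME i. v $ i \<noteq> 0 in v $ i ^ m * t i j (pt v))"

definition of_cone_coeff :: "nat \<Rightarrow> (4 \<Rightarrow> 'a::field ^ 4 \<Rightarrow> 'a) \<Rightarrow> 'a proj3 set \<Rightarrow> 4 \<Rightarrow> 4 \<Rightarrow> 'a proj3 \<Rightarrow> 'a" where
  "of_cone_coeff m \<beta> U = (\<lambda>i j. \<lambda>p\<in>U \<inter> chart i. \<beta> j (rep_proj3 p) / rep_proj3 p $ i ^ m)"

lemma sect_rep_quotient:
  assumes s: "sect (int m) U s" and v: "v \<in> cone U"
  shows "s (rep_proj3 (pt v)) / rep_proj3 (pt v) $ i ^ m = s v / v $ i ^ m"
proof -
  have "v \<noteq> 0" using v by (simp add: cone_def)
  then obtain c where "c \<noteq> 0" "rep_proj3 (pt v) = c *s v" using rep_pt by blast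
  then show ?thesis using sect_scale[OF s v, of c] by (simp add: power_mult_distrib)
qed

lemma of_cone_coeff_pt:
  assumes "sect (int m) U (\<beta> j)" "v \<in> cone U" "v $ i \<noteq> 0"
  shows "of_cone_coeff m \<beta> U i j (pt v) = \<beta> j v / v $ i ^ m"
  using sect_rep_quotient[OF assms(1,2), of i] assms(2,3)
  by (auto simp: of_cone_coeff_def cone_def pt_in_chart)

lemma of_cone_coeff_in_twist:
  assumes U: "open U" and \<beta>: "\<And>j. sect (int m) U (\<beta> j)"
    and jac: "\<And>v. v \<in> cone U \<Longrightarrow> (\<Sum>i\<in>UNIV. pd i f v * \<beta> i v) = 0 \<and> (\<Sum>i\<in>UNIV. pd i g v * \<beta> i v) = 0"
  shows "of_cone_coeff m \<beta> U \<in> sec (twist (int m) (T_sheaf k (f, g))) U"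
  unfolding sec_twist
proof (intro conjI allI)
  fix i
  let ?W = "U \<inter> chart i"
  have oW: "open ?W" using U by auto
  have pt: "of_cone_coeff m \<beta> U i j (pt v) = \<beta> j v / v $ i ^ m" if "v \<in> cone ?W" for v j
    by (rule of_cone_coeff_pt[where U = U]) (use that \<beta> in \<open>auto simp: cone_Int cone_chart\<close>)
  show "of_cone_coeff m \<beta> U i \<in> sec (T_sheaf k (f, g)) ?W"
    unfolding sec_T_sheaf
  proof (intro conjI allI ballI)
    show "of_cone_coeff m \<beta> U i j \<in> extensional ?W" for j by (simp add: of_cone_coeff_def)
    show "regular_on ?W (of_cone_coeff m \<beta> U i j)" for j
    proof -
      have "sect 0 ?W (\<lambda>v. \<beta> j v / v $ i ^ m)"
        by (rule sect_div_coord[OF sect_mono[OF \<beta> oW] oW]) auto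
      then show ?thesis unfolding regular_on_iff_sect by (subst sect_cong[OF pt])
    qed
    fix v assume v: "v \<in> cone ?W"
    have "(\<Sum>j\<in>UNIV. pd j h v * of_cone_coeff m \<beta> U i j (pt v)) = (\<Sum>j\<in>UNIV. pd j h v * \<beta> j v) / v $ i ^ m" for h
      by (simp add: pt[OF v] sum_divide_distrib)
    then show "(\<Sum>j\<in>UNIV. pd j f v * of_cone_coeff m \<beta> U i j (pt v)) = 0"
      "(\<Sum>j\<in>UNIV. pd j g v * of_cone_coeff m \<beta> U i j (pt v)) = 0"
      using jac v by (simp_all add: cone_Int)
  qed
next
  fix i j
  show "res (T_sheaf k (f, g)) (U \<inter> chart j) (U \<inter> chart i \<inter> chart j) (of_cone_coeff m \<beta> U j) =
     restrict (transition (int m) i j) (U \<inter> chart i \<inter> chart j)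
       \<odot>\<^bsub>sections (T_sheaf k (f, g)) (U \<inter> chart i \<inter> chart j)\<^esub>
     res (T_sheaf k (f, g)) (U \<inter> chart i) (U \<inter> chart i \<inter> chart j) (of_cone_coeff m \<beta> U i)"
    unfolding T_sheaf_simps
    by (auto simp: fun_eq_iff restrict_def of_cone_coeff_def transition_def in_chart_iff power_divide)
qed

text \<open>
  Together with \<open>of_cone_coeff_in_twist\<close> this identifies the sections of \<open>T\<^sub>\<sigma>(m)\<close> with the vectors of
  functions of degree \<open>m\<close> on the cone that the Jacobian matrix annihilates.
\<close>

lemma twist_T_sheaf_cone:
  assumes U: "open U" and t: "t \<in> sec (twist (int m) (T_sheaf k (f, g))) U"
  shows cone_coeff_eq: "v \<in> cone U \<Longrightarrow> v $ i \<noteq> 0 \<Longrightarrow> cone_coeff m t j v = v $ i ^ m * t i j (pt v)"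
    and sect_cone_coeff: "sect (int m) U (cone_coeff m t j)"
    and jac_cone_coeff: "v \<in> cone U \<Longrightarrow>
      (\<Sum>i\<in>UNIV. pd i f v * cone_coeff m t i v) = 0 \<and> (\<Sum>i\<in>UNIV. pd i g v * cone_coeff m t i v) = 0"
    and of_cone_coeff_cone_coeff: "t = of_cone_coeff m (cone_coeff m t) U"
proof -
  have ti: "t i \<in> sec (T_sheaf k (f, g)) (U \<inter> chart i)" for i using t unfolding sec_twist by blast
  have glue: "t j l p = transition (int m) i j p * t i l p" if "p \<in> U" "p \<in> chart i" "p \<in> chart j" for i j l p
  proof -
    let ?W = "U \<inter> chart i \<inter> chart j"
    have "res (T_sheaf k (f, g)) (U \<inter> chart j) ?W (t j) =
      restrict (transition (int m) i j) ?W \<odot>\<^bsub>sections (T_sheaf k (f, g)) ?W\<^esub> res (T_sheaf k (f, g)) (U \<inter> chart i) ?W (t i)"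
      using t unfolding sec_twist by blast
    from fun_cong[OF fun_cong[OF this, of l], of p] that show ?thesis
      unfolding T_sheaf_simps by simp
  qed
  have *: "v $ j ^ m * t j l (pt v) = v $ i ^ m * t i l (pt v)" if v: "v \<in> cone U" "v $ i \<noteq> 0" "v $ j \<noteq> 0" for v i j l
  proof -
    have v0: "v \<noteq> 0" "pt v \<in> U" using v by (auto simp: cone_def)
    obtain c where c: "c \<noteq> 0" "rep_proj3 (pt v) = c *s v" using rep_pt[OF v0(1)] by blast
    have "transition (int m) i j (pt v) = v $ i ^ m / v $ j ^ m"
      using c by (simp add: transition_def power_divide)
    moreover have "t j l (pt v) = transition (int m) i j (pt v) * t i l (pt v)"
      by (rule glue) (use v v0 in \<open>auto simp: pt_in_chart\<close>)
    ultimately show ?thesis using v by simp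
  qed
  show eq: "cone_coeff m t j v = v $ i ^ m * t i j (pt v)" if v: "v \<in> cone U" "v $ i \<noteq> 0" for v i j
  proof -
    have "v $ (SOME i. v $ i \<noteq> 0) \<noteq> 0" by (rule someI[of _ i]) (rule v(2))
    then show ?thesis unfolding cone_coeff_def Let_def by (rule *[OF v(1,2)])
  qed
  show sect: "sect (int m) U (cone_coeff m t j)" for j
  proof (rule sect_local)
    fix p assume p: "p \<in> U"
    obtain i where i: "p \<in> chart i" using ex_chart by blast
    let ?W = "U \<inter> chart i"
    have oW: "open ?W" using U by auto
    have "regular_on ?W (t i j)" using ti[of i] unfolding sec_T_sheaf by blast
    then have "sect (int m) ?W (\<lambda>v. v $ i ^ m * t i j (pt v))"
      unfolding regular_on_iff_sect by (rule sect_times_coord_power[OF _ oW]) simp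
    then have "sect (int m) ?W (cone_coeff m t j)"
      by (subst sect_cong[OF eq]) (auto simp: cone_Int cone_chart)
    then show "\<exists>V. open V \<and> p \<in> V \<and> V \<subseteq> U \<and> sect (int m) V (cone_coeff m t j)" using oW p i by blast
  qed
  show "(\<Sum>i\<in>UNIV. pd i f v * cone_coeff m t i v) = 0 \<and> (\<Sum>i\<in>UNIV. pd i g v * cone_coeff m t i v) = 0" if v: "v \<in> cone U"
  proof -
    have "v \<noteq> 0" using v by (simp add: cone_def)
    then obtain i where i: "v $ i \<noteq> 0" by (auto simp: vec_eq_iff)
    have "(\<Sum>j\<in>UNIV. pd j h v * cone_coeff m t j v) = v $ i ^ m * (\<Sum>j\<in>UNIV. pd j h v * t i j (pt v))" for h
      unfolding eq[OF v i] sum_distrib_left by (intro sum.cong) auto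
    moreover have "v \<in> cone (U \<inter> chart i)" using v i by (simp add: cone_Int cone_chart)
    ultimately show ?thesis using ti[of i] unfolding sec_T_sheaf by simp
  qed
  show "t = of_cone_coeff m (cone_coeff m t) U"
  proof (intro ext)
    fix i j p
    show "t i j p = of_cone_coeff m (cone_coeff m t) U i j p"
    proof (cases "p \<in> U \<inter> chart i")
      case True
      then have "rep_proj3 p \<in> cone U" "rep_proj3 p $ i \<noteq> 0" by (auto simp: in_chart_iff)
      from eq[OF this] this True show ?thesis by (simp add: of_cone_coeff_def)
    next
      case False
      have "t i j \<in> extensional (U \<inter> chart i)" using ti[of i] unfolding sec_T_sheaf by blast
      with False show ?thesis by (auto simp: of_cone_coeff_def extensional_def)
    qed
  qed
qed

section \<open>Differential forms\<close>

text \<open>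
  The local condition on a section \<open>\<omega>\<close> in the definition of \<open>Omega1\<close>.
\<close>

definition locally_form :: "'a::field proj3 set \<Rightarrow> ('a proj3 \<Rightarrow> (('a proj3 \<Rightarrow> 'a) \<Rightarrow> 'a) \<Rightarrow> 'a) \<Rightarrow> 'a proj3 \<Rightarrow> bool" where
  "locally_form U \<omega> p \<longleftrightarrow> (\<exists>V n a b. open V \<and> p \<in> V \<and> V \<subseteq> U \<and>
     (\<forall>j<n::nat. regular_on V (a j) \<and> regular_on V (b j)) \<and>
     (\<forall>q\<in>V. \<forall>D\<in>tangent_space q. \<omega> q D = (\<Sum>j<n. a j q * D (b j))))"

lemma Omega1_simps:
  "\<omega> \<oplus>\<^bsub>sections Omega1 U\<^esub> \<eta> = (\<lambda>p\<in>U. \<lambda>D\<in>tangent_space p. \<omega> p D + \<eta> p D)"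
  "\<zero>\<^bsub>sections Omega1 U\<^esub> = (\<lambda>p\<in>U. \<lambda>D\<in>tangent_space p. 0)"
  "a \<odot>\<^bsub>sections Omega1 U\<^esub> \<omega> = (\<lambda>p\<in>U. \<lambda>D\<in>tangent_space p. a p * \<omega> p D)"
  "res Omega1 U V \<omega> = restrict \<omega> V"
  by (simp_all add: Omega1_def mk_module_def)

lemma sec_Omega1: "\<omega> \<in> sec Omega1 U \<longleftrightarrow> \<omega> \<in> extensional U \<and>
    (\<forall>p\<in>U. \<omega> p \<in> extensional (tangent_space p) \<and> locally_form U \<omega> p)"
  by (simp add: Omega1_def mk_module_def locally_form_def)

lemma locally_formI:
  fixes n :: nat
  assumes "open V" "p \<in> V" "V \<subseteq> U"
    "\<And>j. j < n \<Longrightarrow> regular_on V (a j)" "\<And>j. j < n \<Longrightarrow> regular_on V (b j)"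
    "\<And>q D. q \<in> V \<Longrightarrow> D \<in> tangent_space q \<Longrightarrow> \<omega> q D = (\<Sum>j<n. a j q * D (b j))"
  shows "locally_form U \<omega> p"
  unfolding locally_form_def
  by (rule exI[of _ V], rule exI[of _ n], rule exI[of _ a], rule exI[of _ b]) (use assms in auto)

lemma locally_form_add:
  assumes "locally_form U \<omega> p" "locally_form U \<eta> p"
  shows "locally_form U (\<lambda>p\<in>U. \<lambda>D\<in>tangent_space p. \<omega> p D + \<eta> p D) p"
proof -
  obtain V n a b where V: "open V" "p \<in> V" "V \<subseteq> U" "\<forall>j<n::nat. regular_on V (a j) \<and> regular_on V (b j)"
     "\<forall>q\<in>V. \<forall>D\<in>tangent_space q. \<omega> q D = (\<Sum>j<n. a j q * D (b j))"
    using assms(1) unfolding locally_form_def by (elim exE conjE) (rule that)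
  obtain V' n' a' b' where V': "open V'" "p \<in> V'" "V' \<subseteq> U" "\<forall>j<n'::nat. regular_on V' (a' j) \<and> regular_on V' (b' j)"
     "\<forall>q\<in>V'. \<forall>D\<in>tangent_space q. \<eta> q D = (\<Sum>j<n'. a' j q * D (b' j))"
    using assms(2) unfolding locally_form_def by (elim exE conjE) (rule that)
  have oV: "open (V \<inter> V')" using V V' by blast
  have split: "(\<Sum>j<n + n'. h j) = (\<Sum>j<n. h j) + (\<Sum>j<n'. h (n + j))" for h :: "nat \<Rightarrow> 'a"
    by (induction n') (simp_all add: add.assoc)
  show ?thesis
  proof (rule locally_formI[where V = "V \<inter> V'" and n = "n + n'" and a = "\<lambda>j. if j < n then a j else a' (j - n)"
        and b = "\<lambda>j. if j < n then b j else b' (j - n)"])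
    show "regular_on (V \<inter> V') (if j < n then a j else a' (j - n))" if "j < n + n'" for j
      using that V(4) V'(4)[rule_format, of "j - n"] oV less_diff_conv2[of n j n']
      by (auto intro: regular_on_mono simp: not_less add.commute)
    show "regular_on (V \<inter> V') (if j < n then b j else b' (j - n))" if "j < n + n'" for j
      using that V(4) V'(4)[rule_format, of "j - n"] oV less_diff_conv2[of n j n']
      by (auto intro: regular_on_mono simp: not_less add.commute)
    fix q D assume qD: "q \<in> V \<inter> V'" "D \<in> tangent_space q"
    have "q \<in> U" using qD V(3) by blast
    with qD V(5) V'(5) show "(\<lambda>p\<in>U. \<lambda>D\<in>tangent_space p. \<omega> p D + \<eta> p D) q D =
        (\<Sum>j<n + n'. (if j < n then a j else a' (j - n)) q * D (if j < n then b j else b' (j - n)))"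
      unfolding split by simp
  qed (use V V' oV in auto)
qed

lemma locally_form_smult:
  assumes "locally_form U \<omega> p" "regular_on U c"
  shows "locally_form U (\<lambda>p\<in>U. \<lambda>D\<in>tangent_space p. c p * \<omega> p D) p"
proof -
  obtain V n a b where V: "open V" "p \<in> V" "V \<subseteq> U" "\<forall>j<n::nat. regular_on V (a j) \<and> regular_on V (b j)"
     "\<forall>q\<in>V. \<forall>D\<in>tangent_space q. \<omega> q D = (\<Sum>j<n. a j q * D (b j))"
    using assms(1) unfolding locally_form_def by (elim exE conjE) (rule that)
  show ?thesis
  proof (rule locally_formI[OF V(1-3), where n = n and a = "\<lambda>j q. c q * a j q" and b = b])
    show "regular_on V (\<lambda>q. c q * a j q)" if "j < n" for j
      using V(4) that by (intro regular_on_mult V(1) regular_on_mono[OF assms(2) V(1,3)]) auto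
    fix q D assume qD: "q \<in> V" "D \<in> tangent_space q"
    have "q \<in> U" using qD V(3) by blast
    with qD V(5) show "(\<lambda>p\<in>U. \<lambda>D\<in>tangent_space p. c p * \<omega> p D) q D = (\<Sum>j<n. c q * a j q * D (b j))"
      by (simp add: sum_distrib_left mult.assoc)
  qed (use V(4) in auto)
qed

lemma locally_form_restrict:
  assumes "locally_form U \<omega> p" "open W" "p \<in> W"
  shows "locally_form W (restrict \<omega> W) p"
proof -
  obtain V n a b where V: "open V" "p \<in> V" "V \<subseteq> U" "\<forall>j<n::nat. regular_on V (a j) \<and> regular_on V (b j)"
     "\<forall>q\<in>V. \<forall>D\<in>tangent_space q. \<omega> q D = (\<Sum>j<n. a j q * D (b j))"
    using assms(1) unfolding locally_form_def by (elim exE conjE) (rule that)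
  have oV: "open (V \<inter> W)" using V assms by blast
  show ?thesis
    by (rule locally_formI[OF oV, where n = n and a = a and b = b])
       (use V assms oV in \<open>auto intro: regular_on_mono\<close>)
qed

lemma module_Omega1:
  assumes U: "open U"
  shows "Module.module (structure_ring U) (sections Omega1 U)"
proof -
  have add: "(\<lambda>p\<in>U. \<lambda>D\<in>tangent_space p. \<omega> p D + \<eta> p D) \<in> sec Omega1 U"
    if "\<omega> \<in> sec Omega1 U" "\<eta> \<in> sec Omega1 U" for \<omega> \<eta>
    using that unfolding sec_Omega1 by (auto intro: locally_form_add)
  have smult: "(\<lambda>p\<in>U. \<lambda>D\<in>tangent_space p. c p * \<omega> p D) \<in> sec Omega1 U"
    if "regular_on U c" "\<omega> \<in> sec Omega1 U" for \<omega> c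
    using that unfolding sec_Omega1 by (auto intro: locally_form_smult)
  have zero: "(\<lambda>p\<in>U. \<lambda>D\<in>tangent_space p. 0) \<in> sec Omega1 U"
    unfolding sec_Omega1 by (auto intro!: locally_formI[OF U, where n = 0])
  have ext: "\<omega> p = undefined" if "\<omega> \<in> sec Omega1 U" "p \<notin> U" for \<omega> p
    using that unfolding sec_Omega1 by (auto simp: extensional_def)
  have ext2: "\<omega> p D = undefined" if "\<omega> \<in> sec Omega1 U" "p \<in> U" "D \<notin> tangent_space p" for \<omega> p D
    using that unfolding sec_Omega1 by (auto simp: extensional_def)
  show ?thesis
  proof (rule moduleI)
    show "cring (structure_ring U)" by (rule cring_structure_ring[OF U])
    show "abelian_group (sections Omega1 U)"
    proof (rule abelian_groupI, goal_cases)
      case (1 x y) then show ?case by (simp add: Omega1_simps add)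
    next
      case 2 show ?case by (simp add: Omega1_simps zero)
    next
      case (3 x y z) show ?case by (auto simp: Omega1_simps fun_eq_iff restrict_def)
    next
      case (4 x y) show ?case by (auto simp: Omega1_simps fun_eq_iff restrict_def)
    next
      case (5 x) then show ?case by (auto simp: Omega1_simps fun_eq_iff restrict_def ext ext2)
    next
      case (6 x)
      show ?case
        by (rule bexI[OF _ smult[OF regular_on_const[OF U, of "-1"] 6]])
           (auto simp: Omega1_simps fun_eq_iff restrict_def)
    qed
    fix a b x y
    assume x: "x \<in> sec Omega1 U"
    show "\<one>\<^bsub>structure_ring U\<^esub> \<odot>\<^bsub>sections Omega1 U\<^esub> x = x"
      using ext[OF x] ext2[OF x] by (auto simp: Omega1_simps fun_eq_iff restrict_def)
    show "(a \<oplus>\<^bsub>structure_ring U\<^esub> b) \<odot>\<^bsub>sections Omega1 U\<^esub> x =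
        a \<odot>\<^bsub>sections Omega1 U\<^esub> x \<oplus>\<^bsub>sections Omega1 U\<^esub> b \<odot>\<^bsub>sections Omega1 U\<^esub> x"
      by (auto simp: Omega1_simps fun_eq_iff restrict_def algebra_simps)
    show "(a \<otimes>\<^bsub>structure_ring U\<^esub> b) \<odot>\<^bsub>sections Omega1 U\<^esub> x =
        a \<odot>\<^bsub>sections Omega1 U\<^esub> (b \<odot>\<^bsub>sections Omega1 U\<^esub> x)"
      by (auto simp: Omega1_simps fun_eq_iff restrict_def algebra_simps)
    show "a \<odot>\<^bsub>sections Omega1 U\<^esub> (x \<oplus>\<^bsub>sections Omega1 U\<^esub> y) =
        a \<odot>\<^bsub>sections Omega1 U\<^esub> x \<oplus>\<^bsub>sections Omega1 U\<^esub> a \<odot>\<^bsub>sections Omega1 U\<^esub> y"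
      by (auto simp: Omega1_simps fun_eq_iff restrict_def algebra_simps)
    assume "a \<in> carrier (structure_ring U)"
    then show "a \<odot>\<^bsub>sections Omega1 U\<^esub> x \<in> sec Omega1 U"
      using smult[OF _ x] by (simp add: Omega1_simps)
  qed
qed

lemma presheaf_Omega1: "presheaf_of_modules Omega1"
  unfolding presheaf_of_modules_def
proof (intro conjI allI impI ballI)
  fix U V :: "'a proj3 set" assume UV: "open U \<and> open V \<and> V \<subseteq> U"
  show "res Omega1 U V \<in> sec Omega1 U \<rightarrow> sec Omega1 V"
  proof
    fix s :: "'a proj3 \<Rightarrow> (('a proj3 \<Rightarrow> 'a) \<Rightarrow> 'a) \<Rightarrow> 'a" assume s: "s \<in> sec Omega1 U"
    show "res Omega1 U V s \<in> sec Omega1 V"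
      using s UV unfolding sec_Omega1 Omega1_simps
      by (auto intro: locally_form_restrict)
  qed
  fix s t :: "'a proj3 \<Rightarrow> (('a proj3 \<Rightarrow> 'a) \<Rightarrow> 'a) \<Rightarrow> 'a"
  assume "s \<in> sec Omega1 U" "t \<in> sec Omega1 U"
  show "res Omega1 U V (s \<oplus>\<^bsub>sections Omega1 U\<^esub> t) =
      res Omega1 U V s \<oplus>\<^bsub>sections Omega1 V\<^esub> res Omega1 U V t"
    using UV by (auto simp: Omega1_simps fun_eq_iff restrict_def)
next
  fix U V :: "'a proj3 set" and a and s :: "'a proj3 \<Rightarrow> (('a proj3 \<Rightarrow> 'a) \<Rightarrow> 'a) \<Rightarrow> 'a"
  assume UV: "open U \<and> open V \<and> V \<subseteq> U"
  then show "res Omega1 U V (a \<odot>\<^bsub>sections Omega1 U\<^esub> s) =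
      restrict a V \<odot>\<^bsub>sections Omega1 V\<^esub> res Omega1 U V s"
    by (auto simp: Omega1_simps fun_eq_iff restrict_def)
next
  fix U :: "'a proj3 set" and s :: "'a proj3 \<Rightarrow> (('a proj3 \<Rightarrow> 'a) \<Rightarrow> 'a) \<Rightarrow> 'a"
  assume "s \<in> sec Omega1 U"
  then show "res Omega1 U U s = s"
    unfolding sec_Omega1 Omega1_simps by (simp add: extensional_restrict)
next
  fix U V W :: "'a proj3 set" and s :: "'a proj3 \<Rightarrow> (('a proj3 \<Rightarrow> 'a) \<Rightarrow> 'a) \<Rightarrow> 'a"
  assume "open U \<and> open V \<and> open W \<and> W \<subseteq> V \<and> V \<subseteq> U"
  then show "res Omega1 V W (res Omega1 U V s) = res Omega1 U W s"
    by (simp add: Omega1_simps Int_absorb1)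
qed (rule module_Omega1)

interpretation Omega1: module_presheaf "Omega1 :: ('a::field, 'a proj3 \<Rightarrow> (('a proj3 \<Rightarrow> 'a) \<Rightarrow> 'a) \<Rightarrow> 'a) presheaf"
  by unfold_locales (rule presheaf_Omega1)

text \<open>
  A form is determined by its values \<open>\<omega> (Dir v l)\<close>, which are the coefficients of its pullback to the
  cone with respect to the differentials of the coordinates. They have degree \<open>-1\<close>, and contraction
  with the Euler field gives zero.
\<close>

lemma Omega1_expansion:
  fixes \<omega> :: "'a::field_char_0 proj3 \<Rightarrow> (('a proj3 \<Rightarrow> 'a) \<Rightarrow> 'a) \<Rightarrow> 'a"
  assumes U: "open U" and \<omega>: "\<omega> \<in> sec Omega1 U"
  shows sect_Omega1_Dir: "sect (-1) U (\<lambda>v. \<omega> (pt v) (Dir v l))"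
    and Omega1_Dir_euler: "v \<in> cone U \<Longrightarrow> (\<Sum>l\<in>UNIV. v $ l * \<omega> (pt v) (Dir v l)) = 0"
    and Omega1_eq_Dir: "v \<in> cone U \<Longrightarrow> v $ i \<noteq> 0 \<Longrightarrow> D \<in> tangent_space (pt v) \<Longrightarrow>
      \<omega> (pt v) D = (\<Sum>l\<in>UNIV. v $ i * D (coord i l) * \<omega> (pt v) (Dir v l))"
proof -
  have form: "\<exists>V n a b. open V \<and> p \<in> V \<and> V \<subseteq> U \<and>
     (\<forall>j<n::nat. regular_on V (a j) \<and> regular_on V (b j)) \<and>
     (\<forall>q\<in>V. \<forall>D\<in>tangent_space q. \<omega> q D = (\<Sum>j<n. a j q * D (b j)))" if "p \<in> U" for p
    using \<omega> that unfolding sec_Omega1 locally_form_def by blast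
  show "sect (-1) U (\<lambda>v. \<omega> (pt v) (Dir v l))" for l
  proof (rule sect_local)
    fix p assume p: "p \<in> U"
    obtain V n a b where V: "open V" "p \<in> V" "V \<subseteq> U" "\<forall>j<n::nat. regular_on V (a j) \<and> regular_on V (b j)"
       "\<forall>q\<in>V. \<forall>D\<in>tangent_space q. \<omega> q D = (\<Sum>j<n. a j q * D (b j))"
      using form[OF p] by (elim exE conjE) (rule that)
    have "sect (0 + -1) V (\<lambda>v. a j (pt v) * Dir v l (b j))" if "j < n" for j
      using V(4) that by (intro sect_mult sect_Dir V(1)) (auto simp: regular_on_iff_sect)
    then have "sect (-1) V (\<lambda>v. \<Sum>j<n. a j (pt v) * Dir v l (b j))"
      by (intro sect_sum V(1)) auto
    then have "sect (-1) V (\<lambda>v. \<omega> (pt v) (Dir v l))"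
      by (rule iffD2[OF sect_cong, rotated]) (use V(5) Dir_in_tangent_space in \<open>auto simp: cone_def\<close>)
    then show "\<exists>V. open V \<and> p \<in> V \<and> V \<subseteq> U \<and> sect (-1) V (\<lambda>v. \<omega> (pt v) (Dir v l))" using V by blast
  qed
  fix v assume v: "v \<in> cone U"
  then have v0: "v \<noteq> 0" "pt v \<in> U" by (auto simp: cone_def)
  obtain V n a b where V: "open V" "pt v \<in> V" "V \<subseteq> U" "\<forall>j<n::nat. regular_on V (a j) \<and> regular_on V (b j)"
     "\<forall>q\<in>V. \<forall>D\<in>tangent_space q. \<omega> q D = (\<Sum>j<n. a j q * D (b j))"
    using form[OF v0(2)] by (elim exE conjE) (rule that)
  have b: "regular_at (pt v) (b j)" if "j < n" for j using V that by (auto simp: regular_at_def)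
  have Dl: "\<omega> (pt v) (Dir v l) = (\<Sum>j<n. a j (pt v) * Dir v l (b j))" for l
    using V(2,5) Dir_in_tangent_space[OF v0(1)] by blast
  have "(\<Sum>l\<in>UNIV. v $ l * \<omega> (pt v) (Dir v l)) = (\<Sum>j<n. a j (pt v) * (\<Sum>l\<in>UNIV. v $ l * Dir v l (b j)))"
    unfolding Dl sum_distrib_left by (subst sum.swap) (intro sum.cong refl mult.left_commute)
  also have "\<dots> = 0" using Dir_euler[OF v0(1) b] by simp
  finally show "(\<Sum>l\<in>UNIV. v $ l * \<omega> (pt v) (Dir v l)) = 0" .
  assume i: "v $ i \<noteq> 0" and D: "D \<in> tangent_space (pt v)"
  have "\<omega> (pt v) D = (\<Sum>j<n. a j (pt v) * D (b j))" using V(2,5) D by blast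
  also have "\<dots> = (\<Sum>j<n. a j (pt v) * (\<Sum>l\<in>UNIV. v $ i * D (coord i l) * Dir v l (b j)))"
    using tangent_expansion[OF i D b] by (intro sum.cong) auto
  also have "\<dots> = (\<Sum>l\<in>UNIV. v $ i * D (coord i l) * \<omega> (pt v) (Dir v l))"
    unfolding Dl sum_distrib_left by (subst sum.swap) (intro sum.cong refl mult.left_commute)
  finally show "\<omega> (pt v) D = (\<Sum>l\<in>UNIV. v $ i * D (coord i l) * \<omega> (pt v) (Dir v l))" .
qed

text \<open>
  The form \<open>\<Sum>\<^sub>l \<eta>\<^sub>l d(x\<^sub>l / x\<^sub>i)\<close>. If \<open>\<Sum>\<^sub>l x\<^sub>l \<eta>\<^sub>l = 0\<close>, it equals \<open>\<Sum>\<^sub>l \<eta>\<^sub>l dx\<^sub>l\<close> divided by \<open>x\<^sub>i\<close>.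
\<close>

definition chart_form :: "4 \<Rightarrow> (4 \<Rightarrow> 'a::field ^ 4 \<Rightarrow> 'a) \<Rightarrow> 'a proj3 set \<Rightarrow>
    'a proj3 \<Rightarrow> (('a proj3 \<Rightarrow> 'a) \<Rightarrow> 'a) \<Rightarrow> 'a" where
  "chart_form i \<eta> W = (\<lambda>p\<in>W. \<lambda>D\<in>tangent_space p. \<Sum>l\<in>UNIV. \<eta> l (rep_proj3 p) * D (coord i l))"

lemma chart_form_in_Omega1:
  assumes W: "open W" "W \<subseteq> chart i" and \<eta>: "\<And>l. sect 0 W (\<eta> l)"
  shows "chart_form i \<eta> W \<in> sec Omega1 W"
  unfolding sec_Omega1
proof (intro conjI ballI)
  show "chart_form i \<eta> W \<in> extensional W" by (simp add: chart_form_def)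
  fix p assume p: "p \<in> W"
  then show "chart_form i \<eta> W p \<in> extensional (tangent_space p)" by (simp add: chart_form_def)
  show "locally_form W (chart_form i \<eta> W) p"
  proof (rule locally_formI[OF W(1) p, where n = 4 and a = "\<lambda>j q. \<eta> (of_nat j) (rep_proj3 q)"
        and b = "\<lambda>j. coord i (of_nat j)"])
    show "regular_on W (\<lambda>q. \<eta> (of_nat j) (rep_proj3 q))" for j by (rule regular_on_rep[OF \<eta>])
    show "regular_on W (coord i (of_nat j))" for j by (rule regular_on_coord[OF W])
    show "chart_form i \<eta> W q D = (\<Sum>j<4. \<eta> (of_nat j) (rep_proj3 q) * D (coord i (of_nat j)))"
      if "q \<in> W" "D \<in> tangent_space q" for q D
      using that by (simp add: chart_form_def sum_4 eval_nat_numeral)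
  qed simp
qed

lemma chart_form_Dir:
  fixes \<eta> :: "4 \<Rightarrow> 'a::field_char_0 ^ 4 \<Rightarrow> 'a"
  assumes \<eta>: "\<And>l. sect 0 W (\<eta> l)" and eul: "\<And>v. v \<in> cone W \<Longrightarrow> (\<Sum>l\<in>UNIV. v $ l * \<eta> l v) = 0"
    and v: "v \<in> cone W" "v $ i \<noteq> 0"
  shows "chart_form i \<eta> W (pt v) (Dir v l) = \<eta> l v / v $ i"
proof -
  have v0: "v \<noteq> 0" "pt v \<in> W" using v by (auto simp: cone_def)
  have "chart_form i \<eta> W (pt v) (Dir v l) = (\<Sum>j\<in>UNIV. \<eta> j v * Dir v l (coord i j))"
    using v0 Dir_in_tangent_space[OF v0(1)] by (simp add: chart_form_def sect_0_rep[OF \<eta> v(1)])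
  also have "\<dots> = (\<Sum>j\<in>UNIV. (if j = l then \<eta> l v / v $ i else 0) - (if i = l then 1 else 0) / (v $ i)\<^sup>2 * (v $ j * \<eta> j v))"
    unfolding Dir_coord[OF v(2)] using v(2)
    by (intro sum.cong) (auto simp: field_simps power2_eq_square)
  also have "\<dots> = \<eta> l v / v $ i"
    by (auto simp: sum_subtractf eul[OF v(1)] simp flip: sum_distrib_left sum_divide_distrib)
  finally show ?thesis .
qed

text \<open>
  A section of \<open>\<Omega>(1)\<close> with components \<open>b\<^sub>i\<close> corresponds to the form \<open>x\<^sub>i b\<^sub>i\<close> on the cone; these are its
  coefficients, which do not depend on \<open>i\<close>.
\<close>

definition form_coeff :: "(4 \<Rightarrow> 'a::field proj3 \<Rightarrow> (('a proj3 \<Rightarrow> 'a) \<Rightarrow> 'a) \<Rightarrow> 'a) \<Rightarrow> 4 \<Rightarrow> 'a ^ 4 \<Rightarrow> 'a" where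
  "form_coeff b l v = (let i = SOME i. v $ i \<noteq> 0 in v $ i * b i (pt v) (Dir v l))"

definition of_form_coeff :: "(4 \<Rightarrow> 'a::field ^ 4 \<Rightarrow> 'a) \<Rightarrow> 'a proj3 set \<Rightarrow>
    4 \<Rightarrow> 'a proj3 \<Rightarrow> (('a proj3 \<Rightarrow> 'a) \<Rightarrow> 'a) \<Rightarrow> 'a" where
  "of_form_coeff \<eta> U = (\<lambda>i. chart_form i \<eta> (U \<inter> chart i))"

lemma of_form_coeff_in_twist:
  fixes \<eta> :: "4 \<Rightarrow> 'a::field_char_0 ^ 4 \<Rightarrow> 'a"
  assumes U: "open U" and \<eta>: "\<And>l. sect 0 U (\<eta> l)" and eul: "\<And>v. v \<in> cone U \<Longrightarrow> (\<Sum>l\<in>UNIV. v $ l * \<eta> l v) = 0"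
  shows "of_form_coeff \<eta> U \<in> sec (twist 1 Omega1) U"
  unfolding sec_twist
proof (intro conjI allI)
  have oW: "open (U \<inter> chart i)" for i using U by auto
  have \<eta>W: "sect 0 (U \<inter> chart i) (\<eta> l)" for i l by (rule sect_mono[OF \<eta> oW]) blast
  have eulW: "(\<Sum>l\<in>UNIV. v $ l * \<eta> l v) = 0" if "v \<in> cone (U \<inter> chart i)" for i v
    using eul that by (simp add: cone_Int)
  show sec: "of_form_coeff \<eta> U i \<in> sec Omega1 (U \<inter> chart i)" for i
    unfolding of_form_coeff_def by (rule chart_form_in_Omega1[OF oW _ \<eta>W]) blast
  fix i j
  let ?W = "U \<inter> chart i \<inter> chart j"
  show "res Omega1 (U \<inter> chart j) ?W (of_form_coeff \<eta> U j) =
     restrict (transition 1 i j) ?W \<odot>\<^bsub>sections Omega1 ?W\<^esub> res Omega1 (U \<inter> chart i) ?W (of_form_coeff \<eta> U i)"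
  proof (intro ext)
    fix p D
    show "res Omega1 (U \<inter> chart j) ?W (of_form_coeff \<eta> U j) p D =
       (restrict (transition 1 i j) ?W \<odot>\<^bsub>sections Omega1 ?W\<^esub> res Omega1 (U \<inter> chart i) ?W (of_form_coeff \<eta> U i)) p D"
    proof (cases "p \<in> ?W \<and> D \<in> tangent_space p")
      case True
      let ?v = "rep_proj3 p"
      have v: "?v \<in> cone (U \<inter> chart i)" "?v \<in> cone (U \<inter> chart j)" "?v $ i \<noteq> 0" "?v $ j \<noteq> 0" "?v \<in> cone U"
        using True by (auto simp: in_chart_iff)
      have D: "D \<in> tangent_space (pt ?v)" using True by simp
      have "of_form_coeff \<eta> U i p D = (\<Sum>l\<in>UNIV. ?v $ j * D (coord j l) * of_form_coeff \<eta> U i p (Dir ?v l))"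
        using Omega1_eq_Dir[OF oW sec v(1,4) D] by simp
      also have "\<dots> = (\<Sum>l\<in>UNIV. ?v $ j * D (coord j l) * (\<eta> l ?v / ?v $ i))"
        using chart_form_Dir[OF \<eta>W eulW v(1,3)] by (simp add: of_form_coeff_def)
      also have "\<dots> = ?v $ j / ?v $ i * of_form_coeff \<eta> U j p D"
        using True by (simp add: of_form_coeff_def chart_form_def sum_distrib_left mult_ac)
      finally show ?thesis
        using True v by (simp add: Omega1_simps transition_def)
    next
      case False
      then show ?thesis
        by (auto simp: Omega1_simps of_form_coeff_def chart_form_def restrict_def)
    qed
  qed
qed

text \<open>
  The Euler sequence: together with \<open>of_form_coeff_in_twist\<close> and \<open>form_coeff_of_form_coeff\<close> this
  identifies the sections of \<open>\<Omega>(1)\<close> with the vectors \<open>\<eta>\<close> of functions of degree 0 on the cone that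
  satisfy \<open>\<Sum>\<^sub>l x\<^sub>l \<eta>\<^sub>l = 0\<close>.
\<close>

lemma twist_Omega1_cone:
  fixes b :: "4 \<Rightarrow> 'a::field_char_0 proj3 \<Rightarrow> (('a proj3 \<Rightarrow> 'a) \<Rightarrow> 'a) \<Rightarrow> 'a"
  assumes U: "open U" and b: "b \<in> sec (twist 1 Omega1) U"
  shows form_coeff_eq: "v \<in> cone U \<Longrightarrow> v $ i \<noteq> 0 \<Longrightarrow> form_coeff b l v = v $ i * b i (pt v) (Dir v l)"
    and sect_form_coeff: "sect 0 U (form_coeff b l)"
    and form_coeff_euler: "v \<in> cone U \<Longrightarrow> (\<Sum>l\<in>UNIV. v $ l * form_coeff b l v) = 0"
    and of_form_coeff_form_coeff: "b = of_form_coeff (form_coeff b) U"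
proof -
  have oW: "open (U \<inter> chart i)" for i using U by auto
  have bi: "b i \<in> sec Omega1 (U \<inter> chart i)" for i using b unfolding sec_twist by blast
  have glue: "b j p D = transition 1 i j p * b i p D"
    if "p \<in> U" "p \<in> chart i" "p \<in> chart j" "D \<in> tangent_space p" for i j p D
  proof -
    let ?W = "U \<inter> chart i \<inter> chart j"
    have "res Omega1 (U \<inter> chart j) ?W (b j) =
      restrict (transition 1 i j) ?W \<odot>\<^bsub>sections Omega1 ?W\<^esub> res Omega1 (U \<inter> chart i) ?W (b i)"
      using b unfolding sec_twist by blast
    from fun_cong[OF fun_cong[OF this, of p], of D] that show ?thesis
      unfolding Omega1_simps by simp
  qed
  have *: "v $ j * b j (pt v) D = v $ i * b i (pt v) D"
    if v: "v \<in> cone U" "v $ i \<noteq> 0" "v $ j \<noteq> 0" and D: "D \<in> tangent_space (pt v)" for v i j D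
  proof -
    have v0: "v \<noteq> 0" "pt v \<in> U" using v by (auto simp: cone_def)
    obtain c where c: "c \<noteq> 0" "rep_proj3 (pt v) = c *s v" using rep_pt[OF v0(1)] by blast
    have "transition 1 i j (pt v) = v $ i / v $ j" using c by (simp add: transition_def)
    moreover have "b j (pt v) D = transition 1 i j (pt v) * b i (pt v) D"
      by (rule glue) (use v v0 D in \<open>auto simp: pt_in_chart\<close>)
    ultimately show ?thesis using v by simp
  qed
  show eq: "form_coeff b l v = v $ i * b i (pt v) (Dir v l)" if v: "v \<in> cone U" "v $ i \<noteq> 0" for v i l
  proof -
    have "v $ (SOME i. v $ i \<noteq> 0) \<noteq> 0" by (rule someI[of _ i]) (rule v(2))
    moreover have "Dir v l \<in> tangent_space (pt v)" using v by (intro Dir_in_tangent_space) auto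
    ultimately show ?thesis unfolding form_coeff_def Let_def by (intro *[OF v(1,2)])
  qed
  show sect: "sect 0 U (form_coeff b l)" for l
  proof (rule sect_local)
    fix p assume p: "p \<in> U"
    obtain i where i: "p \<in> chart i" using ex_chart by blast
    let ?W = "U \<inter> chart i"
    have "sect 0 ?W (\<lambda>v. v $ i * b i (pt v) (Dir v l))"
      by (rule sect_times_coord[OF sect_Omega1_Dir[OF oW bi] oW]) simp
    then have "sect 0 ?W (form_coeff b l)"
      by (subst sect_cong[OF eq]) (auto simp: cone_Int cone_chart)
    then show "\<exists>V. open V \<and> p \<in> V \<and> V \<subseteq> U \<and> sect 0 V (form_coeff b l)" using oW p i by blast
  qed
  show "(\<Sum>l\<in>UNIV. v $ l * form_coeff b l v) = 0" if v: "v \<in> cone U" for v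
  proof -
    have "v \<noteq> 0" using v by (simp add: cone_def)
    then obtain i where i: "v $ i \<noteq> 0" by (auto simp: vec_eq_iff)
    have "(\<Sum>l\<in>UNIV. v $ l * form_coeff b l v) = v $ i * (\<Sum>l\<in>UNIV. v $ l * b i (pt v) (Dir v l))"
      unfolding eq[OF v i] sum_distrib_left by (intro sum.cong) auto
    moreover have "v \<in> cone (U \<inter> chart i)" using v i by (simp add: cone_Int cone_chart)
    ultimately show ?thesis using Omega1_Dir_euler[OF oW bi] by simp
  qed
  show "b = of_form_coeff (form_coeff b) U"
  proof (intro ext)
    fix i p D
    show "b i p D = of_form_coeff (form_coeff b) U i p D"
    proof (cases "p \<in> U \<inter> chart i")
      case p: True
      let ?v = "rep_proj3 p"
      have v: "?v \<in> cone U" "?v $ i \<noteq> 0" "?v \<in> cone (U \<inter> chart i)" using p by (auto simp: in_chart_iff)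
      show ?thesis
      proof (cases "D \<in> tangent_space p")
        case True
        then have "b i p D = (\<Sum>l\<in>UNIV. ?v $ i * D (coord i l) * b i p (Dir ?v l))"
          using Omega1_eq_Dir[OF oW bi v(3,2), of D] by simp
        with p True show ?thesis
          by (simp add: of_form_coeff_def chart_form_def eq[OF v(1,2)] mult_ac)
      next
        case False
        then show ?thesis using bi[of i] p unfolding sec_Omega1
          by (auto simp: of_form_coeff_def chart_form_def extensional_def)
      qed
    next
      case False
      have "b i \<in> extensional (U \<inter> chart i)" using bi[of i] unfolding sec_Omega1 by blast
      with False show ?thesis by (auto simp: of_form_coeff_def chart_form_def extensional_def)
    qed
  qed
qed

lemma form_coeff_of_form_coeff:
  fixes \<eta> :: "4 \<Rightarrow> 'a::field_char_0 ^ 4 \<Rightarrow> 'a"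
  assumes U: "open U" and \<eta>: "\<And>l. sect 0 U (\<eta> l)" and eul: "\<And>v. v \<in> cone U \<Longrightarrow> (\<Sum>l\<in>UNIV. v $ l * \<eta> l v) = 0"
    and v: "v \<in> cone U"
  shows "form_coeff (of_form_coeff \<eta> U) l v = \<eta> l v"
proof -
  have "v \<noteq> 0" using v by (simp add: cone_def)
  then obtain i where i: "v $ i \<noteq> 0" by (auto simp: vec_eq_iff)
  have oW: "open (U \<inter> chart i)" using U by auto
  have "chart_form i \<eta> (U \<inter> chart i) (pt v) (Dir v l) = \<eta> l v / v $ i"
    by (rule chart_form_Dir[OF sect_mono[OF \<eta> oW]])
       (use eul v i in \<open>auto simp: cone_Int cone_chart\<close>)
  then show ?thesis
    using form_coeff_eq[OF U of_form_coeff_in_twist[OF U \<eta> eul] v i] i by (simp add: of_form_coeff_def)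
qed

section \<open>The null correlation bundle\<close>

lemma peval_diff: "peval (F - G) v = peval F v - peval G v"
  using peval_add[of "F - G" G v] by simp

definition ratio :: "nat \<Rightarrow> 'a::field_char_0" where
  "ratio k = of_nat (k + 2) / of_nat (k + 1)"

lemma of_nat_plus_nonzero: "of_nat (k + 1) \<noteq> (0::'a::field_char_0)" "of_nat (k + 2) \<noteq> (0::'a::field_char_0)"
    "of_nat (k + 3) \<noteq> (0::'a::field_char_0)"
  by (simp_all del: of_nat_add of_nat_Suc add: of_nat_eq_0_iff)

lemma ratio_nonzero: "ratio k \<noteq> (0::'a::field_char_0)"
  unfolding ratio_def divide_eq_0_iff using of_nat_plus_nonzero(1,2)[of k, where 'a = 'a] by blast

text \<open>
  The coefficients of the contact form \<open>r (y dx - x dy) + w dz - z dw\<close>, where \<open>r\<close> is \<open>ratio k\<close>.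
\<close>

definition contact :: "nat \<Rightarrow> 'a::field_char_0 ^ 4 \<Rightarrow> 4 \<Rightarrow> 'a" where
  "contact k v l = (if l = 0 then ratio k * v $ 1 else if l = 1 then - (ratio k * v $ 0)
     else if l = 2 then v $ 3 else - v $ 2)"

text \<open>
  The contractions of the form \<open>\<Sum>\<^sub>l e\<^sub>l dx\<^sub>l\<close> with the vector fields \<open>- z \<partial>\<^sub>y + r x \<partial>\<^sub>w\<close>, \<open>- (z / r) \<partial>\<^sub>x - y \<partial>\<^sub>w\<close>
  and \<open>(w / r) \<partial>\<^sub>x - y \<partial>\<^sub>z\<close>, the last one divided by \<open>k + 3\<close>. They all vanish on the contact form.
\<close>

definition quadA :: "nat \<Rightarrow> (4 \<Rightarrow> 'a::field_char_0) \<Rightarrow> 'a ^ 4 \<Rightarrow> 'a" where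
  "quadA k e v = - v $ 2 * e 1 + ratio k * v $ 0 * e 3"

definition quadT :: "nat \<Rightarrow> (4 \<Rightarrow> 'a::field_char_0) \<Rightarrow> 'a ^ 4 \<Rightarrow> 'a" where
  "quadT k e v = - v $ 2 * (e 0 / ratio k) - v $ 1 * e 3"

definition quadC :: "nat \<Rightarrow> (4 \<Rightarrow> 'a::field_char_0) \<Rightarrow> 'a ^ 4 \<Rightarrow> 'a" where
  "quadC k e v = (v $ 3 * (e 0 / ratio k) - v $ 1 * e 2) / of_nat (k + 3)"

text \<open>
  The parametrization of Jacobian syzygies from \<open>jacobian_syzygy_reduce\<close>, applied to the contractions of
  a form.
\<close>

definition syzygy :: "nat \<Rightarrow> (4 \<Rightarrow> 'a::field_char_0) \<Rightarrow> 'a ^ 4 \<Rightarrow> 4 \<Rightarrow> 'a" where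
  "syzygy k e v j =
     (if j = 0 then v $ 2 ^ (k + 1) * quadA k e v + ratio k * v $ 0 * v $ 1 ^ k * quadT k e v
        - of_nat (k + 2) * v $ 0 * v $ 1 ^ k * quadC k e v
      else if j = 1 then (v $ 2 ^ (k + 1) - v $ 1 ^ (k + 1)) * quadT k e v / of_nat (k + 1) + v $ 1 ^ (k + 1) * quadC k e v
      else if j = 2 then v $ 2 * v $ 1 ^ k * quadC k e v
      else v $ 3 * (v $ 1 ^ k * quadT k e v - of_nat (k + 2) * v $ 1 ^ k * quadC k e v))"

text \<open>
  With the quadrics \<open>y\<^sup>2\<close>, \<open>r x y + z w\<close> and \<open>z\<^sup>2\<close> as coefficients, the three vector fields add up to
  \<open>- y z\<close> times the Euler field.
\<close>

lemma quad_relation: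
  fixes v :: "'a::field_char_0 ^ 4"
  shows "(v $ 1)\<^sup>2 * quadA k e v + (ratio k * v $ 0 * v $ 1 + v $ 2 * v $ 3) * quadT k e v
     + of_nat (k + 3) * (v $ 2)\<^sup>2 * quadC k e v = - (v $ 1 * v $ 2 * (\<Sum>l\<in>UNIV. v $ l * e l))"
proof -
  have C: "of_nat (k + 3) * (v $ 2)\<^sup>2 * quadC k e v = (v $ 2)\<^sup>2 * (v $ 3 * (e 0 / ratio k) - v $ 1 * e 2)"
    unfolding quadC_def using of_nat_plus_nonzero(3)[of k] by (simp add: field_simps del: of_nat_add)
  define a where "a = e 0 / ratio k"
  have e0: "e 0 = ratio k * a" using ratio_nonzero[of k, where 'a = 'a] by (simp add: a_def)
  show ?thesis
    unfolding C unfolding quadA_def quadT_def a_def[symmetric] sum_4 e0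
    by (simp add: algebra_simps power2_eq_square)
qed

lemma syzygy_add: "syzygy k (\<lambda>l. e l + e' l) v j = syzygy k e v j + syzygy k e' v j"
proof -
  have "quadA k (\<lambda>l. e l + e' l) v = quadA k e v + quadA k e' v"
    "quadT k (\<lambda>l. e l + e' l) v = quadT k e v + quadT k e' v"
    "quadC k (\<lambda>l. e l + e' l) v = quadC k e v + quadC k e' v"
    by (simp_all add: quadA_def quadT_def quadC_def algebra_simps add_divide_distrib diff_divide_distrib)
  then show ?thesis by (simp add: syzygy_def algebra_simps add_divide_distrib diff_divide_distrib)
qed

lemma syzygy_scale: "syzygy k (\<lambda>l. c * e l) v j = c * syzygy k e v j"
proof -
  have "quadA k (\<lambda>l. c * e l) v = c * quadA k e v"
    "quadT k (\<lambda>l. c * e l) v = c * quadT k e v"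
    "quadC k (\<lambda>l. c * e l) v = c * quadC k e v"
    by (simp_all add: quadA_def quadT_def quadC_def algebra_simps)
  then show ?thesis by (simp add: syzygy_def algebra_simps)
qed

lemma syzygy_contact: "syzygy k (contact k v) v j = 0" for v :: "'a::field_char_0 ^ 4"
proof -
  have "quadA k (contact k v) v = 0" "quadT k (contact k v) v = 0" "quadC k (contact k v) v = 0"
    using ratio_nonzero[of k, where 'a = 'a] by (simp_all add: quadA_def quadT_def quadC_def contact_def)
  then show ?thesis by (simp add: syzygy_def)
qed

lemma contact_euler: "(\<Sum>l\<in>UNIV. v $ l * contact k v l) = 0"
  by (simp add: sum_4 contact_def)

lemma contact_nonzero: "v \<noteq> 0 \<Longrightarrow> \<exists>l. contact k v l \<noteq> 0" for v :: "'a::field_char_0 ^ 4"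
proof (rule ccontr)
  assume v: "v \<noteq> 0" and "\<nexists>l. contact k v l \<noteq> 0"
  then have "contact k v 0 = 0" "contact k v 1 = 0" "contact k v 2 = 0" "contact k v 3 = 0" by auto
  then have "\<forall>l. v $ l = 0" unfolding all_4 using ratio_nonzero[of k, where 'a = 'a] by (simp add: contact_def)
  then show False using v by (simp add: vec_eq_iff)
qed

lemma sect_contact: "open U \<Longrightarrow> sect 1 U (\<lambda>v. contact k v l)"
  unfolding contact_def
  by (cases "l = 0"; cases "l = 1"; cases "l = 2") (simp_all add: sect_cmult sect_coord sect_uminus)

lemma sect_quad:
  assumes U: "open U" and e: "\<And>l. sect 0 U (e l)"
  shows "sect 1 U (\<lambda>v. quadA k (\<lambda>l. e l v) v)" "sect 1 U (\<lambda>v. quadT k (\<lambda>l. e l v) v)"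
    "sect 1 U (\<lambda>v. quadC k (\<lambda>l. e l v) v)"
proof -
  have *: "sect 1 U (\<lambda>v. v $ i * e l v)" for i l by (rule sect_times_coord[OF e U]) simp
  have "sect 1 U (\<lambda>v. - 1 * (v $ 2 * e 1 v) + ratio k * (v $ 0 * e 3 v))"
    "sect 1 U (\<lambda>v. - (1 / ratio k) * (v $ 2 * e 0 v) - v $ 1 * e 3 v)"
    "sect 1 U (\<lambda>v. (1 / of_nat (k + 3)) * ((1 / ratio k) * (v $ 3 * e 0 v) - v $ 1 * e 2 v))"
    by (intro sect_add sect_diff sect_cmult * U)+
  then show "sect 1 U (\<lambda>v. quadA k (\<lambda>l. e l v) v)" "sect 1 U (\<lambda>v. quadT k (\<lambda>l. e l v) v)"
    "sect 1 U (\<lambda>v. quadC k (\<lambda>l. e l v) v)"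
    by (simp_all add: quadA_def quadT_def quadC_def mult.assoc)
qed

lemma sect_syzygy:
  assumes U: "open U" and e: "\<And>l. sect 0 U (e l)"
  shows "sect (int (k + 2)) U (\<lambda>v. syzygy k (\<lambda>l. e l v) v j)"
proof -
  note ATC = sect_quad[OF U e, of k]
  let ?A = "\<lambda>v. quadA k (\<lambda>l. e l v) v" and ?T = "\<lambda>v. quadT k (\<lambda>l. e l v) v" and ?C = "\<lambda>v. quadC k (\<lambda>l. e l v) v"
  have p: "sect (int (k + 2)) U (\<lambda>v. v $ i ^ (k + 1) * s v)" if "sect 1 U s" for i s
    by (rule sect_times_coord_power[OF that U]) simp
  have c: "sect (int (k + 2)) U (\<lambda>v. v $ i * (v $ 1 ^ k * s v))" if "sect 1 U s" for i s
    by (rule sect_times_coord[OF sect_times_coord_power[OF that U refl] U]) simp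
  have s0: "sect (int (k + 2)) U (\<lambda>v. v $ 2 ^ (k + 1) * ?A v + ratio k * (v $ 0 * (v $ 1 ^ k * ?T v))
        - of_nat (k + 2) * (v $ 0 * (v $ 1 ^ k * ?C v)))"
    by (intro sect_add sect_diff sect_cmult p c ATC U)
  have s1: "sect (int (k + 2)) U (\<lambda>v. (1 / of_nat (k + 1)) * (v $ 2 ^ (k + 1) * ?T v - v $ 1 ^ (k + 1) * ?T v)
      + v $ 1 ^ (k + 1) * ?C v)"
    by (intro sect_add sect_diff sect_cmult p c ATC U)
  have s2: "sect (int (k + 2)) U (\<lambda>v. v $ 2 * (v $ 1 ^ k * ?C v))"
    by (intro c ATC)
  have s3: "sect (int (k + 2)) U (\<lambda>v. v $ 3 * (v $ 1 ^ k * ?T v) - of_nat (k + 2) * (v $ 3 * (v $ 1 ^ k * ?C v)))"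
    by (intro sect_diff sect_cmult c ATC U)
  have "\<forall>j. sect (int (k + 2)) U (\<lambda>v. syzygy k (\<lambda>l. e l v) v j)"
    unfolding all_4
  proof (intro conjI)
    show "sect (int (k + 2)) U (\<lambda>v. syzygy k (\<lambda>l. e l v) v 0)"
      by (rule iffD1[OF sect_cong s0]) (simp add: syzygy_def mult.assoc)
    show "sect (int (k + 2)) U (\<lambda>v. syzygy k (\<lambda>l. e l v) v 1)"
      by (rule iffD1[OF sect_cong s1]) (simp add: syzygy_def left_diff_distrib)
    show "sect (int (k + 2)) U (\<lambda>v. syzygy k (\<lambda>l. e l v) v 2)"
      by (rule iffD1[OF sect_cong s2]) (simp add: syzygy_def mult.assoc)
    show "sect (int (k + 2)) U (\<lambda>v. syzygy k (\<lambda>l. e l v) v 3)"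
      by (rule iffD1[OF sect_cong s3]) (simp add: syzygy_def right_diff_distrib mult_ac)
  qed
  then show ?thesis by blast
qed

locale pencil =
  fixes k :: nat and f g :: "'a::field_char_0 poly4"
  assumes f: "f = X 0 * X 1 ^ (k + 2) + X 2 ^ (k + 3) + X 2 ^ (k + 2) * X 3"
    and g: "g = X 2 * X 3 * (X 2 ^ (k + 1) - X 1 ^ (k + 1))"
begin

lemma jacobian_f: "(\<Sum>i\<in>UNIV. pd i f v * \<beta> i) =
    v $ 1 ^ (k + 2) * \<beta> 0 + of_nat (k + 2) * v $ 0 * v $ 1 ^ (k + 1) * \<beta> 1 +
      (of_nat (k + 3) * v $ 2 ^ (k + 2) + of_nat (k + 2) * v $ 2 ^ (k + 1) * v $ 3) * \<beta> 2
      + v $ 2 ^ (k + 2) * \<beta> 3"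
  unfolding sum_4 f pd_add pd_mult pd_power pd_X
  by (simp add: peval_mult algebra_simps)

lemma jacobian_g: "(\<Sum>i\<in>UNIV. pd i g v * \<beta> i) =
    - of_nat (k + 1) * v $ 2 * v $ 3 * v $ 1 ^ k * \<beta> 1 +
      v $ 3 * (of_nat (k + 2) * v $ 2 ^ (k + 1) - v $ 1 ^ (k + 1)) * \<beta> 2
      + v $ 2 * (v $ 2 ^ (k + 1) - v $ 1 ^ (k + 1)) * \<beta> 3"
  unfolding sum_4 g pd_diff pd_mult pd_power pd_X
  by (simp add: peval_mult peval_diff algebra_simps)

lemma jacobian_syzygy:
  assumes "(\<Sum>l\<in>UNIV. v $ l * e l) = 0"
  shows "(\<Sum>i\<in>UNIV. pd i f v * syzygy k e v i) = 0 \<and> (\<Sum>i\<in>UNIV. pd i g v * syzygy k e v i) = 0"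
proof
  let ?N = "of_nat :: nat \<Rightarrow> 'a"
  define A T C where "A = quadA k e v" and "T = quadT k e v / ?N (k + 1)" and "C = quadC k e v"
  have T: "quadT k e v = ?N (k + 1) * T" "ratio k * quadT k e v = ?N (k + 2) * T"
    using of_nat_plus_nonzero(1)[of k, where 'a = 'a] by (simp_all add: T_def ratio_def del: of_nat_add)
  have rel: "(v $ 1)\<^sup>2 * A + (?N (k + 2) * v $ 0 * v $ 1 + ?N (k + 1) * v $ 2 * v $ 3) * T + ?N (k + 3) * (v $ 2)\<^sup>2 * C = 0"
  proof -
    have "(ratio k * v $ 0 * v $ 1 + v $ 2 * v $ 3) * quadT k e v =
        v $ 0 * v $ 1 * (ratio k * quadT k e v) + v $ 2 * v $ 3 * quadT k e v"
      by (simp add: algebra_simps)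
    also have "\<dots> = (?N (k + 2) * v $ 0 * v $ 1 + ?N (k + 1) * v $ 2 * v $ 3) * T"
      unfolding T(2) unfolding T(1) by (simp add: algebra_simps)
    finally show ?thesis
      using quad_relation[of v k e] unfolding A_def[symmetric] C_def[symmetric] assms by simp
  qed
  have c0: "syzygy k e v 0 = v $ 2 ^ (k + 1) * A + ?N (k + 2) * v $ 0 * v $ 1 ^ k * T - ?N (k + 2) * v $ 0 * v $ 1 ^ k * C"
  proof -
    have "syzygy k e v 0 = v $ 2 ^ (k + 1) * A + v $ 0 * v $ 1 ^ k * (ratio k * quadT k e v) - ?N (k + 2) * v $ 0 * v $ 1 ^ k * C"
      by (simp add: syzygy_def A_def C_def mult_ac del: of_nat_add)
    then show ?thesis unfolding T(2) by (simp add: mult_ac del: of_nat_add)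
  qed
  have c1: "syzygy k e v 1 = (v $ 2 ^ (k + 1) - v $ 1 ^ (k + 1)) * T + v $ 1 ^ (k + 1) * C"
    by (simp add: syzygy_def T_def C_def del: of_nat_add)
  have c2: "syzygy k e v 2 = v $ 2 * v $ 1 ^ k * C" by (simp add: syzygy_def C_def)
  have c3: "syzygy k e v 3 = v $ 3 * (v $ 1 ^ k * (?N (k + 1) * T) - ?N (k + 2) * v $ 1 ^ k * C)"
    unfolding T(1)[symmetric] by (simp add: syzygy_def C_def)
  have "(\<Sum>i\<in>UNIV. pd i f v * syzygy k e v i) = v $ 1 ^ k * v $ 2 ^ (k + 1) *
     ((v $ 1)\<^sup>2 * A + (?N (k + 2) * v $ 0 * v $ 1 + ?N (k + 1) * v $ 2 * v $ 3) * T + ?N (k + 3) * (v $ 2)\<^sup>2 * C)"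
    unfolding jacobian_f c0 c1 c2 c3 by (simp add: algebra_simps power2_eq_square power_add eval_nat_numeral)
  then show "(\<Sum>i\<in>UNIV. pd i f v * syzygy k e v i) = 0" unfolding rel by simp
  show "(\<Sum>i\<in>UNIV. pd i g v * syzygy k e v i) = 0"
    unfolding jacobian_g c0 c1 c2 c3 by (simp add: algebra_simps)
qed

text \<open>
  The entries with index 2, 3 and 0 of the syzygy vanish; cancelling coordinates gives \<open>C = 0\<close>, then
  \<open>T = 0\<close> and \<open>A = 0\<close>, and \<open>contact_kernel\<close> applies.
\<close>

lemma syzygy_kernel:
  fixes e :: "4 \<Rightarrow> 'a ^ 4 \<Rightarrow> 'a"
  assumes V: "open V" "p \<in> V" and e: "\<And>l. sect 0 V (e l)"
    and zero: "\<And>v j. v \<in> cone V \<Longrightarrow> syzygy k (\<lambda>l. e l v) v j = 0"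
  obtains W \<mu> where "open W" "p \<in> W" "W \<subseteq> V" "sect (-1) W \<mu>"
    "\<And>v l. v \<in> cone W \<Longrightarrow> e l v = \<mu> v * contact k v l"
proof -
  let ?A = "\<lambda>v. quadA k (\<lambda>l. e l v) v" and ?T = "\<lambda>v. quadT k (\<lambda>l. e l v) v" and ?C = "\<lambda>v. quadC k (\<lambda>l. e l v) v"
  note r = sect_quad[OF V(1) e, of k, THEN rat_of_sect]
  define ones :: "'a ^ 4" where "ones = (\<chi> i. 1)"
  have C: "?C v = 0" if "v \<in> cone V" for v
  proof (rule rat_cancel[OF r(3), where P = "\<lambda>v. v $ 2 * v $ 1 ^ k" and w = ones])
    show "v $ 2 * v $ 1 ^ k * ?C v = 0" if "v \<in> cone V" for v
      using zero[OF that, of 2] by (simp add: syzygy_def)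
  qed (use that in \<open>auto simp: ones_def intro!: polyfun_intros\<close>)
  have T: "?T v = 0" if "v \<in> cone V" for v
  proof (rule rat_cancel[OF r(2), where P = "\<lambda>v. v $ 3 * v $ 1 ^ k" and w = ones])
    show "v $ 3 * v $ 1 ^ k * ?T v = 0" if "v \<in> cone V" for v
      using zero[OF that, of 3] C[OF that] by (simp add: syzygy_def)
  qed (use that in \<open>auto simp: ones_def intro!: polyfun_intros\<close>)
  have A: "?A v = 0" if "v \<in> cone V" for v
  proof (rule rat_cancel[OF r(1), where P = "\<lambda>v. v $ 2 ^ (k + 1)" and w = ones])
    show "v $ 2 ^ (k + 1) * ?A v = 0" if "v \<in> cone V" for v
      using zero[OF that, of 0] C[OF that] T[OF that] by (simp add: syzygy_def)
  qed (use that in \<open>auto simp: ones_def simp del: power_Suc intro!: polyfun_intros\<close>)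
  have e0: "sect 0 V (\<lambda>v. (1 / ratio k) * e 0 v)" by (rule sect_cmult[OF e V(1)])
  show thesis
  proof (rule contact_kernel[OF V ratio_nonzero e0 e e e])
    fix v assume v: "v \<in> cone V"
    show "v $ 2 * e 1 v = ratio k * v $ 0 * e 3 v" using A[OF v] by (simp add: quadA_def)
    show "v $ 2 * ((1 / ratio k) * e 0 v) = - (v $ 1 * e 3 v)"
      using T[OF v] by (simp add: quadT_def eq_neg_iff_add_eq_0 neg_eq_iff_add_eq_0 minus_equation_iff)
    show "v $ 3 * ((1 / ratio k) * e 0 v) = v $ 1 * e 2 v"
      using C[OF v] of_nat_plus_nonzero(3)[of k, where 'a = 'a] by (simp add: quadC_def del: of_nat_add)
  next
    fix W \<mu>
    assume W: "open W" "p \<in> W" "W \<subseteq> V" "sect (-1) W \<mu>"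
      and eq: "\<And>v. v \<in> cone W \<Longrightarrow> (1 / ratio k) * e 0 v = v $ 1 * \<mu> v \<and> e 1 v = - (ratio k * v $ 0 * \<mu> v) \<and>
        e 2 v = v $ 3 * \<mu> v \<and> e 3 v = - (v $ 2 * \<mu> v)"
    show thesis
    proof (rule that[OF W])
      fix v l assume v: "v \<in> cone W"
      have "e 0 v = ratio k * ((1 / ratio k) * e 0 v)" using ratio_nonzero[of k, where 'a = 'a] by simp
      also have "\<dots> = \<mu> v * (ratio k * v $ 1)" using eq[OF v] by simp
      finally have "\<forall>l. e l v = \<mu> v * contact k v l"
        unfolding all_4 using eq[OF v] by (simp add: contact_def)
      then show "e l v = \<mu> v * contact k v l" by blast
    qed
  qed
qed

lemma syzygy_surjective:
  assumes V: "open V" "p \<in> V" and \<beta>: "\<And>j. sect (int (k + 2)) V (\<beta> j)"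
    and jac: "\<And>v. v \<in> cone V \<Longrightarrow> (\<Sum>i\<in>UNIV. pd i f v * \<beta> i v) = 0 \<and> (\<Sum>i\<in>UNIV. pd i g v * \<beta> i v) = 0"
  obtains W e where "open W" "p \<in> W" "W \<subseteq> V" "\<And>l. sect 0 W (e l)"
    "\<And>v. v \<in> cone W \<Longrightarrow> (\<Sum>l\<in>UNIV. v $ l * e l v) = 0"
    "\<And>v j. v \<in> cone W \<Longrightarrow> syzygy k (\<lambda>l. e l v) v j = \<beta> j v"
proof -
  have \<beta>': "sect (int k + 2) V (\<beta> j)" for j using \<beta>[of j] by (simp add: add.commute)
  show thesis
  proof (rule jacobian_syzygy_reduce[OF V \<beta>' \<beta>' \<beta>' \<beta>', of 0 1 2 3])
    fix v assume v: "v \<in> cone V"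
    show "v $ 1 ^ (k + 2) * \<beta> 0 v + of_nat (k + 2) * v $ 0 * v $ 1 ^ (k + 1) * \<beta> 1 v +
      (of_nat (k + 3) * v $ 2 ^ (k + 2) + of_nat (k + 2) * v $ 2 ^ (k + 1) * v $ 3) * \<beta> 2 v
      + v $ 2 ^ (k + 2) * \<beta> 3 v = 0"
      using jac[OF v] unfolding jacobian_f[of v "\<lambda>i. \<beta> i v"] by blast
    show "- of_nat (k + 1) * v $ 2 * v $ 3 * v $ 1 ^ k * \<beta> 1 v +
      v $ 3 * (of_nat (k + 2) * v $ 2 ^ (k + 1) - v $ 1 ^ (k + 1)) * \<beta> 2 v
      + v $ 2 * (v $ 2 ^ (k + 1) - v $ 1 ^ (k + 1)) * \<beta> 3 v = 0"
      using jac[OF v] unfolding jacobian_g[of v "\<lambda>i. \<beta> i v"] by blast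
  next
    fix W A T C
    assume W: "open W" "p \<in> W" "W \<subseteq> V" and s: "sect 1 W A" "sect 1 W T" "sect 1 W C"
      and rel: "\<And>v. v \<in> cone W \<Longrightarrow> (v $ 1)\<^sup>2 * A v + (of_nat (k + 2) / of_nat (k + 1) * v $ 0 * v $ 1 + v $ 2 * v $ 3) * T v
        + of_nat (k + 3) * (v $ 2)\<^sup>2 * C v = 0"
      and b: "\<And>v. v \<in> cone W \<Longrightarrow> \<beta> 0 v = v $ 2 ^ (k + 1) * A v + of_nat (k + 2) / of_nat (k + 1) * v $ 0 * v $ 1 ^ k * T v
        - of_nat (k + 2) * v $ 0 * v $ 1 ^ k * C v"
      "\<And>v. v \<in> cone W \<Longrightarrow> \<beta> 1 v = (v $ 2 ^ (k + 1) - v $ 1 ^ (k + 1)) * T v / of_nat (k + 1) + v $ 1 ^ (k + 1) * C v"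
      "\<And>v. v \<in> cone W \<Longrightarrow> \<beta> 2 v = v $ 2 * v $ 1 ^ k * C v"
      "\<And>v. v \<in> cone W \<Longrightarrow> \<beta> 3 v = v $ 3 * (v $ 1 ^ k * T v - of_nat (k + 2) * v $ 1 ^ k * C v)"
    note rel = rel[folded ratio_def] and b = b(1)[folded ratio_def] b(2-4)
    show thesis
    proof (rule quadric_syzygy_lift[OF W(1,2) ratio_nonzero s(1,2) sect_cmult[OF s(3) W(1), of "of_nat (k + 3)"]])
      show "(v $ 1)\<^sup>2 * A v + (ratio k * v $ 0 * v $ 1 + v $ 2 * v $ 3) * T v + (v $ 2)\<^sup>2 * (of_nat (k + 3) * C v) = 0"
        if "v \<in> cone W" for v using rel[OF that] by (simp add: mult_ac del: of_nat_add)
    next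
      fix W' e0 e1 e2 e3
      assume W': "open W'" "p \<in> W'" "W' \<subseteq> W" and se: "sect 0 W' e0" "sect 0 W' e1" "sect 0 W' e2" "sect 0 W' e3"
        and eul: "\<And>v. v \<in> cone W' \<Longrightarrow> ratio k * v $ 0 * e0 v + v $ 1 * e1 v + v $ 2 * e2 v + v $ 3 * e3 v = 0"
        and A: "\<And>v. v \<in> cone W' \<Longrightarrow> A v = - v $ 2 * e1 v + ratio k * v $ 0 * e3 v"
        and T: "\<And>v. v \<in> cone W' \<Longrightarrow> T v = - v $ 2 * e0 v - v $ 1 * e3 v"
        and C: "\<And>v. v \<in> cone W' \<Longrightarrow> of_nat (k + 3) * C v = v $ 3 * e0 v - v $ 1 * e2 v"
      define e where "e l = (if l = 0 then (\<lambda>v. ratio k * e0 v) else if l = 1 then e1 else if l = 2 then e2 else e3)" for l :: 4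
      show thesis
      proof (rule that[of W' e])
        show "sect 0 W' (e l)" for l using se W'(1) by (simp add: e_def sect_cmult)
        show "W' \<subseteq> V" using W' W by blast
        show "(\<Sum>l\<in>UNIV. v $ l * e l v) = 0" if "v \<in> cone W'" for v
          using eul[OF that] by (simp add: sum_4 e_def mult_ac)
        fix v j assume v: "v \<in> cone W'"
        have vW: "v \<in> cone W" using v cone_mono[OF W'(3)] by blast
        have "quadA k (\<lambda>l. e l v) v = A v" by (simp add: quadA_def e_def A[OF v])
        moreover have "quadT k (\<lambda>l. e l v) v = T v"
          using ratio_nonzero[of k, where 'a = 'a] by (simp add: quadT_def e_def T[OF v])
        moreover have "quadC k (\<lambda>l. e l v) v = C v"
        proof -
          have "quadC k (\<lambda>l. e l v) v = (of_nat (k + 3) * C v) / of_nat (k + 3)"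
            unfolding C[OF v] using ratio_nonzero[of k, where 'a = 'a] by (simp add: quadC_def e_def)
          then show ?thesis using of_nat_plus_nonzero(3)[of k, where 'a = 'a] by (simp del: of_nat_add)
        qed
        ultimately have "\<forall>j. syzygy k (\<lambda>l. e l v) v j = \<beta> j v"
          unfolding all_4 by (simp add: syzygy_def b[OF vW] del: of_nat_add)
        then show "syzygy k (\<lambda>l. e l v) v j = \<beta> j v" by blast
      qed (use W' in auto)
    qed
  qed
qed

end

lemma O_sheaf_simps:
  "s \<in> sec (O_sheaf d) U \<longleftrightarrow> s \<in> extensional (cone U) \<and> sect d U s"
  "s \<oplus>\<^bsub>sections (O_sheaf d) U\<^esub> t = (\<lambda>v\<in>cone U. s v + t v)"
  "a \<odot>\<^bsub>sections (O_sheaf d) U\<^esub> s = (\<lambda>v\<in>cone U. a (pt v) * s v)"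
  "res (O_sheaf d) U V s = restrict s (cone V)"
  by (simp_all add: O_sheaf_def mk_module_def sect_def)

lemma of_form_coeff_cong:
  assumes "\<And>l v. v \<in> cone U \<Longrightarrow> \<eta> l v = \<eta>' l v"
  shows "of_form_coeff \<eta> U = of_form_coeff \<eta>' U"
  using assms by (auto simp: of_form_coeff_def chart_form_def restrict_def fun_eq_iff intro!: sum.cong)

lemma of_cone_coeff_cong:
  assumes "\<And>l v. v \<in> cone U \<Longrightarrow> \<beta> l v = \<beta>' l v"
  shows "of_cone_coeff m \<beta> U = of_cone_coeff m \<beta>' U"
  using assms by (auto simp: of_cone_coeff_def restrict_def fun_eq_iff)

lemma res_of_form_coeff:
  assumes "V \<subseteq> U"
  shows "res (twist 1 Omega1) U V (of_form_coeff \<eta> U) = of_form_coeff \<eta> V"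
  using assms by (auto simp: Omega1_simps of_form_coeff_def chart_form_def restrict_def fun_eq_iff)

lemma res_of_cone_coeff:
  assumes "V \<subseteq> U"
  shows "res (twist d (T_sheaf k \<sigma>)) U V (of_cone_coeff m \<beta> U) = of_cone_coeff m \<beta> V"
  using assms by (auto simp: T_sheaf_simps of_cone_coeff_def restrict_def fun_eq_iff)

lemma form_coeff_simps:
  fixes b :: "4 \<Rightarrow> 'a::field_char_0 proj3 \<Rightarrow> (('a proj3 \<Rightarrow> 'a) \<Rightarrow> 'a) \<Rightarrow> 'a"
  assumes v: "v \<in> cone U"
  shows "form_coeff (b \<oplus>\<^bsub>sections (twist 1 Omega1) U\<^esub> b') l v = form_coeff b l v + form_coeff b' l v"
    and "form_coeff (a \<odot>\<^bsub>sections (twist 1 Omega1) U\<^esub> b) l v = a (pt v) * form_coeff b l v"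
    and "form_coeff (res (twist 1 Omega1) W U b) l v = form_coeff b l v"
proof -
  have v0: "v \<noteq> 0" "pt v \<in> U" using v by (auto simp: cone_def)
  then obtain i where i: "v $ i \<noteq> 0" by (auto simp: vec_eq_iff)
  define j where "j = (SOME i. v $ i \<noteq> 0)"
  have "v $ j \<noteq> 0" unfolding j_def by (rule someI[of _ i]) (rule i)
  then have "pt v \<in> U \<inter> chart j" "Dir v l \<in> tangent_space (pt v)"
    using v0 by (auto simp: pt_in_chart Dir_in_tangent_space)
  then show "form_coeff (b \<oplus>\<^bsub>sections (twist 1 Omega1) U\<^esub> b') l v = form_coeff b l v + form_coeff b' l v"
    "form_coeff (a \<odot>\<^bsub>sections (twist 1 Omega1) U\<^esub> b) l v = a (pt v) * form_coeff b l v"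
    "form_coeff (res (twist 1 Omega1) W U b) l v = form_coeff b l v"
    by (simp_all add: form_coeff_def Let_def j_def[symmetric] Omega1_simps distrib_left)
qed

text \<open>
  Evaluation at a tangent vector at \<open>p\<close> is additive. It will detect that a section is nonzero in the
  fibre at \<open>p\<close>.
\<close>

lemma twist_Omega1_finsum_zero:
  fixes t :: "nat \<Rightarrow> 4 \<Rightarrow> 'a::field_char_0 proj3 \<Rightarrow> (('a proj3 \<Rightarrow> 'a) \<Rightarrow> 'a) \<Rightarrow> 'a"
  assumes V: "open V" and p: "p \<in> V" "p \<in> chart i" and D: "D \<in> tangent_space p"
    and t: "\<And>j. j < n \<Longrightarrow> t j \<in> sec (twist 1 Omega1) V" "\<And>j. j < n \<Longrightarrow> t j i p D = 0"
  shows "finsum (sections (twist 1 Omega1) V) t {..<n} i p D = 0"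
proof -
  interpret M: Module.module "structure_ring V" "sections (twist 1 Omega1) V"
    by (rule module_presheaf.sections_module[OF Omega1.module_presheaf_twist V])
  show ?thesis
    using t
  proof (induction n)
    case 0 then show ?case using p D by (simp add: Omega1_simps)
  next
    case (Suc n)
    have "finsum (sections (twist 1 Omega1) V) t {..<Suc n} =
        t n \<oplus>\<^bsub>sections (twist 1 Omega1) V\<^esub> finsum (sections (twist 1 Omega1) V) t {..<n}"
      unfolding lessThan_Suc using Suc.prems by (intro M.finsum_insert) auto
    then show ?case using Suc p D by (simp add: Omega1_simps)
  qed
qed

context pencil
begin

definition contact_map :: "'a proj3 set \<Rightarrow> ('a ^ 4 \<Rightarrow> 'a) \<Rightarrow> 4 \<Rightarrow> 'a proj3 \<Rightarrow> (('a proj3 \<Rightarrow> 'a) \<Rightarrow> 'a) \<Rightarrow> 'a" where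
  "contact_map U \<mu> = of_form_coeff (\<lambda>l v. \<mu> v * contact k v l) U"

definition nc_bundle :: "('a, 4 \<Rightarrow> 4 \<Rightarrow> 'a proj3 \<Rightarrow> 'a) presheaf" where
  "nc_bundle = twist (int (k + 2)) (T_sheaf k (f, g))"

definition syzygy_map :: "'a proj3 set \<Rightarrow> (4 \<Rightarrow> 'a proj3 \<Rightarrow> (('a proj3 \<Rightarrow> 'a) \<Rightarrow> 'a) \<Rightarrow> 'a) \<Rightarrow> 4 \<Rightarrow> 4 \<Rightarrow> 'a proj3 \<Rightarrow> 'a" where
  "syzygy_map U b = of_cone_coeff (k + 2) (\<lambda>j v. syzygy k (\<lambda>l. form_coeff b l v) v j) U"

lemma contact_coeff:
  assumes U: "open U" and \<mu>: "sect (-1) U \<mu>"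
  shows "sect 0 U (\<lambda>v. \<mu> v * contact k v l)" "(\<Sum>l\<in>UNIV. v $ l * (\<mu> v * contact k v l)) = 0"
proof -
  show "sect 0 U (\<lambda>v. \<mu> v * contact k v l)"
    using sect_mult[OF \<mu> sect_contact[OF U] U] by simp
  have "(\<Sum>l\<in>UNIV. v $ l * (\<mu> v * contact k v l)) = \<mu> v * (\<Sum>l\<in>UNIV. v $ l * contact k v l)"
    by (simp add: sum_distrib_left mult_ac)
  then show "(\<Sum>l\<in>UNIV. v $ l * (\<mu> v * contact k v l)) = 0" by (simp add: contact_euler)
qed

lemma contact_map_closed: "open U \<Longrightarrow> sect (-1) U \<mu> \<Longrightarrow> contact_map U \<mu> \<in> sec (twist 1 Omega1) U"
  unfolding contact_map_def by (rule of_form_coeff_in_twist) (simp_all add: contact_coeff)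

lemma form_coeff_contact_map:
  "open U \<Longrightarrow> sect (-1) U \<mu> \<Longrightarrow> v \<in> cone U \<Longrightarrow> form_coeff (contact_map U \<mu>) l v = \<mu> v * contact k v l"
  unfolding contact_map_def by (rule form_coeff_of_form_coeff) (simp_all add: contact_coeff)

lemma contact_map_morphism: "sheaf_morphism (O_sheaf (-1)) (twist 1 Omega1) contact_map"
  unfolding sheaf_morphism_def
proof (intro conjI allI impI ballI)
  fix U :: "'a proj3 set" assume U: "open U"
  show "contact_map U \<in> sec (O_sheaf (-1)) U \<rightarrow> sec (twist 1 Omega1) U"
    using contact_map_closed[OF U] by (auto simp: O_sheaf_simps)
  fix s t assume "s \<in> sec (O_sheaf (-1)) U" "t \<in> sec (O_sheaf (-1)) U"
  show "contact_map U (s \<oplus>\<^bsub>sections (O_sheaf (-1)) U\<^esub> t) =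
      contact_map U s \<oplus>\<^bsub>sections (twist 1 Omega1) U\<^esub> contact_map U t"
    by (auto simp: contact_map_def of_form_coeff_def chart_form_def O_sheaf_simps Omega1_simps fun_eq_iff restrict_def
        distrib_right sum.distrib)
next
  fix U :: "'a proj3 set" and a s assume U: "open U" and "s \<in> sec (O_sheaf (-1)) U"
  show "contact_map U (a \<odot>\<^bsub>sections (O_sheaf (-1)) U\<^esub> s) = a \<odot>\<^bsub>sections (twist 1 Omega1) U\<^esub> contact_map U s"
    by (auto simp: contact_map_def of_form_coeff_def chart_form_def O_sheaf_simps Omega1_simps fun_eq_iff restrict_def
        sum_distrib_left mult.assoc)
next
  fix U V :: "'a proj3 set" and s assume UV: "open U \<and> open V \<and> V \<subseteq> U" and "s \<in> sec (O_sheaf (-1)) U"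
  have "res (twist 1 Omega1) U V (contact_map U s) = of_form_coeff (\<lambda>l v. s v * contact k v l) V"
    unfolding contact_map_def using UV by (intro res_of_form_coeff) blast
  also have "\<dots> = contact_map V (res (O_sheaf (-1)) U V s)"
    unfolding contact_map_def O_sheaf_simps by (rule of_form_coeff_cong) simp
  finally show "res (twist 1 Omega1) U V (contact_map U s) = contact_map V (res (O_sheaf (-1)) U V s)" .
qed

text \<open>
  A section that vanishes in the fibre at \<open>p\<close> takes the value zero at all tangent vectors at \<open>p\<close>. At the
  tangent vectors \<open>Dir v l\<close> the contact form takes its coefficients as values, up to a nonzero factor,
  and these have no common zero.
\<close>

lemma contact_map_nowhere_vanishing: "nowhere_vanishing (O_sheaf (-1)) (twist 1 Omega1) contact_map"
  unfolding nowhere_vanishing_def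
proof
  fix p :: "'a proj3"
  obtain i where i: "p \<in> chart i" using ex_chart by blast
  let ?U = "chart i" and ?v = "rep_proj3 p"
  let ?\<mu> = "\<lambda>v\<in>cone ?U. 1 / v $ i"
  have U: "open ?U" by simp
  have \<mu>: "sect (-1) ?U ?\<mu>"
    by (rule iffD1[OF sect_cong sect_inverse_coord[OF U order_refl]]) simp
  have "\<not> vanishes_at (twist 1 Omega1) ?U (contact_map ?U ?\<mu>) p"
  proof
    assume "vanishes_at (twist 1 Omega1) ?U (contact_map ?U ?\<mu>) p"
    then obtain V n a t where V: "open V" "p \<in> V" "V \<subseteq> ?U"
      and at: "\<forall>j<n::nat. a j \<in> carrier (structure_ring V) \<and> a j p = 0 \<and> t j \<in> sec (twist 1 Omega1) V"
      and eq: "res (twist 1 Omega1) ?U V (contact_map ?U ?\<mu>) =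
        finsum (sections (twist 1 Omega1) V) (\<lambda>j. a j \<odot>\<^bsub>sections (twist 1 Omega1) V\<^esub> t j) {..<n}"
      unfolding vanishes_at_def by (elim exE conjE) (rule that)
    have v: "?v \<in> cone V" "?v $ i \<noteq> 0" "?v \<in> cone ?U" "?v \<noteq> 0" using V i by (auto simp: in_chart_iff rep_proj3_nonzero)
    have "contact k ?v l = 0" for l
    proof -
      have D: "Dir ?v l \<in> tangent_space p" using Dir_in_tangent_space[OF rep_proj3_nonzero, of p l] by simp
      have cl: "a j \<odot>\<^bsub>sections (twist 1 Omega1) V\<^esub> t j \<in> sec (twist 1 Omega1) V" if "j < n" for j
        using at that by (intro module_presheaf.smult_closed[OF Omega1.module_presheaf_twist V(1)]) auto
      have "finsum (sections (twist 1 Omega1) V) (\<lambda>j. a j \<odot>\<^bsub>sections (twist 1 Omega1) V\<^esub> t j) {..<n} i p (Dir ?v l) = 0"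
        by (rule twist_Omega1_finsum_zero[OF V(1,2) i D cl])
           (use at V(2) i D in \<open>simp_all add: Omega1_simps\<close>)
      then have "res (twist 1 Omega1) ?U V (contact_map ?U ?\<mu>) i p (Dir ?v l) = 0" by (simp only: eq)
      then have "contact_map ?U ?\<mu> i p (Dir ?v l) = 0" using V(2) i by (simp add: Omega1_simps)
      then have "form_coeff (contact_map ?U ?\<mu>) l ?v = 0"
        using form_coeff_eq[OF U contact_map_closed[OF U \<mu>] v(3,2), of l] by simp
      then show ?thesis using form_coeff_contact_map[OF U \<mu> v(3), of l] v(2,3) by simp
    qed
    then show False using contact_nonzero[OF v(4), of k] by blast
  qed
  then show "\<exists>U. open U \<and> p \<in> U \<and> (\<exists>s\<in>sec (O_sheaf (-1)) U. \<not> vanishes_at (twist 1 Omega1) U (contact_map U s) p)"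
    using U i \<mu> by (intro exI[of _ ?U] conjI bexI[of _ ?\<mu>]) (simp_all add: O_sheaf_simps)
qed

lemma syzygy_map_coeff:
  assumes U: "open U" and b: "b \<in> sec (twist 1 Omega1) U"
  shows "sect (int (k + 2)) U (\<lambda>v. syzygy k (\<lambda>l. form_coeff b l v) v j)"
    and "v \<in> cone U \<Longrightarrow> (\<Sum>i\<in>UNIV. pd i f v * syzygy k (\<lambda>l. form_coeff b l v) v i) = 0 \<and>
      (\<Sum>i\<in>UNIV. pd i g v * syzygy k (\<lambda>l. form_coeff b l v) v i) = 0"
  by (rule sect_syzygy[OF U sect_form_coeff[OF U b]])
     (rule jacobian_syzygy, rule form_coeff_euler[OF U b])

lemma syzygy_map_closed: "open U \<Longrightarrow> b \<in> sec (twist 1 Omega1) U \<Longrightarrow> syzygy_map U b \<in> sec nc_bundle U"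
  unfolding syzygy_map_def nc_bundle_def by (rule of_cone_coeff_in_twist) (assumption, rule syzygy_map_coeff, assumption+, rule syzygy_map_coeff)

lemma syzygy_map_morphism: "sheaf_morphism (twist 1 Omega1) nc_bundle syzygy_map"
  unfolding sheaf_morphism_def
proof (intro conjI allI impI ballI)
  fix U :: "'a proj3 set" assume U: "open U"
  show "syzygy_map U \<in> sec (twist 1 Omega1) U \<rightarrow> sec nc_bundle U" using syzygy_map_closed[OF U] by blast
  fix b c assume "b \<in> sec (twist 1 Omega1) U" "c \<in> sec (twist 1 Omega1) U"
  have "syzygy_map U (b \<oplus>\<^bsub>sections (twist 1 Omega1) U\<^esub> c) =
      of_cone_coeff (k + 2) (\<lambda>j v. syzygy k (\<lambda>l. form_coeff b l v) v j + syzygy k (\<lambda>l. form_coeff c l v) v j) U"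
    unfolding syzygy_map_def syzygy_add[symmetric] by (rule of_cone_coeff_cong) (simp only: form_coeff_simps)
  also have "\<dots> = syzygy_map U b \<oplus>\<^bsub>sections nc_bundle U\<^esub> syzygy_map U c"
    by (auto simp: syzygy_map_def nc_bundle_def of_cone_coeff_def T_sheaf_simps fun_eq_iff restrict_def add_divide_distrib)
  finally show "syzygy_map U (b \<oplus>\<^bsub>sections (twist 1 Omega1) U\<^esub> c) = syzygy_map U b \<oplus>\<^bsub>sections nc_bundle U\<^esub> syzygy_map U c" .
next
  fix U :: "'a proj3 set" and a b assume U: "open U" and "b \<in> sec (twist 1 Omega1) U"
  have "syzygy_map U (a \<odot>\<^bsub>sections (twist 1 Omega1) U\<^esub> b) =
      of_cone_coeff (k + 2) (\<lambda>j v. a (pt v) * syzygy k (\<lambda>l. form_coeff b l v) v j) U"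
    unfolding syzygy_map_def syzygy_scale[symmetric] by (rule of_cone_coeff_cong) (simp only: form_coeff_simps)
  also have "\<dots> = a \<odot>\<^bsub>sections nc_bundle U\<^esub> syzygy_map U b"
    by (auto simp: syzygy_map_def nc_bundle_def of_cone_coeff_def T_sheaf_simps fun_eq_iff restrict_def)
  finally show "syzygy_map U (a \<odot>\<^bsub>sections (twist 1 Omega1) U\<^esub> b) = a \<odot>\<^bsub>sections nc_bundle U\<^esub> syzygy_map U b" .
next
  fix U V :: "'a proj3 set" and b assume UV: "open U \<and> open V \<and> V \<subseteq> U" and "b \<in> sec (twist 1 Omega1) U"
  have "res nc_bundle U V (syzygy_map U b) = of_cone_coeff (k + 2) (\<lambda>j v. syzygy k (\<lambda>l. form_coeff b l v) v j) V"
    unfolding syzygy_map_def nc_bundle_def using UV by (intro res_of_cone_coeff) blast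
  also have "\<dots> = syzygy_map V (res (twist 1 Omega1) U V b)"
    unfolding syzygy_map_def by (rule of_cone_coeff_cong) (simp only: form_coeff_simps)
  finally show "res nc_bundle U V (syzygy_map U b) = syzygy_map V (res (twist 1 Omega1) U V b)" .
qed

lemma syzygy_map_eq_zero_iff:
  assumes U: "open U" and b: "b \<in> sec (twist 1 Omega1) U"
  shows "syzygy_map U b = \<zero>\<^bsub>sections nc_bundle U\<^esub> \<longleftrightarrow> (\<forall>v\<in>cone U. \<forall>j. syzygy k (\<lambda>l. form_coeff b l v) v j = 0)"
proof
  assume eq: "syzygy_map U b = \<zero>\<^bsub>sections nc_bundle U\<^esub>"
  show "\<forall>v\<in>cone U. \<forall>j. syzygy k (\<lambda>l. form_coeff b l v) v j = 0"
  proof (intro ballI allI)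
    fix v j assume v: "v \<in> cone U"
    then have v0: "v \<noteq> 0" "pt v \<in> U" by (auto simp: cone_def)
    then obtain i where i: "v $ i \<noteq> 0" by (auto simp: vec_eq_iff)
    have "syzygy_map U b i j (pt v) = 0"
      unfolding eq nc_bundle_def using v0 i by (simp add: T_sheaf_simps pt_in_chart)
    then show "syzygy k (\<lambda>l. form_coeff b l v) v j = 0"
      unfolding syzygy_map_def of_cone_coeff_pt[where \<beta> = "\<lambda>j v. syzygy k (\<lambda>l. form_coeff b l v) v j", OF syzygy_map_coeff(1)[OF U b] v i]
      using i by simp
  qed
next
  assume "\<forall>v\<in>cone U. \<forall>j. syzygy k (\<lambda>l. form_coeff b l v) v j = 0"
  then have "syzygy_map U b = of_cone_coeff (k + 2) (\<lambda>j v. 0) U"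
    unfolding syzygy_map_def by (intro of_cone_coeff_cong) auto
  then show "syzygy_map U b = \<zero>\<^bsub>sections nc_bundle U\<^esub>"
    by (auto simp: nc_bundle_def of_cone_coeff_def T_sheaf_simps fun_eq_iff)
qed

text \<open>
  \<open>syzygy_surjective\<close> gives local surjectivity and \<open>syzygy_kernel\<close> the local description of the kernel,
  after both sheaves have been replaced by vectors of functions on the cone.
\<close>

lemma syzygy_map_cokernel: "is_cokernel (O_sheaf (-1)) (twist 1 Omega1) contact_map nc_bundle"
  unfolding is_cokernel_def
proof (intro conjI exI[of _ syzygy_map] allI impI ballI)
  show "sheaf_of_modules nc_bundle" unfolding nc_bundle_def by (rule T_sheaf.sheaf_twist)
  show "sheaf_morphism (twist 1 Omega1) nc_bundle syzygy_map" by (rule syzygy_map_morphism)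
next
  fix U :: "'a proj3 set" and t p assume U: "open U" and t: "t \<in> sec nc_bundle U" and p: "p \<in> U"
  note t = t[unfolded nc_bundle_def]
  note T = twist_T_sheaf_cone[OF U t]
  obtain V e where V: "open V" "p \<in> V" "V \<subseteq> U" and e: "\<And>l. sect 0 V (e l)"
    "\<And>v. v \<in> cone V \<Longrightarrow> (\<Sum>l\<in>UNIV. v $ l * e l v) = 0"
    and eq: "\<And>v j. v \<in> cone V \<Longrightarrow> syzygy k (\<lambda>l. e l v) v j = cone_coeff (k + 2) t j v"
  proof (rule syzygy_surjective[OF U p T(2,3)], goal_cases)
    case (2 W e)
    show ?case by (rule 2(1)[OF 2(2-)])
  qed
  have eV: "form_coeff (of_form_coeff e V) l v = e l v" if "v \<in> cone V" for l v
    by (rule form_coeff_of_form_coeff[OF V(1) e that])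
  have "syzygy_map V (of_form_coeff e V) = of_cone_coeff (k + 2) (cone_coeff (k + 2) t) V"
    unfolding syzygy_map_def
  proof (rule of_cone_coeff_cong)
    fix j v assume v: "v \<in> cone V"
    show "syzygy k (\<lambda>l. form_coeff (of_form_coeff e V) l v) v j = cone_coeff (k + 2) t j v"
      unfolding eV[OF v] by (rule eq[OF v])
  qed
  also have "\<dots> = res nc_bundle U V t"
    unfolding nc_bundle_def by (subst T(4)) (rule res_of_cone_coeff[OF V(3), symmetric])
  finally show "\<exists>V. open V \<and> p \<in> V \<and> V \<subseteq> U \<and> (\<exists>b\<in>sec (twist 1 Omega1) V. syzygy_map V b = res nc_bundle U V t)"
    using V of_form_coeff_in_twist[OF V(1) e] by blast
next
  fix U :: "'a proj3 set" and b assume U: "open U" and b: "b \<in> sec (twist 1 Omega1) U"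
  note B = twist_Omega1_cone[OF U b]
  show "syzygy_map U b = \<zero>\<^bsub>sections nc_bundle U\<^esub> \<longleftrightarrow>
      (\<forall>p\<in>U. \<exists>V. open V \<and> p \<in> V \<and> V \<subseteq> U \<and> (\<exists>a\<in>sec (O_sheaf (-1)) V. contact_map V a = res (twist 1 Omega1) U V b))"
    unfolding syzygy_map_eq_zero_iff[OF U b]
  proof (intro iffI ballI allI)
    fix p assume zero: "\<forall>v\<in>cone U. \<forall>j. syzygy k (\<lambda>l. form_coeff b l v) v j = 0" and p: "p \<in> U"
    obtain W \<mu> where W: "open W" "p \<in> W" "W \<subseteq> U" "sect (-1) W \<mu>"
      and eq: "\<And>v l. v \<in> cone W \<Longrightarrow> form_coeff b l v = \<mu> v * contact k v l"
    proof (rule syzygy_kernel[OF U p B(2) zero[rule_format]], goal_cases)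
      case (2 W \<mu>)
      show ?case by (rule 2(1)[OF 2(2-)])
    qed
    let ?a = "restrict \<mu> (cone W)"
    have "sect (-1) W ?a" by (rule iffD1[OF sect_cong W(4)]) simp
    then have a: "?a \<in> sec (O_sheaf (-1)) W" by (simp add: O_sheaf_simps)
    have "contact_map W ?a = of_form_coeff (form_coeff b) W"
      unfolding contact_map_def by (rule of_form_coeff_cong) (simp add: eq)
    also have "\<dots> = res (twist 1 Omega1) U W b"
      by (subst (2) B(4)) (rule res_of_form_coeff[OF W(3), symmetric])
    finally show "\<exists>V. open V \<and> p \<in> V \<and> V \<subseteq> U \<and> (\<exists>a\<in>sec (O_sheaf (-1)) V. contact_map V a = res (twist 1 Omega1) U V b)"
      using W a by blast
  next
    fix v j
    assume loc: "\<forall>p\<in>U. \<exists>V. open V \<and> p \<in> V \<and> V \<subseteq> U \<and>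
        (\<exists>a\<in>sec (O_sheaf (-1)) V. contact_map V a = res (twist 1 Omega1) U V b)" and v: "v \<in> cone U"
    have v0: "v \<noteq> 0" "pt v \<in> U" using v by (auto simp: cone_def)
    obtain V a where V: "open V" "pt v \<in> V" "V \<subseteq> U" and a: "a \<in> sec (O_sheaf (-1)) V"
      and eq: "contact_map V a = res (twist 1 Omega1) U V b"
      using bspec[OF loc v0(2)] by blast
    have vV: "v \<in> cone V" using v0 V by (simp add: cone_def)
    have "form_coeff b l v = a v * contact k v l" for l
      using form_coeff_contact_map[OF V(1) _ vV, of a l] a form_coeff_simps(3)[OF vV, of U b l]
      unfolding eq by (simp only: O_sheaf_simps)
    then show "syzygy k (\<lambda>l. form_coeff b l v) v j = 0" by (simp add: syzygy_scale syzygy_contact)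
  qed
qed

lemma null_correlation_nc_bundle: "null_correlation_bundle nc_bundle"
  unfolding null_correlation_bundle_def
  using contact_map_morphism contact_map_nowhere_vanishing syzygy_map_cokernel by blast

lemma T_sheaf_iso: "T_sheaf k (f, g) \<simeq>\<^sub>s twist (- int k - 2) nc_bundle"
proof -
  have "- int k - 2 = - int (k + 2)" by simp
  then show ?thesis
    using T_sheaf.twist_untwist[of k f g "int (k + 2)"] unfolding nc_bundle_def by metis
qed

end

theorem theorem5:
  fixes k :: nat
    and f g :: "'a::{alg_closed_field, field_char_0} poly4"
  assumes "f = X 0 * X 1 ^ (k + 2) + X 2 ^ (k + 3) + X 2 ^ (k + 2) * X 3"
    and "g = X 2 * X 3 * (X 2 ^ (k + 1) - X 1 ^ (k + 1))"
  shows "\<exists>N :: ('a, 4 \<Rightarrow> 4 \<Rightarrow> 'a proj3 \<Rightarrow> 'a) presheaf.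
    null_correlation_bundle N \<and> T_sheaf k (f, g) \<simeq>\<^sub>s twist (- int k - 2) N"
proof -
  interpret pencil k f g by unfold_locales (rule assms)+
  show ?thesis using null_correlation_nc_bundle T_sheaf_iso by blast
qed

end
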